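(* For every sequence number $s$, if $B_0\underline{s} =_{\omega} B_1\underline{s}$, then the subtree $T(s)$ of $T$ rooted at $s$ is well founded.
   Context: Untyped $\lambda$-calculus; $[N/x]U$ is capture-avoiding substitution; $\underline{k}$ is the $k$-th Church numeral; $\mathbf{\Omega} \equiv (\lambda x.xx)(\lambda x.xx)$; $\mathbf{K^*} \equiv \lambda ab.b$; a closed term is unsolvable if no application of it to closed terms $\beta$-converts to $\lambda x.x$. The relation $=_{\omega}$ on closed terms is the least relation containing $M=_\omega M$, $(\lambda x.U)N =_{\omega} [N/x]U$ and its symmetric version for closed $(\lambda x.U)N$, $M=_\omega\mathbf{\Omega}$ and $\mathbf{\Omega}=_\omega M$ for closed unsolvable $M$, closed under the Leibniz rule (from $[M/z]X =_{\omega} [M/z]Y$ and $M =_{\omega} N$, with $X,Y$ having at most $z$ free, infer $[N/z]X =_{\omega} [N/z]Y$) and the $\omega$-rule (from $PM=_\omega QM$ for all closed $M$ infer $P=_\omega Q$). Fix an effective coding of finite sequences of natural numbers by natural numbers ("sequence numbers"); $s' < s$ means $s'$ is a proper initial subsequence of $s$; $\bar f(m)$ is the code of $\langle f(0),\dots,f(m-1)\rangle$. Fix a $\mathbf{\Pi^1_1}$ predicate $P(n) \Leftrightarrow \forall f\,\exists m\, R(\bar f(m), n)$ with $R$ recursive, and fix $n$. $s$ is $n$-unsecured if there is no $s'<s$ with $R(s',n)$; $T$ is the (recursive) tree of $n$-unsecured sequence numbers; $T(s)$ is the set of elements of $T$ extending $s$ (empty if $s\notin T$); a tree is well founded if it has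 no infinite strictly increasing chain. Let $*$ be a closed term (written infix) representing concatenation of sequence numbers such that $\underline{s}*z$ has a $\beta\mathbf{\Omega}$-normal form beginning with $z$, and let $x^{+}$ denote a closed successor term applied to $x$. Let $D$ be a closed term such that: for every numeral $\underline{m}$, $Dx\underline{m}$ has a $\beta\mathbf{\Omega}$-normal form beginning with $x$ and containing $\underline{m}$; $D\underline{s} =_\omega \mathbf{K^*}$ if $s\in T$ and $D\underline{s}=_\omega \mathbf{\Omega}$ otherwise; and if $s\in T$ then $D\underline{s}$ reduces to $\mathbf{K^*}$ by head $\beta$-reductions whose redexes are closed. Write $[A,B] \equiv \lambda z.zAB$. Define $\mathbf{\Theta} \equiv (\lambda ab.b(aab))(\lambda ab.b(aab))$, and for $i=0,1$: $F_i \equiv \lambda wxy.\, Dx\underline{i}(\lambda ab.b(aab))(\lambda ab.b(aab))(\lambda axf.[fx,\ x(\lambda u.u\mathbf{\Omega})y(a(x^{+})f)])\underline{0}(\lambda z.w(x*z))$ and $B_i \equiv \mathbf{\Theta}F_i$. *)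

theory Defs
  imports "HOL-Library.Sublist"
begin

section \<open>Untyped lambda terms\<close>

text \<open>De Bruijn terms, so that syntactic identity is identity up to renaming of bound variables.\<close>

datatype trm =
    Var nat
  | App trm trm (infixl "\<cdot>" 200)
  | Abs trm

primrec lift :: "trm \<Rightarrow> nat \<Rightarrow> trm" where
  "lift (Var i) k = (if i < k then Var i else Var (Suc i))"
| "lift (t \<cdot> u) k = lift t k \<cdot> lift u k"
| "lift (Abs t) k = Abs (lift t (Suc k))"

text \<open>\<open>subst t s k\<close> is \<open>[s/k]t\<close>; the variable \<open>k\<close> disappears and larger indices are lowered.\<close>

primrec subst :: "trm \<Rightarrow> trm \<Rightarrow> nat \<Rightarrow> trm" where
  "subst (Var i) s k = (if k < i then Var (i - 1) else if i = k then s else Var i)"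
| "subst (t \<cdot> u) s k = subst t s k \<cdot> subst u s k"
| "subst (Abs t) s k = Abs (subst t (lift s 0) (Suc k))"

text \<open>All free variables have an index below \<open>k\<close>.\<close>

primrec closed_at :: "nat \<Rightarrow> trm \<Rightarrow> bool" where
  "closed_at k (Var i) \<longleftrightarrow> i < k"
| "closed_at k (t \<cdot> u) \<longleftrightarrow> closed_at k t \<and> closed_at k u"
| "closed_at k (Abs t) \<longleftrightarrow> closed_at (Suc k) t"

abbreviation closed :: "trm \<Rightarrow> bool" where
  "closed \<equiv> closed_at 0"

abbreviation apps :: "trm \<Rightarrow> trm list \<Rightarrow> trm" where
  "apps \<equiv> foldl App"

primrec subterms :: "trm \<Rightarrow> trm set" where
  "subterms (Var i) = {Var i}"
| "subterms (t \<cdot> u) = insert (t \<cdot> u) (subterms t \<union> subterms u)"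
| "subterms (Abs t) = insert (Abs t) (subterms t)"

definition Id_trm :: trm where
  "Id_trm = Abs (Var 0)"

definition Om :: trm where
  "Om = Abs (Var 0 \<cdot> Var 0) \<cdot> Abs (Var 0 \<cdot> Var 0)"

definition Kstar :: trm where
  "Kstar = Abs (Abs (Var 0))"

definition church :: "nat \<Rightarrow> trm" where
  "church k = Abs (Abs ((App (Var 1) ^^ k) (Var 0)))"

text \<open>\<open>[A, B] = \<lambda>z. z A B\<close>.\<close>

definition pair :: "trm \<Rightarrow> trm \<Rightarrow> trm" where
  "pair a b = Abs (Var 0 \<cdot> lift a 0 \<cdot> lift b 0)"


section \<open>Conversion, solvability and reduction\<close>

inductive beta :: "trm \<Rightarrow> trm \<Rightarrow> bool" where
  beta_redex: "beta (Abs t \<cdot> u) (subst t u 0)"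
| beta_appL: "beta t t' \<Longrightarrow> beta (t \<cdot> u) (t' \<cdot> u)"
| beta_appR: "beta u u' \<Longrightarrow> beta (t \<cdot> u) (t \<cdot> u')"
| beta_abs: "beta t t' \<Longrightarrow> beta (Abs t) (Abs t')"

abbreviation beta_conv :: "trm \<Rightarrow> trm \<Rightarrow> bool" where
  "beta_conv \<equiv> equivclp beta"

text \<open>An open term is (un)solvable when its closure under abstraction is; a closed term is its own
  closure.\<close>

definition closure :: "trm \<Rightarrow> trm" where
  "closure t = (Abs ^^ (LEAST k. closed_at k t)) t"

lemma closure_closed: "closed t \<Longrightarrow> closure t = t"
  by (simp add: closure_def)

definition unsolvable :: "trm \<Rightarrow> bool" where
  "unsolvable t \<longleftrightarrow>
     \<not> (\<exists>args. (\<forall>a\<in>set args. closed a) \<and> beta_conv (apps (closure t) args) Id_trm)"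

text \<open>\<open>Om\<close> contracts to itself, so it is not counted as a redex; otherwise no term containing
  \<open>Om\<close> would be normal. This omits only trivial steps.\<close>

inductive betaOm :: "trm \<Rightarrow> trm \<Rightarrow> bool" where
  betaOm_beta: "Abs t \<cdot> u \<noteq> Om \<Longrightarrow> betaOm (Abs t \<cdot> u) (subst t u 0)"
| betaOm_Om: "unsolvable t \<Longrightarrow> t \<noteq> Om \<Longrightarrow> betaOm t Om"
| betaOm_appL: "betaOm t t' \<Longrightarrow> betaOm (t \<cdot> u) (t' \<cdot> u)"
| betaOm_appR: "betaOm u u' \<Longrightarrow> betaOm (t \<cdot> u) (t \<cdot> u')"
| betaOm_abs: "betaOm t t' \<Longrightarrow> betaOm (Abs t) (Abs t')"

definition has_betaOm_nf :: "trm \<Rightarrow> trm \<Rightarrow> bool" where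
  "has_betaOm_nf t v \<longleftrightarrow> betaOm\<^sup>*\<^sup>* t v \<and> \<not> (\<exists>v'. betaOm v v')"

text \<open>The first symbol of \<open>v\<close> is the variable \<open>x\<close>: there are no leading abstractions.\<close>

definition begins_with :: "nat \<Rightarrow> trm \<Rightarrow> bool" where
  "begins_with x v \<longleftrightarrow> (\<exists>args. v = apps (Var x) args)"

inductive closed_head_step :: "trm \<Rightarrow> trm \<Rightarrow> bool" where
  "closed (Abs p \<cdot> q) \<Longrightarrow>
     closed_head_step ((Abs ^^ k) (apps (Abs p \<cdot> q) rs)) ((Abs ^^ k) (apps (subst p q 0) rs))"

inductive omega_eq :: "trm \<Rightarrow> trm \<Rightarrow> bool" (infix "=\<^sub>\<omega>" 50) where
  omega_refl: "closed M \<Longrightarrow> M =\<^sub>\<omega> M"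
| omega_beta: "closed (Abs U \<cdot> N) \<Longrightarrow> Abs U \<cdot> N =\<^sub>\<omega> subst U N 0"
| omega_beta_sym: "closed (Abs U \<cdot> N) \<Longrightarrow> subst U N 0 =\<^sub>\<omega> Abs U \<cdot> N"
| omega_Om: "closed M \<Longrightarrow> unsolvable M \<Longrightarrow> M =\<^sub>\<omega> Om"
| omega_Om_sym: "closed M \<Longrightarrow> unsolvable M \<Longrightarrow> Om =\<^sub>\<omega> M"
| omega_Leibniz: "closed_at 1 X \<Longrightarrow> closed_at 1 Y \<Longrightarrow> closed M \<Longrightarrow> closed N \<Longrightarrow>
    subst X M 0 =\<^sub>\<omega> subst Y M 0 \<Longrightarrow> M =\<^sub>\<omega> N \<Longrightarrow> subst X N 0 =\<^sub>\<omega> subst Y N 0"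
| omega_rule: "closed P \<Longrightarrow> closed Q \<Longrightarrow> (\<And>M. closed M \<Longrightarrow> P \<cdot> M =\<^sub>\<omega> Q \<cdot> M) \<Longrightarrow> P =\<^sub>\<omega> Q"


section \<open>Recursive functions\<close>

text \<open>Total recursive functions of \<open>k\<close> arguments, given as a list; the minimisation rule is
  restricted to regular functions. The last rule makes the notion independent of the values on lists
  of other lengths.\<close>

inductive recursive_fun :: "nat \<Rightarrow> (nat list \<Rightarrow> nat) \<Rightarrow> bool" where
  rec_zero: "recursive_fun k (\<lambda>_. 0)"
| rec_succ: "recursive_fun 1 (\<lambda>xs. Suc (xs ! 0))"
| rec_proj: "i < k \<Longrightarrow> recursive_fun k (\<lambda>xs. xs ! i)"
| rec_comp: "recursive_fun (length hs) g \<Longrightarrow> (\<forall>h\<in>set hs. recursive_fun k h) \<Longrightarrow>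
    recursive_fun k (\<lambda>xs. g (map (\<lambda>h. h xs) hs))"
| rec_prim: "recursive_fun k g \<Longrightarrow> recursive_fun (Suc (Suc k)) h \<Longrightarrow>
    recursive_fun (Suc k) (\<lambda>xs. rec_nat (g (tl xs)) (\<lambda>i r. h (i # r # tl xs)) (hd xs))"
| rec_mu: "recursive_fun (Suc k) g \<Longrightarrow> (\<forall>xs. length xs = k \<longrightarrow> (\<exists>i. g (i # xs) = 0)) \<Longrightarrow>
    recursive_fun k (\<lambda>xs. LEAST i. g (i # xs) = 0)"
| rec_cong: "recursive_fun k f \<Longrightarrow> (\<forall>xs. length xs = k \<longrightarrow> f xs = g xs) \<Longrightarrow> recursive_fun k g"

definition recursive_rel :: "(nat \<Rightarrow> nat \<Rightarrow> bool) \<Rightarrow> bool" where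
  "recursive_rel R \<longleftrightarrow> recursive_fun 2 (\<lambda>xs. if R (xs ! 0) (xs ! 1) then 1 else 0)"


section \<open>Sequence numbers and trees\<close>

text \<open>Being a sequence number, the length and the entries are recursive; that the code of an
  extended sequence is computable follows by search. The sequence numbers are the elements of
  \<open>range code\<close>, which need not be all numbers.\<close>

definition effective_coding :: "(nat list \<Rightarrow> nat) \<Rightarrow> bool" where
  "effective_coding code \<longleftrightarrow>
     inj code \<and>
     recursive_fun 1 (\<lambda>xs. if xs ! 0 \<in> range code then 1 else 0) \<and>
     (\<exists>len. recursive_fun 1 len \<and> (\<forall>xs. len [code xs] = length xs)) \<and>
     (\<exists>ent. recursive_fun 2 ent \<and> (\<forall>xs. \<forall>i<length xs. ent [code xs, i] = xs ! i))"

definition bar :: "(nat list \<Rightarrow> nat) \<Rightarrow> (nat \<Rightarrow> nat) \<Rightarrow> nat \<Rightarrow> nat" where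
  "bar code f m = code (map f [0..<m])"

definition seq_less :: "(nat list \<Rightarrow> nat) \<Rightarrow> nat \<Rightarrow> nat \<Rightarrow> bool" where
  "seq_less code s' s \<longleftrightarrow> (\<exists>xs ys. s' = code xs \<and> s = code ys \<and> strict_prefix xs ys)"

definition unsecured :: "(nat list \<Rightarrow> nat) \<Rightarrow> (nat \<Rightarrow> nat \<Rightarrow> bool) \<Rightarrow> nat \<Rightarrow> nat \<Rightarrow> bool" where
  "unsecured code R n s \<longleftrightarrow> \<not> (\<exists>s'. seq_less code s' s \<and> R s' n)"

definition unsecured_tree :: "(nat list \<Rightarrow> nat) \<Rightarrow> (nat \<Rightarrow> nat \<Rightarrow> bool) \<Rightarrow> nat \<Rightarrow> nat set" where
  "unsecured_tree code R n = {s \<in> range code. unsecured code R n s}"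

definition subtree :: "(nat list \<Rightarrow> nat) \<Rightarrow> nat set \<Rightarrow> nat \<Rightarrow> nat set" where
  "subtree code T s = (if s \<in> T then {t \<in> T. t = s \<or> seq_less code s t} else {})"

definition well_founded_tree :: "(nat list \<Rightarrow> nat) \<Rightarrow> nat set \<Rightarrow> bool" where
  "well_founded_tree code T \<longleftrightarrow>
     \<not> (\<exists>g :: nat \<Rightarrow> nat. \<forall>i. g i \<in> T \<and> seq_less code (g i) (g (Suc i)))"

text \<open>Two usages of \<open>s * z\<close> are both admitted: \<open>z\<close> is itself a sequence number, or \<open>z\<close> stands for
  the one-element sequence whose entry is \<open>z\<close>. The latter is how \<open>*\<close> is applied in \<open>Ftrm\<close> below,
  where \<open>z\<close> runs through all numerals.\<close>

definition represents_concatenation :: "(nat list \<Rightarrow> nat) \<Rightarrow> trm \<Rightarrow> bool" where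
  "represents_concatenation code C \<longleftrightarrow>
     (\<forall>xs ys. beta_conv (C \<cdot> church (code xs) \<cdot> church (code ys)) (church (code (xs @ ys)))) \<or>
     (\<forall>xs z. beta_conv (C \<cdot> church (code xs) \<cdot> church z) (church (code (xs @ [z]))))"


section \<open>The terms \<open>F\<^sub>i\<close> and \<open>B\<^sub>i\<close>\<close>

definition Atrm :: trm where
  "Atrm = Abs (Abs (Var 0 \<cdot> (Var 1 \<cdot> Var 1 \<cdot> Var 0)))"

definition Theta :: trm where
  "Theta = Atrm \<cdot> Atrm"

text \<open>\<open>S\<close> is the successor term. Under the three binders \<open>a, x, f\<close> the indices are
  \<open>a = 2\<close>, \<open>x = 1\<close>, \<open>f = 0\<close>, and \<open>y\<close> is the free variable \<open>0\<close>, seen there as \<open>3\<close>.\<close>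

definition Gtrm :: "trm \<Rightarrow> trm" where
  "Gtrm S = Abs (Abs (Abs
     (pair (Var 0 \<cdot> Var 1)
           (Var 1 \<cdot> Abs (Var 0 \<cdot> Om) \<cdot> Var 3 \<cdot> (Var 2 \<cdot> (S \<cdot> Var 1) \<cdot> Var 0)))))"

text \<open>\<open>C\<close> is the concatenation term. The binders are \<open>w = 2\<close>, \<open>x = 1\<close>, \<open>y = 0\<close>, each one higher
  below the innermost binder \<open>z\<close>. As \<open>D\<close>, \<open>C\<close> and \<open>S\<close> are closed they need no lifting.\<close>

definition Ftrm :: "trm \<Rightarrow> trm \<Rightarrow> trm \<Rightarrow> nat \<Rightarrow> trm" where
  "Ftrm D C S i = Abs (Abs (Abs
     (D \<cdot> Var 1 \<cdot> church i \<cdot> Atrm \<cdot> Atrm \<cdot> Gtrm S \<cdot> church 0 \<cdot>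
        Abs (Var 3 \<cdot> (C \<cdot> Var 2 \<cdot> Var 0)))))"

definition Btrm :: "trm \<Rightarrow> trm \<Rightarrow> trm \<Rightarrow> nat \<Rightarrow> trm" where
  "Btrm D C S i = Theta \<cdot> Ftrm D C S i"

end

theory Submission
  imports Defs
begin

text \<open>Let \<open>s\<^sub>0 < s\<^sub>1 < \<dots>\<close> be an infinite branch with \<open>s\<^bsub>m+1\<^esub> = s\<^sub>m * z\<^sub>m\<close>, and let \<open>\<simeq>\<close> be
  observational equivalence with respect to head normalizability. It is a congruence that contains \<open>=\<^sub>\<omega>\<close>,
  but it need not separate \<open>B\<^sub>0 s\<^sub>0\<close> from \<open>B\<^sub>1 s\<^sub>0\<close>, so it is refined as follows. There is an infinite
  stack \<open>\<pi>\<close> of closed terms such that the weak head reduction of \<open>B\<^sub>0 s\<^sub>0\<close>, supplied with the entries of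
  \<open>\<pi>\<close> whenever it stops at an abstraction, passes through all \<open>w\<^sub>m z\<^sub>m\<close>, where
  \<open>w\<^sub>m = \<lambda>z. B\<^sub>0 (s\<^sub>m * z)\<close>. Say that a term succeeds if it reaches in this way a target, that is, a term
  \<open>w q e\<^sub>1 \<dots> e\<^sub>l\<close> with \<open>w \<simeq> w\<^sub>m\<close>, \<open>q \<simeq> z\<^sub>m\<close> and \<open>e\<^sub>1, \<dots>, e\<^sub>l\<close> equivalent to the entries supplied since
  \<open>w\<^sub>m z\<^sub>m\<close> was due. The reduct of a target succeeds too, with the next \<open>m\<close>, and a term that succeeds
  has a head normal form; hence the closed terms that are equivalent and succeed in the same contexts
  satisfy all rules of \<open>=\<^sub>\<omega>\<close>. As for the \<open>\<omega>\<close>-rule, a head without arguments is supplied with the next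
  entry of \<open>\<pi>\<close>, which is closed.

  Now \<open>B\<^sub>0 s\<^sub>0\<close> succeeds. The run of \<open>B\<^sub>1 s\<^sub>0\<close> can be followed step by step and meets no target: \<open>D x\<close> has
  one head normal form with head variable \<open>x\<close>, and the numeral \<open>i\<close> is passed on as one of the arguments
  of this variable in \<open>B\<^sub>i x y\<close>, so that \<open>\<simeq>\<close> does distinguish \<open>\<lambda>z. B\<^sub>1 (s\<^sub>m * z)\<close> and \<open>B\<^sub>1\<close> from the terms
  \<open>w\<^sub>k\<close>.\<close>

section \<open>Parallel substitution\<close>

text \<open>On nodes of the tree \<open>D\<close> reduces to \<open>Kstar\<close>, which discards
  the numeral i, and the recursion applies its last argument
  \<open>\<lambda>z. B\<^sub>i (s * z)\<close> to numerals only. So the difference between the two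
  runs shows only in that argument before its numeral arrives, while z can still be tested as a
  variable; a target is the moment when it has come to head position. The stack is closed because
  the premise of the \<omega>-rule speaks of closed arguments. Its block m, spent between two nodes,
  is a tuple with z_m + 1 components in the place of y, then entries that drive the recursion
  through 0, ..., z_m and leave it. The calls apply y to a varying number of \<open>Om\<close>
  before the recursive call; a tuple postpones the choice among them. The obstacle is \<eta>: a term
  equivalent to the expected one may demand further arguments before its head surfaces. They are
  taken from the stack, hence the trailing terms of a target. Where the run of
  \<open>B\<^sub>1\<close> is followed literally, \<open>beta_conv_reach\<close> excludes this
  slack.\<close>

definition up :: "(nat \<Rightarrow> trm) \<Rightarrow> nat \<Rightarrow> trm" where
  "up \<sigma> = case_nat (Var 0) (\<lambda>i. lift (\<sigma> i) 0)"

text \<open>Simultaneous substitutions compose by the single law \<open>psub_psub\<close>. Since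
  \<open>lift\<close> and \<open>subst\<close> are instances of them, index arithmetic is confined
  to a few lemmas.\<close>

primrec psub :: "(nat \<Rightarrow> trm) \<Rightarrow> trm \<Rightarrow> trm" where
  "psub \<sigma> (Var i) = \<sigma> i"
| "psub \<sigma> (t \<cdot> u) = psub \<sigma> t \<cdot> psub \<sigma> u"
| "psub \<sigma> (Abs t) = Abs (psub (up \<sigma>) t)"

lemma up_simps [simp]: "up \<sigma> 0 = Var 0" "up \<sigma> (Suc i) = lift (\<sigma> i) 0"
  by (simp_all add: up_def)

lemma psub_cong_closed:
  "closed_at d t \<Longrightarrow> (\<And>i. i < d \<Longrightarrow> \<sigma> i = \<tau> i) \<Longrightarrow> psub \<sigma> t = psub \<tau> t"
proof (induction t arbitrary: d \<sigma> \<tau>)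
  case (App t u)
  have "psub \<sigma> t = psub \<tau> t" "psub \<sigma> u = psub \<tau> u"
    using App.prems by (auto intro!: App.IH(1)[of d] App.IH(2)[of d])
  then show ?case by simp
next
  case (Abs t)
  have "psub (up \<sigma>) t = psub (up \<tau>) t"
    using Abs.prems by (intro Abs.IH[of "Suc d"]) (auto simp: up_def split: nat.split)
  then show ?case by simp
qed simp

lemma lift_psub: "lift t k = psub (\<lambda>i. if i < k then Var i else Var (Suc i)) t"
proof (induction t arbitrary: k)
  case (Abs t)
  have "up (\<lambda>i. if i < k then Var i else Var (Suc i))
    = (\<lambda>i. if i < Suc k then Var i else Var (Suc i))"
    by (auto simp: fun_eq_iff up_def split: nat.split)
  with Abs show ?case by simp
qed auto

lemma lift0_psub: "lift t 0 = psub (\<lambda>i. Var (Suc i)) t"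
  by (simp add: lift_psub)

lemma up_Var [simp]: "up Var = Var"
  by (auto simp: fun_eq_iff up_def split: nat.split)

lemma psub_Var [simp]: "psub Var t = t"
  by (induction t) auto

lemma up_rename:
  "up (\<lambda>i. Var (r i)) = (\<lambda>i. Var (case_nat 0 (\<lambda>i. Suc (r i)) i))"
  by (auto simp: fun_eq_iff up_def split: nat.split)

lemma psub_rename: "psub \<sigma> (psub (\<lambda>i. Var (r i)) t) = psub (\<lambda>i. \<sigma> (r i)) t"
proof (induction t arbitrary: \<sigma> r)
  case (Abs t)
  have *: "(\<lambda>i. up \<sigma> (case_nat 0 (\<lambda>i. Suc (r i)) i)) = up (\<lambda>i. \<sigma> (r i))"
    by (auto simp: fun_eq_iff up_def split: nat.split)
  show ?case by (simp add: up_rename Abs.IH *)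
qed auto

lemma rename_psub: "psub (\<lambda>i. Var (r i)) (psub \<sigma> t) = psub (\<lambda>i. psub (\<lambda>i. Var (r i)) (\<sigma> i)) t"
proof (induction t arbitrary: \<sigma> r)
  case (Abs t)
  have *: "(\<lambda>i. psub (\<lambda>i. Var (case_nat 0 (\<lambda>i. Suc (r i)) i)) (up \<sigma> i))
    = up (\<lambda>i. psub (\<lambda>i. Var (r i)) (\<sigma> i))"
    by (auto simp: fun_eq_iff up_def lift0_psub psub_rename split: nat.split)
  show ?case by (simp add: up_rename Abs.IH *)
qed auto

lemma up_comp: "psub (up \<sigma>) (up \<tau> i) = up (\<lambda>i. psub \<sigma> (\<tau> i)) i"
  by (cases i) (simp_all add: lift0_psub psub_rename rename_psub)

lemma psub_psub [simp]: "psub \<sigma> (psub \<tau> t) = psub (\<lambda>i. psub \<sigma> (\<tau> i)) t"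
proof (induction t arbitrary: \<sigma> \<tau>)
  case (Abs t)
  then show ?case by (simp add: up_comp)
qed auto

lemma subst_psub:
  "subst t u k = psub (\<lambda>i. if k < i then Var (i - 1) else if i = k then u else Var i) t"
proof (induction t arbitrary: u k)
  case (Abs t)
  have "up (\<lambda>i. if k < i then Var (i - 1) else if i = k then u else Var i)
    = (\<lambda>i. if Suc k < i then Var (i - 1) else if i = Suc k then lift u 0 else Var i)"
    by (auto simp: fun_eq_iff up_def split: nat.split)
  with Abs show ?case by simp
qed auto

lemma subst0_psub: "subst t u 0 = psub (case_nat u Var) t"
proof -
  have "(\<lambda>i. if 0 < i then Var (i - 1) else if i = 0 then u else Var i) = case_nat u Var"
    by (auto simp: fun_eq_iff split: nat.split)
  then show ?thesis by (simp add: subst_psub)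
qed

lemma psub_subst: "psub \<sigma> (subst t u 0) = subst (psub (up \<sigma>) t) (psub \<sigma> u) 0"
proof -
  have "(\<lambda>i. psub \<sigma> (case_nat u Var i)) = (\<lambda>i. psub (case_nat (psub \<sigma> u) Var) (up \<sigma> i))"
    by (auto simp: fun_eq_iff up_def lift0_psub split: nat.split)
  then show ?thesis by (simp add: subst0_psub)
qed

lemma psub_closed [simp]: "closed t \<Longrightarrow> psub \<sigma> t = t"
  using psub_cong_closed[of 0 t \<sigma> Var] by simp

lemma lift_closed [simp]: "closed t \<Longrightarrow> lift t k = t"
  by (simp add: lift_psub)

lemma subst_closed [simp]: "closed t \<Longrightarrow> subst t u k = t"
  by (simp add: subst_psub)

lemma closed_at_mono: "closed_at d t \<Longrightarrow> d \<le> e \<Longrightarrow> closed_at e t"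
  by (induction t arbitrary: d e) fastforce+

lemma closed_mono: "closed t \<Longrightarrow> closed_at d t"
  by (rule closed_at_mono) auto

lemma ex_closed_at: "\<exists>d. closed_at d t"
proof (induction t)
  case (Var i)
  then show ?case by (auto intro: exI[of _ "Suc i"])
next
  case (App t u)
  then obtain d e where "closed_at d t" "closed_at e u" by blast
  then have "closed_at (max d e) (t \<cdot> u)" by (auto intro: closed_at_mono)
  then show ?case by blast
next
  case (Abs t)
  then obtain d where "closed_at d t" by blast
  then have "closed_at d (Abs t)" by (auto intro: closed_at_mono)
  then show ?case by blast
qed

lemma closed_at_lift: "closed_at d t \<Longrightarrow> closed_at (Suc d) (lift t k)"
  by (induction t arbitrary: d k) auto

lemma closed_at_psub: "closed_at d t \<Longrightarrow> (\<And>i. i < d \<Longrightarrow> closed_at e (\<sigma> i)) \<Longrightarrow> closed_at e (psub \<sigma> t)"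
proof (induction t arbitrary: d e \<sigma>)
  case (Abs t)
  have "closed_at (Suc e) (psub (up \<sigma>) t)"
    using Abs.prems by (intro Abs.IH[of "Suc d"]) (auto simp: up_def closed_at_lift split: nat.split)
  then show ?case by simp
next
  case (App t u)
  then show ?case by simp blast
qed simp

lemma closed_at_subst0: "closed_at (Suc d) t \<Longrightarrow> closed_at d u \<Longrightarrow> closed_at d (subst t u 0)"
  unfolding subst0_psub by (erule closed_at_psub) (auto split: nat.split)

lemma apps_snoc [simp]: "apps t (as @ [a]) = apps t as \<cdot> a"
  by simp

lemma psub_apps [simp]: "psub \<sigma> (apps t as) = apps (psub \<sigma> t) (map (psub \<sigma>) as)"
  by (induction as arbitrary: t) auto

lemma subst_apps [simp]: "subst (apps t as) u k = apps (subst t u k) (map (\<lambda>a. subst a u k) as)"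
  by (induction as arbitrary: t) auto

lemma closed_at_apps [simp]: "closed_at d (apps t as) \<longleftrightarrow> closed_at d t \<and> (\<forall>a\<in>set as. closed_at d a)"
  by (induction as arbitrary: t) auto

section \<open>Weak head reduction\<close>

inductive wh :: "trm \<Rightarrow> trm \<Rightarrow> bool" where
  wh_redex: "wh (Abs t \<cdot> u) (subst t u 0)"
| wh_appL: "wh t t' \<Longrightarrow> wh (t \<cdot> u) (t' \<cdot> u)"

abbreviation whs :: "trm \<Rightarrow> trm \<Rightarrow> bool" where
  "whs \<equiv> wh\<^sup>*\<^sup>*"

inductive_cases wh_AppE: "wh (s \<cdot> u) t"

lemma not_wh [simp]: "\<not> wh (Var i) t" "\<not> wh (Abs u) t"
  by (auto elim: wh.cases)

primrec vhead :: "trm \<Rightarrow> bool" where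
  "vhead (Var i) \<longleftrightarrow> True"
| "vhead (t \<cdot> u) \<longleftrightarrow> vhead t"
| "vhead (Abs t) \<longleftrightarrow> False"

lemma vhead_apps [simp]: "vhead (apps t as) \<longleftrightarrow> vhead t"
  by (induction as arbitrary: t) auto

lemma vhead_iff: "vhead t \<longleftrightarrow> (\<exists>i as. t = apps (Var i) as)"
proof
  show "vhead t \<Longrightarrow> \<exists>i as. t = apps (Var i) as"
  proof (induction t)
    case (Var i)
    then show ?case by (metis foldl_Nil)
  next
    case (App t u)
    then obtain i as where "t = apps (Var i) as" by auto
    then have "t \<cdot> u = apps (Var i) (as @ [u])" by simp
    then show ?case by blast
  qed simp
next
  show "\<exists>i as. t = apps (Var i) as \<Longrightarrow> vhead t" by auto
qed

lemma vhead_psub: "vhead t \<Longrightarrow> (\<And>i. vhead (\<sigma> i)) \<Longrightarrow> vhead (psub \<sigma> t)"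
  by (induction t) auto

lemma wh_AbsAppD: "wh (Abs t \<cdot> u) v \<Longrightarrow> v = subst t u 0"
  by (erule wh_AppE) simp_all

lemma wh_AppD: "wh (t \<cdot> u) v \<Longrightarrow> wh t t' \<Longrightarrow> \<exists>t'. v = t' \<cdot> u \<and> wh t t'"
  by (erule wh_AppE) auto

lemma wh_det: "wh t u \<Longrightarrow> wh t v \<Longrightarrow> u = v"
  by (induction arbitrary: v rule: wh.induct) (use wh_AbsAppD wh_AppD in blast)+

lemma vhead_no_wh: "vhead t \<Longrightarrow> \<not> wh t u"
proof (induction t arbitrary: u)
  case (App t s)
  then show ?case by (auto elim!: wh_AppE)
qed simp_all

lemma whnf_cases:
  obtains "vhead t" | u where "t = Abs u" | u where "wh t u"
proof (induction t arbitrary: thesis)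
  case (App t u)
  show ?case
    by (rule App.IH(1)) (use App.prems in \<open>auto intro: wh.intros\<close>)
qed auto

lemma wh_apps: "wh t u \<Longrightarrow> wh (apps t as) (apps u as)"
  by (induction as arbitrary: t u) (auto intro: wh.intros)

lemma whs_apps: "whs t u \<Longrightarrow> whs (apps t as) (apps u as)"
  by (induction rule: rtranclp_induct) (auto intro: wh_apps rtranclp.rtrancl_into_rtrancl)

lemma whs_App: "whs t u \<Longrightarrow> whs (t \<cdot> a) (u \<cdot> a)"
  using whs_apps[of t u "[a]"] by simp

lemma wh_psub: "wh t u \<Longrightarrow> wh (psub \<sigma> t) (psub \<sigma> u)"
  by (induction rule: wh.induct) (auto simp: psub_subst intro: wh.intros)

lemma whs_psub: "whs t u \<Longrightarrow> whs (psub \<sigma> t) (psub \<sigma> u)"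
  by (induction rule: rtranclp_induct) (auto intro: wh_psub rtranclp.rtrancl_into_rtrancl)

lemma wh_closed_at: "wh t u \<Longrightarrow> closed_at d t \<Longrightarrow> closed_at d u"
  by (induction rule: wh.induct) (auto simp: closed_at_subst0)

lemma whs_closed_at: "whs t u \<Longrightarrow> closed_at d t \<Longrightarrow> closed_at d u"
  by (induction rule: rtranclp_induct) (auto intro: wh_closed_at)

lemma wh_beta: "wh t u \<Longrightarrow> beta t u"
  by (induction rule: wh.induct) (auto intro: beta.intros)

lemma whs_redex: "whs (apps (Abs t) (a # as)) (apps (subst t a 0) as)"
  using wh_apps[OF wh_redex] by auto

lemma whs_vhead_step: "whs t v \<Longrightarrow> vhead v \<Longrightarrow> wh t u \<Longrightarrow> whs u v"
  by (erule converse_rtranclpE) (use vhead_no_wh wh_det in blast)+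

text \<open>By determinism the instance follows the steps of \<open>t\<close>, and \<open>t\<close>
  cannot stop at an abstraction: the instance would then be an abstraction as well and never reach a
  variable head.\<close>

lemma psub_reflects_vhead:
  assumes "(wh ^^ n) (psub \<sigma> t) v" "vhead v"
  shows "\<exists>u. whs t u \<and> vhead u"
  using assms(1)
proof (induction n arbitrary: t)
  case 0
  show ?case
  proof (cases t rule: whnf_cases)
    case (2 u)
    with 0 assms(2) show ?thesis by auto
  next
    case (3 u)
    with 0 assms(2) wh_psub[OF 3, of \<sigma>] vhead_no_wh show ?thesis by auto
  qed auto
next
  case (Suc n)
  from Suc.prems obtain s where s: "wh (psub \<sigma> t) s" "(wh ^^ n) s v"
    by (metis relpowp_Suc_D2)
  show ?case
  proof (cases t rule: whnf_cases)
    case (2 u)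
    with s show ?thesis by auto
  next
    case (3 u)
    with s wh_psub[OF 3, of \<sigma>] wh_det have "s = psub \<sigma> u" by blast
    with Suc.IH[of u] s 3 show ?thesis by (meson converse_rtranclp_into_rtranclp)
  qed auto
qed

section \<open>Head normalizability\<close>

text \<open>Arguments take the place of abstracted variables, so that head normalizability is
  expressed without reduction under abstractions.\<close>

definition hn :: "trm \<Rightarrow> bool" where
  "hn t \<longleftrightarrow> (\<exists>as u. whs (apps t as) u \<and> vhead u)"

lemma hn_appsD: "hn (apps t as) \<Longrightarrow> hn t"
  unfolding hn_def by (metis foldl_append)

lemma hn_AppD: "hn (t \<cdot> a) \<Longrightarrow> hn t"
  using hn_appsD[of t "[a]"] by simp

lemma hn_vhead [simp]: "vhead t \<Longrightarrow> hn t"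
  unfolding hn_def by (metis rtranclp.rtrancl_refl foldl_Nil)

lemma hn_wh: "wh t u \<Longrightarrow> hn t \<longleftrightarrow> hn u"
  unfolding hn_def by (meson converse_rtranclp_into_rtranclp wh_apps whs_vhead_step)

lemma hn_whs: "whs t u \<Longrightarrow> hn t \<longleftrightarrow> hn u"
  by (induction rule: rtranclp_induct) (auto simp: hn_wh)

text \<open>Fresh variables do as well as the given arguments: \<open>\<tau>\<close> maps the former
  to the latter, and \<open>psub_reflects_vhead\<close> removes \<open>\<tau>\<close>.\<close>

lemma hn_psub_out:
  assumes "hn (psub \<sigma> t)" "closed_at d t"
  obtains j u where "whs (apps t (map Var [d..<d + j])) u" "vhead u"
proof -
  from assms obtain as u where u: "whs (apps (psub \<sigma> t) as) u" "vhead u" unfolding hn_def by blast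
  define \<tau> where "\<tau> i = (if i < d then \<sigma> i else as ! (i - d))" for i
  have "psub \<tau> (apps t (map Var [d..<d + length as])) = apps (psub \<sigma> t) as"
    using psub_cong_closed[OF assms(2), of \<tau> \<sigma>]
    by (auto simp: \<tau>_def intro!: nth_equalityI arg_cong[of _ _ "apps _"])
  with u obtain v where "whs (apps t (map Var [d..<d + length as])) v" "vhead v"
    using psub_reflects_vhead by (metis rtranclp_imp_relpowp)
  then show thesis using that by blast
qed

lemma hn_reflect: "hn (psub \<sigma> t) \<Longrightarrow> hn t"
  using ex_closed_at[of t] hn_psub_out unfolding hn_def[of t] by metis

lemmas hn_out = hn_psub_out[of Var, unfolded psub_Var]

text \<open>The fresh variables of \<open>hn_out\<close> are all identified with
  \<open>Var i\<close>; one more copy only lengthens the spine of the variable head.\<close>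

lemma hn_AppVar: "hn t \<Longrightarrow> hn (t \<cdot> Var i)"
proof -
  assume hn: "hn t"
  obtain d where d: "closed_at d t" using ex_closed_at by blast
  obtain j u where u: "whs (apps t (map Var [d..<d + j])) u" "vhead u" using hn_out[OF hn d] .
  define \<tau> where "\<tau> k = (if k < d then Var k else Var i)" for k
  have *: "psub \<tau> t = t" using psub_cong_closed[OF d, of \<tau> Var] by (auto simp: \<tau>_def)
  have v: "vhead (psub \<tau> u)" using u(2) by (rule vhead_psub) (simp add: \<tau>_def)
  have m: "map (psub \<tau>) (map Var [d..<d + j]) = replicate j (Var i)"
    by (auto simp: \<tau>_def intro!: nth_equalityI)
  have "whs (apps t (replicate j (Var i))) (psub \<tau> u)"
    using whs_psub[OF u(1), of \<tau>] by (simp add: * m del: map_map)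
  then have "whs (apps t (replicate j (Var i) @ [Var i])) (psub \<tau> u \<cdot> Var i)"
    unfolding apps_snoc by (rule whs_App)
  then have "whs (apps t (replicate (Suc j) (Var i))) (psub \<tau> u \<cdot> Var i)"
    by (simp add: replicate_append_same del: apps_snoc foldl_append)
  then have "whs (apps (t \<cdot> Var i) (replicate j (Var i))) (psub \<tau> u \<cdot> Var i)" by simp
  moreover have "vhead (psub \<tau> u \<cdot> Var i)" using v by simp
  ultimately show ?thesis unfolding hn_def by blast
qed

lemma hn_rename: "hn t \<Longrightarrow> hn (psub (\<lambda>i. Var (r i)) t)"
proof -
  assume "hn t"
  then obtain as u where u: "whs (apps t as) u" "vhead u" unfolding hn_def by blast
  have v: "vhead (psub (\<lambda>i. Var (r i)) u)" using u(2) by (rule vhead_psub) simp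
  from whs_psub[OF u(1), of "\<lambda>i. Var (r i)"] v show ?thesis unfolding hn_def by auto
qed

lemma hn_Abs: "hn t \<Longrightarrow> hn (Abs t)"
proof -
  assume "hn t"
  then have "hn (psub (\<lambda>i. Var (case_nat 0 id i)) t)" by (rule hn_rename)
  also have "(\<lambda>i. Var (case_nat 0 id i)) = case_nat (Var 0) Var"
    by (auto simp: fun_eq_iff split: nat.split)
  finally have "hn (Abs t \<cdot> Var 0)" using wh_redex hn_wh subst0_psub by metis
  then show ?thesis by (rule hn_AppD)
qed

lemma Om_closed [simp]: "closed Om" by (simp add: Om_def)

lemma wh_Om: "wh Om Om"
proof -
  have "wh (Abs (Var 0 \<cdot> Var 0) \<cdot> Abs (Var 0 \<cdot> Var 0)) (subst (Var 0 \<cdot> Var 0) (Abs (Var 0 \<cdot> Var 0)) 0)"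
    by (rule wh_redex)
  then show ?thesis by (simp add: Om_def)
qed

lemma not_hn_Om: "\<not> hn Om"
proof
  assume "hn Om"
  then obtain as u where u: "whs (apps Om as) u" "vhead u" unfolding hn_def by blast
  have "u = apps Om as" using u(1)
    by (induction rule: rtranclp_induct) (use wh_Om wh_apps wh_det in blast)+
  with u(2) show False by (simp add: Om_def)
qed

lemma not_hn_apps: "\<not> hn t \<Longrightarrow> \<not> hn (apps (psub \<sigma> t) as)"
  using hn_appsD hn_reflect by blast

section \<open>Tuples\<close>

text \<open>The last argument belongs to the innermost binder, hence the reversal; indices beyond
  the arguments are lowered by their number.\<close>

definition args_env :: "trm list \<Rightarrow> nat \<Rightarrow> trm" where
  "args_env as i = (if i < length as then rev as ! i else Var (i - length as))"

lemma args_env_Nil [simp]: "args_env [] = Var"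
  by (auto simp: args_env_def)

lemma args_env_snoc: "args_env (as @ [a]) = case_nat a (args_env as)"
  by (auto simp: args_env_def fun_eq_iff split: nat.split)

lemma psub_up_env: "psub (case_nat a Var) (psub (up \<sigma>) t) = psub (case_nat a \<sigma>) t"
proof -
  have "(\<lambda>i. psub (case_nat a Var) (up \<sigma> i)) = case_nat a \<sigma>"
    by (auto simp: fun_eq_iff up_def lift0_psub split: nat.split)
  then show ?thesis by simp
qed

lemma funpow_Suc_Abs: "(Abs ^^ Suc n) t = (Abs ^^ n) (Abs t)"
  by (simp only: funpow_Suc_right o_def)

lemma closed_at_Abs_pow [simp]: "closed_at d ((Abs ^^ n) t) \<longleftrightarrow> closed_at (d + n) t"
  by (induction n arbitrary: d) auto

lemma whs_Abs_pow: "whs (apps ((Abs ^^ length as) t) as) (psub (args_env as) t)"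
proof (induction as arbitrary: t rule: rev_induct)
  case (snoc a as)
  have "whs (apps ((Abs ^^ length as) (Abs t)) as \<cdot> a) (psub (args_env as) (Abs t) \<cdot> a)"
    using snoc by (rule whs_App)
  also have "wh (psub (args_env as) (Abs t) \<cdot> a) (psub (case_nat a (args_env as)) t)"
    using wh_redex[of "psub (up (args_env as)) t" a] by (simp add: subst0_psub psub_up_env del: psub_psub)
  finally show ?case by (simp add: args_env_snoc funpow_Suc_Abs del: funpow.simps)
qed simp

text \<open>\<open>tup N = \<lambda>x\<^sub>1 \<dots> x\<^sub>N p. p x\<^sub>1 \<dots> x\<^sub>N\<close>, and \<open>sel N l\<close> selects entry \<open>l\<close> (counted from \<open>0\<close>).\<close>

definition tup :: "nat \<Rightarrow> trm" where
  "tup N = (Abs ^^ N) (Abs (apps (Var 0) (map (\<lambda>l. Var (N - l)) [0..<N])))"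

definition sel :: "nat \<Rightarrow> nat \<Rightarrow> trm" where
  "sel N l = (Abs ^^ N) (Var (N - 1 - l))"

lemma closed_tup [simp]: "closed_at d (tup N)"
  by (auto simp: tup_def)

lemma closed_sel: "l < N \<Longrightarrow> closed (sel N l)"
  by (auto simp: sel_def)

lemma whs_sel: "l < length as \<Longrightarrow> whs (apps (sel (length as) l) as) (as ! l)"
proof -
  assume l: "l < length as"
  then have "length as - Suc l < length as" by linarith
  with l have "args_env as (length as - 1 - l) = as ! l"
    by (simp add: args_env_def rev_nth)
  then show ?thesis
    using whs_Abs_pow[of as "Var (length as - 1 - l)"] by (simp add: sel_def)
qed

lemma tup_body:
  "psub (args_env as) (Abs (apps (Var 0) (map (\<lambda>l. Var (length as - l)) [0..<length as])))
    = Abs (apps (Var 0) (map (\<lambda>a. lift a 0) as))"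
proof -
  have "map (psub (up (args_env as))) (map (\<lambda>l. Var (length as - l)) [0..<length as])
    = map (\<lambda>a. lift a 0) as"
  proof (rule nth_equalityI, goal_cases)
    case (2 i)
    then have "length as - i = Suc (length as - Suc i)" by simp
    moreover from 2 have "length as - Suc i < length as" by simp
    ultimately show ?case using 2 by (simp add: args_env_def rev_nth)
  qed simp
  then show ?thesis by (simp del: map_map)
qed

lemma whs_tup_full: "whs (apps (tup (length as)) as) (Abs (apps (Var 0) (map (\<lambda>a. lift a 0) as)))"
  using whs_Abs_pow[of as] unfolding tup_def by (metis tup_body)

lemma subst_lift0 [simp]: "subst (lift t 0) u 0 = t"
proof -
  have "(\<lambda>i. case_nat u Var (Suc i)) = Var" by auto
  then show ?thesis by (simp add: subst0_psub lift0_psub)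
qed

lemma whs_tup: "whs (apps (tup (length as)) as \<cdot> q) (apps q as)"
proof -
  have "whs (apps (tup (length as)) as \<cdot> q) (Abs (apps (Var 0) (map (\<lambda>a. lift a 0) as)) \<cdot> q)"
    by (rule whs_App[OF whs_tup_full])
  also have "wh \<dots> (subst (apps (Var 0) (map (\<lambda>a. lift a 0) as)) q 0)" by (rule wh_redex)
  also have "\<dots> = apps q as" by (simp add: o_def)
  finally show ?thesis .
qed

lemma whs_tup_sel: "l < length as \<Longrightarrow> whs (apps (tup (length as)) as \<cdot> sel (length as) l) (as ! l)"
  using whs_tup whs_sel by (meson rtranclp_trans)

lemma hn_tup: "length as \<le> N \<Longrightarrow> hn (apps (tup N) as)"
proof -
  assume le: "length as \<le> N"
  define bs where "bs = as @ replicate (N - length as) (Var 0)"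
  have "length bs = N" using le by (simp add: bs_def)
  then have "whs (apps (tup N) bs \<cdot> Var 0) (apps (Var 0) bs)" using whs_tup[of bs] by simp
  then have "hn (apps (tup N) bs \<cdot> Var 0)" by (simp add: hn_whs)
  then have "hn (apps (apps (tup N) as) (replicate (N - length as) (Var 0) @ [Var 0]))"
    by (simp add: bs_def)
  then show ?thesis by (rule hn_appsD)
qed

section \<open>Observational equivalence\<close>

text \<open>Free variables are tested through all sufficiently large tuples only; that these tests already
  decide all substitution instances is lemma \<open>eqv_psub\<close> below.\<close>

definition eqv_from :: "nat \<Rightarrow> trm \<Rightarrow> trm \<Rightarrow> bool" where
  "eqv_from N t u \<longleftrightarrow> (\<forall>\<nu>. (\<forall>i. N \<le> \<nu> i) \<longrightarrow> (\<forall>as. (\<forall>a\<in>set as. closed a) \<longrightarrow>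
     hn (apps (psub (\<lambda>i. tup (\<nu> i)) t) as) = hn (apps (psub (\<lambda>i. tup (\<nu> i)) u) as)))"

definition eqv :: "trm \<Rightarrow> trm \<Rightarrow> bool" (infix "\<simeq>" 50) where
  "t \<simeq> u \<longleftrightarrow> (\<exists>N. eqv_from N t u)"

lemma eqvI:
  "(\<And>\<nu> as. (\<And>i. N \<le> \<nu> i) \<Longrightarrow> (\<And>a. a \<in> set as \<Longrightarrow> closed a) \<Longrightarrow>
    hn (apps (psub (\<lambda>i. tup (\<nu> i)) t) as) = hn (apps (psub (\<lambda>i. tup (\<nu> i)) u) as)) \<Longrightarrow> t \<simeq> u"
  unfolding eqv_def eqv_from_def by blast

lemma eqv_fromD:
  "eqv_from N t u \<Longrightarrow> (\<And>i. N \<le> \<nu> i) \<Longrightarrow> (\<And>a. a \<in> set as \<Longrightarrow> closed a) \<Longrightarrow>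
    hn (apps (psub (\<lambda>i. tup (\<nu> i)) t) as) = hn (apps (psub (\<lambda>i. tup (\<nu> i)) u) as)"
  unfolding eqv_from_def by blast

lemma eqv_refl [simp]: "t \<simeq> t"
  by (rule eqvI) simp

lemma eqv_sym: "t \<simeq> u \<Longrightarrow> u \<simeq> t"
  unfolding eqv_def eqv_from_def by (simp add: eq_commute)

lemma eqv_trans [trans]: "t \<simeq> u \<Longrightarrow> u \<simeq> v \<Longrightarrow> t \<simeq> v"
proof -
  assume "t \<simeq> u" "u \<simeq> v"
  obtain N where "eqv_from N t u" using \<open>t \<simeq> u\<close> unfolding eqv_def by blast
  note N = eqv_fromD[OF this]
  obtain M where "eqv_from M u v" using \<open>u \<simeq> v\<close> unfolding eqv_def by blast
  note M = eqv_fromD[OF this]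
  show ?thesis
  proof (rule eqvI[of "max N M"])
    fix \<nu> :: "nat \<Rightarrow> nat" and as assume *: "\<And>i. max N M \<le> \<nu> i" "\<And>a. a \<in> set as \<Longrightarrow> closed a"
    have "N \<le> \<nu> i" "M \<le> \<nu> i" for i using *(1)[of i] by auto
    with N M *(2) show "hn (apps (psub (\<lambda>i. tup (\<nu> i)) t) as)
      = hn (apps (psub (\<lambda>i. tup (\<nu> i)) v) as)" by metis
  qed
qed

lemma eqv_wh: "wh t u \<Longrightarrow> t \<simeq> u"
  by (rule eqvI) (meson hn_wh wh_apps wh_psub)

lemma eqv_whs: "whs t u \<Longrightarrow> t \<simeq> u"
  by (induction rule: rtranclp_induct) (auto intro: eqv_trans eqv_wh)

lemma eqv_apps_same: "t \<simeq> u \<Longrightarrow> apps t as \<simeq> apps u as"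
proof -
  assume "t \<simeq> u"
  obtain N where "eqv_from N t u" using \<open>t \<simeq> u\<close> unfolding eqv_def by blast
  note N = eqv_fromD[OF this]
  show ?thesis
  proof (rule eqvI[of N])
    fix \<nu> :: "nat \<Rightarrow> nat" and bs assume *: "\<And>i. N \<le> \<nu> i" "\<And>a. a \<in> set bs \<Longrightarrow> closed a"
    obtain d where d: "\<And>a. a \<in> set as \<Longrightarrow> closed (psub (\<lambda>i. tup (\<nu> i)) a)"
      by (metis closed_at_psub ex_closed_at closed_tup)
    have "hn (apps (psub (\<lambda>i. tup (\<nu> i)) t) (map (psub (\<lambda>i. tup (\<nu> i))) as @ bs))
      = hn (apps (psub (\<lambda>i. tup (\<nu> i)) u) (map (psub (\<lambda>i. tup (\<nu> i))) as @ bs))"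
      by (rule N) (use * d in auto)
    then show "hn (apps (psub (\<lambda>i. tup (\<nu> i)) (apps t as)) bs)
      = hn (apps (psub (\<lambda>i. tup (\<nu> i)) (apps u as)) bs)" by simp
  qed
qed

lemma eqv_rename: "t \<simeq> u \<Longrightarrow> psub (\<lambda>i. Var (r i)) t \<simeq> psub (\<lambda>i. Var (r i)) u"
proof -
  assume "t \<simeq> u"
  then obtain N where "eqv_from N t u" unfolding eqv_def by blast
  note N = eqv_fromD[OF this]
  show ?thesis
    by (rule eqvI[of N]) (simp add: N[of "\<lambda>i. \<nu> (r i)" for \<nu>])
qed

lemma eqv_lift: "t \<simeq> u \<Longrightarrow> lift t 0 \<simeq> lift u 0"
  unfolding lift0_psub by (rule eqv_rename)

text \<open>The bound \<open>N\<close> is the number of arguments of the head variable: a tuple of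
  at least that size takes them all and still awaits its selector.\<close>

lemma hn_large_tup:
  assumes "hn t"
  shows "\<exists>N. \<forall>\<nu>. (\<forall>i. N \<le> \<nu> i) \<longrightarrow> hn (psub (\<lambda>i. tup (\<nu> i)) t)"
proof -
  from assms obtain as i bs where u: "whs (apps t as) (apps (Var i) bs)"
    unfolding hn_def vhead_iff by blast
  have "hn (psub (\<lambda>i. tup (\<nu> i)) t)" if "\<And>i. length bs \<le> \<nu> i" for \<nu> :: "nat \<Rightarrow> nat"
  proof -
    have "hn (apps (tup (\<nu> i)) (map (psub (\<lambda>i. tup (\<nu> i))) bs))"
      by (rule hn_tup) (simp add: that)
    with whs_psub[OF u, of "\<lambda>i. tup (\<nu> i)"] have "hn (apps (psub (\<lambda>i. tup (\<nu> i)) t) (map (psub (\<lambda>i. tup (\<nu> i))) as))"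
      by (simp add: hn_whs)
    then show ?thesis by (rule hn_appsD)
  qed
  then show ?thesis by blast
qed

lemma eqv_hn: "t \<simeq> u \<Longrightarrow> hn t \<longleftrightarrow> hn u"
proof -
  have *: "hn u" if "t \<simeq> u" "hn t" for t u
  proof -
    obtain N where "eqv_from N t u" using \<open>t \<simeq> u\<close> unfolding eqv_def by blast
  note N = eqv_fromD[OF this]
    obtain M where M: "\<And>\<nu>. (\<And>i. M \<le> \<nu> i) \<Longrightarrow> hn (psub (\<lambda>i. tup (\<nu> i)) t)"
      using hn_large_tup[OF \<open>hn t\<close>] by blast
    have "hn (psub (\<lambda>i. tup (max N M)) t)" by (rule M[of "\<lambda>_. max N M"]) simp
    then have "hn (psub (\<lambda>i. tup (max N M)) u)" using N[of "\<lambda>_. max N M" "[]"] by simp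
    then show ?thesis by (rule hn_reflect)
  qed
  show "t \<simeq> u \<Longrightarrow> hn t \<longleftrightarrow> hn u" using * eqv_sym by blast
qed

lemma eqv_not_hn: "\<not> hn t \<Longrightarrow> \<not> hn u \<Longrightarrow> t \<simeq> u"
  by (rule eqvI) (simp add: not_hn_apps)

text \<open>A saturated tuple passes control to the next argument; feeding \<open>Om\<close> there measures by how many
  arguments the tuple was short.\<close>

lemma eqv_head_aux:
  assumes e: "apps (Var h) bs \<simeq> apps (Var i) cs"
  obtains N where "\<And>\<nu>. (\<And>i. N \<le> \<nu> i) \<Longrightarrow> \<nu> h - length bs = \<nu> i - length cs"
    "length bs \<le> N" "length cs \<le> N"
proof -
  obtain N where "eqv_from N (apps (Var h) bs) (apps (Var i) cs)" using e unfolding eqv_def by blast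
  note N = eqv_fromD[OF this]
  define M where "M = max N (max (length bs) (length cs))"
  have no: False if nu: "\<And>i. M \<le> \<nu> i" and lt: "\<nu> h - length bs < \<nu> i - length cs"
    and ab: "length bs \<le> M" "length cs \<le> M" and
    hn: "\<And>as. (\<And>a. a \<in> set as \<Longrightarrow> closed a) \<Longrightarrow>
      hn (apps (psub (\<lambda>i. tup (\<nu> i)) (apps (Var h) bs)) as)
        = hn (apps (psub (\<lambda>i. tup (\<nu> i)) (apps (Var i) cs)) as)" for \<nu> h i bs cs
  proof -
    \<comment> \<open>The left tuple lacks \<open>a\<close> components. After \<open>a\<close>
      dummies it is full and a further \<open>Om\<close> becomes its head, while the right tuple
      still absorbs that \<open>Om\<close>.\<close>
    define a where "a = \<nu> h - length bs"
    let ?s = "psub (\<lambda>i. tup (\<nu> i))"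
    have "hn (apps (tup (\<nu> i)) (map ?s cs @ replicate a Om @ [Om]))"
      by (rule hn_tup) (use lt in \<open>simp add: a_def\<close>)
    then have "hn (apps (?s (apps (Var i) cs)) (replicate a Om @ [Om]))" by simp
    moreover have "hn (apps (?s (apps (Var h) bs)) (replicate a Om @ [Om]))
      = hn (apps (?s (apps (Var i) cs)) (replicate a Om @ [Om]))"
      by (rule hn) auto
    ultimately have "hn (apps (?s (apps (Var h) bs)) (replicate a Om @ [Om]))" by blast
    then have 1: "hn (apps (tup (\<nu> h)) (map ?s bs @ replicate a Om) \<cdot> Om)" by simp
    have len: "length (map ?s bs @ replicate a Om) = \<nu> h" using nu[of h] ab by (simp add: a_def)
    from whs_tup[of "map ?s bs @ replicate a Om" Om] 1 have "hn (apps Om (map ?s bs @ replicate a Om))"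
      unfolding len by (simp only: hn_whs)
    then show False using hn_appsD not_hn_Om by blast
  qed
  have "\<nu> h - length bs = \<nu> i - length cs" if "\<And>i. M \<le> \<nu> i" for \<nu>
  proof -
    have 1: "N \<le> \<nu> i" for i using that[of i] by (simp add: M_def)
    have eqN: "hn (apps (psub (\<lambda>i. tup (\<nu> i)) (apps (Var h) bs)) as)
        = hn (apps (psub (\<lambda>i. tup (\<nu> i)) (apps (Var i) cs)) as)"
      if "\<And>a. a \<in> set as \<Longrightarrow> closed a" for as
      by (rule N) (use 1 that in auto)
    have le: "length bs \<le> M" "length cs \<le> M" by (simp_all add: M_def)
    have "\<not> \<nu> h - length bs < \<nu> i - length cs"
    proof
      assume lt: "\<nu> h - length bs < \<nu> i - length cs"
      show False by (rule no[OF that lt le eqN])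
    qed
    moreover have "\<not> \<nu> i - length cs < \<nu> h - length bs"
    proof
      assume lt: "\<nu> i - length cs < \<nu> h - length bs"
      show False by (rule no[OF that lt le(2,1) eqN[symmetric]])
    qed
    ultimately show ?thesis by simp
  qed
  then show thesis using that[of M] by (simp add: M_def)
qed

lemma eqv_head:
  assumes e: "apps (Var h) bs \<simeq> apps (Var i) cs"
  shows "h = i" "length bs = length cs"
proof -
  obtain N where N: "\<And>\<nu>. (\<And>i. N \<le> \<nu> i) \<Longrightarrow> \<nu> h - length bs = \<nu> i - length cs"
    "length bs \<le> N" "length cs \<le> N" by (rule eqv_head_aux[OF e]) (rule that, auto)
  show "h = i"
  proof (rule ccontr)
    assume "h \<noteq> i"
    \<comment> \<open>Enlarging the tuple for \<open>h\<close> alone changes one side of the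
      equation only.\<close>
    have "((\<lambda>_. N)(h := Suc N)) h - length bs = ((\<lambda>_. N)(h := Suc N)) i - length cs"
      by (rule N(1)) simp
    with \<open>h \<noteq> i\<close> N(1)[of "\<lambda>_. N"] N(2,3) show False by auto
  qed
  with N(1)[of "\<lambda>_. N"] N(2,3) show "length bs = length cs" by auto
qed

lemma eqv_comps:
  assumes e: "apps (Var h) bs \<simeq> apps (Var i) cs" and l: "l < length bs"
  shows "bs ! l \<simeq> cs ! l"
proof -
  have hi: "h = i" and len0: "length bs = length cs" using eqv_head[OF e] .
  obtain N where "eqv_from N (apps (Var h) bs) (apps (Var i) cs)" using e unfolding eqv_def by blast
  note N = eqv_fromD[OF this]
  show ?thesis
  proof (rule eqvI[of "max N (length bs)"])
    fix \<nu> :: "nat \<Rightarrow> nat" and as assume nu: "\<And>i. max N (length bs) \<le> \<nu> i" and as: "\<And>a. a \<in> set as \<Longrightarrow> closed a"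
    let ?s = "psub (\<lambda>i. tup (\<nu> i))"
    \<comment> \<open>The identities fill up the tuple, the selector exposes component
      \<open>l\<close>, and \<open>as\<close> tests it.\<close>
    let ?d = "replicate (\<nu> h - length bs) Id_trm @ sel (\<nu> h) l # as"
    have N': "N \<le> \<nu> i" "length bs \<le> \<nu> i" for i using nu[of i] by auto
    have *: "hn (apps (?s (apps (Var h) bs)) ?d) = hn (apps (?s (bs ! l)) as)"
      if "length bs \<le> \<nu> h" "l < length bs" "length bs = length cs" for bs
    proof -
      let ?bs = "map ?s bs @ replicate (\<nu> h - length cs) Id_trm"
      have len: "length ?bs = \<nu> h" using that by simp
      have "whs (apps (tup (\<nu> h)) ?bs \<cdot> sel (\<nu> h) l) (?bs ! l)"
        using whs_tup_sel[of l ?bs] that unfolding len by simp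
      then have "whs (apps (apps (tup (\<nu> h)) ?bs \<cdot> sel (\<nu> h) l) as) (apps (?s (bs ! l)) as)"
        using that by (intro whs_apps) (simp add: nth_append)
      from hn_whs[OF this] show ?thesis using len0 by simp
    qed
    have cl: "closed a" if "a \<in> set ?d" for a
      using that as closed_sel[of l "\<nu> h"] l N'(2)[of h] by (auto simp: Id_trm_def)
    have "hn (apps (?s (apps (Var h) bs)) ?d) = hn (apps (?s (apps (Var i) cs)) ?d)"
      by (rule N) (use N' cl in auto)
    with *[of bs] *[of cs] len0 l N'(2)[of h] hi
    show "hn (apps (?s (bs ! l)) as) = hn (apps (?s (cs ! l)) as)" by simp
  qed
qed

text \<open>Up to \<eta> only: \<open>u\<close> may have to be given \<open>j\<close> fresh
  variables before its head surfaces, and these reappear, up to \<open>\<simeq>\<close>, as the last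
  components.\<close>

lemma eqv_inversion:
  assumes e: "u \<simeq> apps (Var i) ts" and d: "closed_at d u"
  obtains j us where "whs (apps u (map Var [d..<d + j])) (apps (Var i) us)"
    "length us = length ts + j" "\<forall>l<length ts. us ! l \<simeq> ts ! l"
    "\<forall>l<j. us ! (length ts + l) \<simeq> Var (d + l)"
proof -
  have "hn u" using eqv_hn[OF e] by simp
  then obtain j v where v: "whs (apps u (map Var [d..<d + j])) v" "vhead v" using d by (rule hn_out)
  then obtain h us where us: "v = apps (Var h) us" by (auto simp: vhead_iff)
  have e': "apps (Var h) us \<simeq> apps (Var i) (ts @ map Var [d..<d + j])"
    using eqv_trans[OF eqv_sym[OF eqv_whs[OF v(1)]] eqv_apps_same[OF e]] us by simp
  note hd = eqv_head[OF e'] and cs = eqv_comps[OF e']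
  show thesis
  proof (rule that[of j us])
    show "\<forall>l<length ts. us ! l \<simeq> ts ! l"
    proof (intro allI impI)
      show "us ! l \<simeq> ts ! l" if "l < length ts" for l
        using cs[of l] hd(2) that by (simp add: nth_append)
    qed
    show "\<forall>l<j. us ! (length ts + l) \<simeq> Var (d + l)"
    proof (intro allI impI)
      show "us ! (length ts + l) \<simeq> Var (d + l)" if "l < j" for l
        using cs[of "length ts + l"] hd(2) that by (simp add: nth_append)
    qed
  qed (use v us hd in auto)
qed

section \<open>Observational equivalence is a congruence\<close>

text \<open>A congruence candidate in the style of Howe's method. The rule \<open>rel_sub\<close>
  substitutes related terms into equivalent ones, which makes \<open>rel_psub\<close> a plain
  induction; that \<open>rel\<close> is no larger than \<open>\<simeq>\<close> rests on
  \<open>rel_hn_aux\<close>.\<close>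

inductive rel :: "trm \<Rightarrow> trm \<Rightarrow> bool" where
  rel_app: "rel t t' \<Longrightarrow> rel u u' \<Longrightarrow> rel (t \<cdot> u) (t' \<cdot> u')"
| rel_abs: "rel t t' \<Longrightarrow> rel (Abs t) (Abs t')"
| rel_sub: "t \<simeq> u \<Longrightarrow> (\<And>i. rel (\<sigma> i) (\<tau> i)) \<Longrightarrow> rel (psub \<sigma> t) (psub \<tau> u)"
| rel_var: "rel (Var i) (Var i)"

lemma rel_rename: "rel t u \<Longrightarrow> rel (psub (\<lambda>i. Var (r i)) t) (psub (\<lambda>i. Var (r i)) u)"
proof (induction arbitrary: r rule: rel.induct)
  case (rel_abs t t')
  from rel_abs.IH show ?case by (simp add: up_rename rel.rel_abs)
qed (simp_all add: rel.intros)

lemma rel_psub: "rel t u \<Longrightarrow> (\<And>i. rel (\<sigma> i) (\<tau> i)) \<Longrightarrow> rel (psub \<sigma> t) (psub \<tau> u)"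
proof (induction arbitrary: \<sigma> \<tau> rule: rel.induct)
  case (rel_abs t t')
  have "rel (up \<sigma> i) (up \<tau> i)" for i
    using rel_abs.prems by (cases i) (auto simp: lift0_psub rel_var intro: rel_rename)
  with rel_abs.IH show ?case by (simp add: rel.rel_abs)
qed (simp_all add: rel.intros)

lemma rel_refl: "rel t t"
  using rel_sub[where \<sigma> = Var and \<tau> = Var and t = t and u = t] by (simp add: rel_var)

lemma rel_eqv: "t \<simeq> u \<Longrightarrow> rel t u"
  using rel_sub[where \<sigma> = Var and \<tau> = Var and t = t and u = u] by (simp add: rel_var)

lemma rel_sym: "rel t u \<Longrightarrow> rel u t"
  by (induction rule: rel.induct) (auto intro: rel.intros eqv_sym)

lemma rel_apps: "rel t u \<Longrightarrow> list_all2 rel as bs \<Longrightarrow> rel (apps t as) (apps u bs)"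
proof (induction as arbitrary: t u bs)
  case (Cons a as)
  then obtain b bs' where "bs = b # bs'" "rel a b" "list_all2 rel as bs'"
    by (auto simp: list_all2_Cons1)
  with Cons.IH[of "t \<cdot> a" "u \<cdot> b" bs'] Cons.prems(1) show ?case by (simp add: rel_app)
qed simp

lemma wh_pow_Abs: "(wh ^^ n) (Abs t) v \<Longrightarrow> v = Abs t"
  by (induction n arbitrary: v) (simp, metis not_wh(2) relpowp_Suc_E)

text \<open>Outer induction on the number of steps, inner induction on the derivation of
  \<open>rel\<close>. A step made by an abstraction or by \<open>t\<close> lowers the outer measure.
  When a variable of \<open>t\<close> is at the head, no step has been made, but the derivation
  relating the terms substituted for it is smaller.\<close>

lemma rel_hn_aux:
  "rel h h' \<Longrightarrow> list_all2 rel as as' \<Longrightarrow> (wh ^^ n) (apps h as) v \<Longrightarrow> vhead v \<Longrightarrow> hn (apps h' as')"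
proof (induction n arbitrary: h h' as as' v rule: less_induct)
  case (less n)
  note IH = less.IH
  from less.prems show ?case
  proof (induction arbitrary: as as' v rule: rel.induct)
    case (rel_app t t' u u')
    from rel_app.IH(1)[of "u # as" "u' # as'" v] rel_app show ?case by simp
  next
    case (rel_abs t t')
    show ?case
    proof (cases as)
      case Nil
      with rel_abs.prems show ?thesis by (auto dest: wh_pow_Abs)
    next
      case (Cons a bs)
      then obtain a' bs' where as': "as' = a' # bs'" "rel a a'" "list_all2 rel bs bs'"
        using rel_abs.prems(1) by (auto simp: list_all2_Cons1)
      have w: "wh (apps (Abs t) as) (apps (subst t a 0) bs)" using wh_apps[OF wh_redex] Cons by simp
      then obtain m where m: "n = Suc m" "(wh ^^ m) (apps (subst t a 0) bs) v"
        using rel_abs.prems(2,3) vhead_no_wh wh_det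
        by (cases n) (simp, metis relpowp_Suc_D2)
      have "rel (subst t a 0) (subst t' a' 0)"
        unfolding subst0_psub by (rule rel_psub[OF rel_abs.hyps]) (auto simp: rel_var as' split: nat.split)
      with m rel_abs.prems(3) as' have "hn (apps (subst t' a' 0) bs')" by (intro IH[of m]) auto
      then show ?thesis using wh_apps[OF wh_redex, of t' a' bs'] hn_wh as' by simp
    qed
  next
    case (rel_var i)
    then show ?case by simp
  next
    case (rel_sub t u \<sigma> \<tau>)
    show ?case
    proof (cases t rule: whnf_cases)
      case 1
      then obtain i ts where t: "t = apps (Var i) ts" by (auto simp: vhead_iff)
      obtain d where d: "closed_at d (u \<cdot> t)" using ex_closed_at by blast
      then have du: "closed_at d u" and dt: "\<And>s. s \<in> set ts \<Longrightarrow> closed_at d s" "i < d" by (auto simp: t)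
      from rel_sub.hyps(1) have "u \<simeq> apps (Var i) ts" by (simp add: t eqv_sym)
      then obtain j us where us: "whs (apps u (map Var [d..<d + j])) (apps (Var i) us)"
        "length us = length ts + j" "\<forall>l<length ts. us ! l \<simeq> ts ! l"
        "\<forall>l<j. us ! (length ts + l) \<simeq> Var (d + l)"
        using du by (rule eqv_inversion)
      \<comment> \<open>If \<open>u\<close> needs \<open>j\<close> more arguments than
        \<open>t\<close>, dummies on both sides guarantee them; \<open>hn_appsD\<close> removes them
        at the end.\<close>
      define bs where "bs = as @ replicate j (Var 0)"
      define bs' where "bs' = as' @ replicate j (Var 0)"
      have len: "length as = length as'" using rel_sub.prems(1) by (rule list_all2_lengthD)
      have bs: "list_all2 rel bs bs'" unfolding bs_def bs'_def
        using rel_sub.prems(1) by (auto simp: list_all2_conv_all_nth nth_append rel_var)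
      then have bs_nth: "rel (bs ! l) (bs' ! l)" if "l < j" for l
        using that by (auto simp: list_all2_conv_all_nth bs_def)
      define \<sigma>' where "\<sigma>' k = (if k < d then \<sigma> k else if k < d + j then bs ! (k - d) else Var 0)" for k
      define \<tau>' where "\<tau>' k = (if k < d then \<tau> k else if k < d + j then bs' ! (k - d) else Var 0)" for k
      have rel': "rel (\<sigma>' k) (\<tau>' k)" for k
        unfolding \<sigma>'_def \<tau>'_def using rel_sub.hyps(2) bs_nth rel_var by auto
      have \<sigma>': "psub \<sigma>' s = psub \<sigma> s" if "closed_at d s" for s
        by (rule psub_cong_closed[OF that]) (simp add: \<sigma>'_def)
      have \<tau>': "psub \<tau>' s = psub \<tau> s" if "closed_at d s" for s
        by (rule psub_cong_closed[OF that]) (simp add: \<tau>'_def)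
      have args: "list_all2 rel (map (psub \<sigma>) ts @ bs) (map (psub \<tau>') us @ drop j bs')"
      proof -
        have "list_all2 rel (map (psub \<sigma>) ts @ take j bs) (map (psub \<tau>') us)"
        proof (rule list_all2_all_nthI)
          fix l assume l: "l < length (map (psub \<sigma>) ts @ take j bs)"
          show "rel ((map (psub \<sigma>) ts @ take j bs) ! l) (map (psub \<tau>') us ! l)"
          proof (cases "l < length ts")
            case True
            then have "rel (psub \<sigma>' (ts ! l)) (psub \<tau>' (us ! l))"
              using us(3)[rule_format, of l] rel' by (intro rel.rel_sub) (auto intro: eqv_sym)
            with True us(2) dt(1)[of "ts ! l"] show ?thesis by (simp add: nth_append \<sigma>')
          next
            case False
            define k where "k = l - length ts"
            have k: "k < j" "l = length ts + k" using l False by (auto simp: k_def bs_def)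
            have "rel (psub \<sigma>' (Var (d + k))) (psub \<tau>' (us ! l))"
              using us(4)[rule_format, of k] k rel' by (intro rel.rel_sub) (auto intro: eqv_sym)
            moreover have "k - length as < j" using k by simp
            ultimately show ?thesis using k us(2)
              by (auto simp: nth_append \<sigma>'_def bs_def split: if_splits)
          qed
        qed (use us(2) in \<open>simp add: bs_def\<close>)
        moreover have "list_all2 rel (drop j bs) (drop j bs')" using bs by (rule list_all2_dropI)
        ultimately have "list_all2 rel ((map (psub \<sigma>) ts @ take j bs) @ drop j bs)
          (map (psub \<tau>') us @ drop j bs')" by (rule list_all2_appendI)
        then show ?thesis by simp
      qed
      have "(wh ^^ n) (apps (\<sigma> i) (map (psub \<sigma>) ts @ bs)) (apps v (replicate j (Var 0)))"
      proof -
        have "(wh ^^ m) (apps x ys) (apps y ys)" if "(wh ^^ m) x y" for m x y ys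
          using that by (induction m arbitrary: y) (auto intro: wh_apps)
        from this[OF rel_sub.prems(2), of "replicate j (Var 0)"] show ?thesis by (simp add: t bs_def)
      qed
      then have "hn (apps (\<tau> i) (map (psub \<tau>') us @ drop j bs'))"
        by (rule rel_sub.IH[OF args]) (simp add: rel_sub.prems(3))
      also have "apps (\<tau> i) (map (psub \<tau>') us @ drop j bs') = apps (psub \<tau>' (apps (Var i) us)) (drop j bs')"
        using dt(2) by (simp add: \<tau>'_def)
      finally have "hn (apps (psub \<tau>' (apps u (map Var [d..<d + j]))) (drop j bs'))"
        using hn_whs[OF whs_apps[OF whs_psub[OF us(1)]]] by simp
      also have "apps (psub \<tau>' (apps u (map Var [d..<d + j]))) (drop j bs')
        = apps (psub \<tau> u) (take j bs' @ drop j bs')"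
      proof -
        have "j \<le> length bs'" by (simp add: bs'_def)
        then have "map (psub \<tau>') (map Var [d..<d + j]) = take j bs'"
          by (intro nth_equalityI) (auto simp: \<tau>'_def)
        then show ?thesis using \<tau>'[OF du] by (simp del: map_map append_take_drop_id)
      qed
      finally have "hn (apps (apps (psub \<tau> u) as') (replicate j (Var 0)))"
        unfolding append_take_drop_id by (simp add: bs'_def)
      then show ?thesis by (rule hn_appsD)
    next
      case (2 a)
      show ?thesis
      proof (cases as)
        case Nil
        with 2 rel_sub.prems show ?thesis by (auto dest: wh_pow_Abs)
      next
        case (Cons b bs)
        then obtain b' bs' where as': "as' = b' # bs'" "rel b b'" "list_all2 rel bs bs'"
          using rel_sub.prems(1) by (auto simp: list_all2_Cons1)
        have "wh (apps (psub \<sigma> t) as) (apps (psub (case_nat b \<sigma>) a) bs)"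
          using wh_apps[OF wh_redex, of "psub (up \<sigma>) a" b bs] Cons 2
          by (simp add: subst0_psub psub_up_env del: psub_psub)
        then obtain m where m: "n = Suc m" "(wh ^^ m) (apps (psub (case_nat b \<sigma>) a) bs) v"
          using rel_sub.prems(2,3) vhead_no_wh wh_det
          by (cases n) (simp, metis relpowp_Suc_D2)
        \<comment> \<open>\<open>u\<close> need not be an abstraction, so its application to a fresh
          variable stands for the body.\<close>
        have "a \<simeq> lift u 0 \<cdot> Var 0"
        proof -
          have "lift (Abs a) 0 \<cdot> Var 0 \<simeq> lift u 0 \<cdot> Var 0"
            using eqv_apps_same[OF eqv_lift[OF rel_sub.hyps(1)], of "[Var 0]"] by (simp add: 2)
          moreover have "wh (lift (Abs a) 0 \<cdot> Var 0) a"
          proof -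
            have "wh (lift (Abs a) 0 \<cdot> Var 0) (subst (lift a (Suc 0)) (Var 0) 0)"
              using wh_redex by simp
            also have "subst (lift a (Suc 0)) (Var 0) 0 = psub Var a"
              unfolding subst0_psub lift_psub psub_psub
              by (rule arg_cong[of _ _ "\<lambda>\<sigma>. psub \<sigma> a"]) (auto simp: fun_eq_iff split: nat.split)
            finally show ?thesis by simp
          qed
          ultimately show ?thesis using eqv_wh eqv_sym eqv_trans by blast
        qed
        then have "rel (psub (case_nat b \<sigma>) a) (psub (case_nat b' \<tau>) (lift u 0 \<cdot> Var 0))"
          using rel_sub.hyps(2) as' by (intro rel.rel_sub) (auto split: nat.split)
        also have "psub (case_nat b' \<tau>) (lift u 0 \<cdot> Var 0) = psub \<tau> u \<cdot> b'"
          by (simp add: lift0_psub psub_rename del: psub_psub)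
        finally have "hn (apps (psub \<tau> u \<cdot> b') bs')"
          using m rel_sub.prems(3) as' by (intro IH[of m]) auto
        then show ?thesis by (simp add: as')
      qed
    next
      case (3 s)
      have "wh (apps (psub \<sigma> t) as) (apps (psub \<sigma> s) as)" using 3 by (intro wh_apps wh_psub)
      then obtain m where m: "n = Suc m" "(wh ^^ m) (apps (psub \<sigma> s) as) v"
        using rel_sub.prems(2,3) vhead_no_wh wh_det
        by (cases n) (simp, metis relpowp_Suc_D2)
      have "s \<simeq> u" using eqv_wh[OF 3] rel_sub.hyps(1) eqv_sym eqv_trans by blast
      then have "rel (psub \<sigma> s) (psub \<tau> u)" using rel_sub.hyps(2) by (rule rel.rel_sub)
      then show ?thesis using m rel_sub.prems by (intro IH[of m]) auto
    qed
  qed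
qed

lemma rel_hn: "rel t u \<Longrightarrow> hn t \<Longrightarrow> hn u"
proof -
  assume r: "rel t u" and "hn t"
  then obtain as v n where v: "(wh ^^ n) (apps t as) v" "vhead v"
    unfolding hn_def by (metis rtranclp_imp_relpowp)
  have "list_all2 rel as as" by (simp add: list.rel_refl rel_refl)
  from rel_hn_aux[OF r this v] show "hn u" by (rule hn_appsD)
qed

text \<open>The tests that define \<open>\<simeq>\<close> consist of substitutions and applications,
  under which \<open>rel\<close> is closed; so \<open>rel_hn\<close> settles all of them.\<close>

theorem rel_iff_eqv: "rel t u \<longleftrightarrow> t \<simeq> u"
proof
  assume r: "rel t u"
  show "t \<simeq> u"
  proof (rule eqvI[of 0])
    fix \<nu> :: "nat \<Rightarrow> nat" and as
    have "rel (apps (psub (\<lambda>i. tup (\<nu> i)) t) as) (apps (psub (\<lambda>i. tup (\<nu> i)) u) as)"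
      by (intro rel_apps rel_psub r rel_refl) (simp add: list.rel_refl rel_refl)
    then show "hn (apps (psub (\<lambda>i. tup (\<nu> i)) t) as) = hn (apps (psub (\<lambda>i. tup (\<nu> i)) u) as)"
      using rel_hn rel_sym by blast
  qed
qed (rule rel_eqv)

lemma eqv_app: "t \<simeq> t' \<Longrightarrow> u \<simeq> u' \<Longrightarrow> t \<cdot> u \<simeq> t' \<cdot> u'"
  unfolding rel_iff_eqv[symmetric] by (rule rel_app)

lemma eqv_abs: "t \<simeq> t' \<Longrightarrow> Abs t \<simeq> Abs t'"
  unfolding rel_iff_eqv[symmetric] by (rule rel_abs)

lemma eqv_psub: "t \<simeq> u \<Longrightarrow> (\<And>i. \<sigma> i \<simeq> \<tau> i) \<Longrightarrow> psub \<sigma> t \<simeq> psub \<tau> u"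
  unfolding rel_iff_eqv[symmetric] by (rule rel_psub)

lemma eqv_apps: "t \<simeq> u \<Longrightarrow> list_all2 (\<simeq>) as bs \<Longrightarrow> apps t as \<simeq> apps u bs"
  using rel_apps unfolding rel_iff_eqv by blast

section \<open>Soundness of the \<open>\<omega>\<close>-theory for observational equivalence\<close>

lemma eqv_beta: "beta t u \<Longrightarrow> t \<simeq> u"
  by (induction rule: beta.induct) (auto intro: eqv_app eqv_abs eqv_wh wh_redex)

lemma eqv_beta_conv: "beta_conv t u \<Longrightarrow> t \<simeq> u"
proof (induction rule: equivclp_induct)
  case (step y z)
  then show ?case using eqv_beta eqv_sym eqv_trans by metis
qed simp

lemma whs_beta: "whs t u \<Longrightarrow> beta\<^sup>*\<^sup>* t u"
  by (induction rule: rtranclp_induct) (auto intro: wh_beta rtranclp.rtrancl_into_rtrancl)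

lemma whs_beta_conv: "whs t u \<Longrightarrow> beta_conv t u"
  using whs_beta rtranclp_into_equivclp by metis

text \<open>Every variable is replaced by \<open>p\<close>, which discards as many arguments as the
  head has and returns the identity.\<close>

lemma hn_closed_solvable:
  assumes "closed M" "hn M"
  shows "\<exists>as. (\<forall>a\<in>set as. closed a) \<and> beta_conv (apps M as) Id_trm"
proof -
  obtain j v where v: "whs (apps M (map Var [0..<0 + j])) v" "vhead v"
    using hn_out[OF assms(2,1)] .
  then obtain i us where us: "v = apps (Var i) us" by (auto simp: vhead_iff)
  define p where "p = (Abs ^^ length us) Id_trm"
  have p: "closed p" by (simp add: p_def Id_trm_def)
  have "whs (apps M (map (psub (\<lambda>_. p)) (map Var [0..<j]))) (apps p (map (psub (\<lambda>_. p)) us))"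
    using whs_psub[OF v(1), of "\<lambda>_. p"] assms(1) by (simp add: us)
  also have "whs (apps p (map (psub (\<lambda>_. p)) us)) Id_trm"
    using whs_Abs_pow[of "map (psub (\<lambda>_. p)) us" Id_trm] by (simp add: p_def Id_trm_def)
  finally have "beta_conv (apps M (map (psub (\<lambda>_. p)) (map Var [0..<j]))) Id_trm"
    by (rule whs_beta_conv)
  moreover have "\<forall>a\<in>set (map (psub (\<lambda>_. p)) (map Var [0..<j])). closed a" using p by simp
  ultimately show ?thesis by blast
qed

lemma hn_Abs_pow: "hn t \<Longrightarrow> hn ((Abs ^^ n) t)"
  by (induction n) (auto intro: hn_Abs)

lemma unsolvable_not_hn: "unsolvable t \<Longrightarrow> \<not> hn t"
proof
  assume u: "unsolvable t" and "hn t"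
  then have "hn (closure t)" by (simp add: closure_def hn_Abs_pow)
  moreover have "closed (closure t)"
    unfolding closure_def using LeastI_ex[OF ex_closed_at] by simp
  ultimately show False using u hn_closed_solvable unfolding unsolvable_def by blast
qed

lemma eqv_unsolvable: "unsolvable t \<Longrightarrow> t \<simeq> Om"
  using unsolvable_not_hn not_hn_Om eqv_not_hn by blast

lemma eqv_betaOm: "betaOm t u \<Longrightarrow> t \<simeq> u"
  by (induction rule: betaOm.induct)
    (auto intro: eqv_app eqv_abs eqv_wh wh_redex eqv_unsolvable)

lemma eqv_betaOms: "betaOm\<^sup>*\<^sup>* t u \<Longrightarrow> t \<simeq> u"
proof (induction rule: rtranclp_induct)
  case (step y z)
  then show ?case using eqv_betaOm eqv_trans by metis
qed simp

lemma eqv_subst: "closed_at 1 X \<Longrightarrow> M \<simeq> N \<Longrightarrow> subst X M 0 \<simeq> subst X N 0"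
  unfolding subst0_psub by (rule eqv_psub) (auto split: nat.split)

text \<open>A nonempty list of test arguments starts with a closed term, to which the premise
  applies. For the empty list, a solvable \<open>P\<close> stays solvable on a sufficiently large
  tuple, again a closed argument.\<close>

lemma eqv_ext:
  assumes P: "closed P" and Q: "closed Q" and PQ: "\<And>M. closed M \<Longrightarrow> P \<cdot> M \<simeq> Q \<cdot> M"
  shows "P \<simeq> Q"
proof (rule eqvI[of 0])
  fix \<nu> :: "nat \<Rightarrow> nat" and as assume as: "\<And>a. a \<in> set as \<Longrightarrow> closed a"
  have aux: "hn Q" if "closed P" "closed Q" "hn P" "\<And>M. closed M \<Longrightarrow> P \<cdot> M \<simeq> Q \<cdot> M" for P Q
  proof -
    from hn_large_tup[OF hn_AppVar[OF \<open>hn P\<close>, of 0]] that(1)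
    obtain N where "hn (P \<cdot> tup N)" by force
    then have "hn (Q \<cdot> tup N)" using eqv_hn[OF that(4)] by simp
    then show ?thesis by (rule hn_AppD)
  qed
  show "hn (apps (psub (\<lambda>i. tup (\<nu> i)) P) as) = hn (apps (psub (\<lambda>i. tup (\<nu> i)) Q) as)"
  proof (cases as)
    case Nil
    with aux[OF P Q] aux[OF Q P] PQ eqv_sym P Q show ?thesis by auto
  next
    case (Cons a bs)
    with eqv_hn[OF eqv_apps_same[OF PQ[of a], of bs]] as P Q show ?thesis by simp
  qed
qed

section \<open>Runs along an infinite stack\<close>

lemma closed_not_vhead: "closed t \<Longrightarrow> \<not> vhead t"
  by (auto simp: vhead_iff)

lemma list_all2_nthI:
  "length xs = length ys \<Longrightarrow> (\<And>i. i < length ys \<Longrightarrow> P (xs ! i) (ys ! i)) \<Longrightarrow> list_all2 P xs ys"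
  by (simp add: list_all2_conv_all_nth)

text \<open>The argument \<open>k\<close> of \<open>target\<close> and \<open>bb\<close> counts the entries of the stack \<open>\<pi>\<close> that the term has
  received so far; position \<open>c m\<close> is the one at which the run is due to evaluate \<open>W m \<cdot> Z m\<close>.\<close>

locale stack =
  fixes \<pi> :: "nat \<Rightarrow> trm" and W Z :: "nat \<Rightarrow> trm" and c :: "nat \<Rightarrow> nat"
  assumes closed_\<pi> [simp]: "closed (\<pi> i)"
begin

definition seg :: "nat \<Rightarrow> nat \<Rightarrow> trm list" where
  "seg i j = map \<pi> [i..<j]"

lemma length_seg [simp]: "length (seg i j) = j - i"
  by (simp add: seg_def)

lemma nth_seg [simp]: "l < j - i \<Longrightarrow> seg i j ! l = \<pi> (i + l)"
  by (simp add: seg_def)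

lemma closed_seg [simp]: "a \<in> set (seg i j) \<Longrightarrow> closed a"
  by (auto simp: seg_def)

lemma seg_append: "i \<le> j \<Longrightarrow> j \<le> k \<Longrightarrow> seg i j @ seg j k = seg i k"
  unfolding seg_def by (metis le_Suc_ex map_append upt_add_eq_append)

lemma seg_Suc: "i \<le> k \<Longrightarrow> seg i (Suc k) = seg i k @ [\<pi> k]"
  by (simp add: seg_def)

lemma psub_seg [simp]: "map (psub \<sigma>) (seg i j) = seg i j"
  by (auto simp: seg_def)

lemma subst_seg [simp]: "map (\<lambda>a. subst a u k) (seg i j) = seg i j"
  by (auto simp: seg_def)

definition target :: "nat \<Rightarrow> trm \<Rightarrow> bool" where
  "target k s \<longleftrightarrow> (\<exists>m w q es. s = apps w (q # es) \<and> closed s \<and> w \<simeq> W m \<and> q \<simeq> Z m \<and> c m \<le> k \<and>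
     list_all2 (\<simeq>) es (seg (c m) k))"

text \<open>\<open>feed\<close> may be used at any time, not only at an abstraction. Hence supplying
  the next entry never changes success (\<open>feed\<close>, \<open>bb_extend\<close>), which the
  \<omega>-rule requires.\<close>

inductive bb :: "nat \<Rightarrow> trm \<Rightarrow> bool" where
  base: "target k s \<Longrightarrow> bb k s"
| feed: "bb (Suc k) (s \<cdot> \<pi> k) \<Longrightarrow> bb k s"
| step: "wh s s' \<Longrightarrow> bb k s' \<Longrightarrow> bb k s"

lemma bb_whs: "whs s s' \<Longrightarrow> bb k s' \<Longrightarrow> bb k s"
  by (induction rule: converse_rtranclp_induct) (auto intro: step)

lemma bb_feeds: "bb (k + j) (apps s (seg k (k + j))) \<Longrightarrow> bb k s"
proof (induction j)
  case (Suc j)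
  have "bb (Suc (k + j)) (apps s (seg k (k + j)) \<cdot> \<pi> (k + j))"
    using Suc.prems unfolding add_Suc_right seg_Suc[OF le_add1] apps_snoc .
  then show ?case by (rule Suc.IH[OF feed])
qed (simp add: seg_def)

lemma bb_extend: "bb k s \<Longrightarrow> bb (Suc k) (s \<cdot> \<pi> k)"
proof (induction rule: bb.induct)
  case (base k s)
  then obtain m w q es where *: "s = apps w (q # es)" "closed s" "w \<simeq> W m" "q \<simeq> Z m" "c m \<le> k"
    "list_all2 (\<simeq>) es (seg (c m) k)" unfolding target_def by blast
  have "s \<cdot> \<pi> k = apps w (q # es @ [\<pi> k])" by (simp add: *(1))
  moreover have "list_all2 (\<simeq>) (es @ [\<pi> k]) (seg (c m) (Suc k))"
    unfolding seg_Suc[OF *(5)] using *(6) by (intro list_all2_appendI) simp_all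
  ultimately have "target (Suc k) (s \<cdot> \<pi> k)"
    unfolding target_def using * closed_\<pi> le_SucI closed_at.simps(2) by metis
  then show ?case by (rule bb.base)
next
  case (step s s' k)
  then show ?case by (blast intro: bb.step wh_appL)
qed

lemma spine_subst:
  "subst X P 0 = apps w as \<Longrightarrow> \<not> vhead X \<Longrightarrow>
    \<exists>w' as'. X = apps w' as' \<and> w = subst w' P 0 \<and> as = map (\<lambda>a. subst a P 0) as'"
proof (induction as arbitrary: X rule: rev_induct)
  case Nil
  then show ?case by (intro exI[of _ X] exI[of _ "[]"]) simp
next
  case (snoc a as)
  then obtain X1 X2 where X: "X = X1 \<cdot> X2" by (cases X) auto
  with snoc.prems have "subst X1 P 0 = apps w as" "\<not> vhead X1" "a = subst X2 P 0" by auto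
  with snoc.IH[of X1] obtain w' as' where
    "X1 = apps w' as'" "w = subst w' P 0" "as = map (\<lambda>a. subst a P 0) as'" by blast
  with X \<open>a = _\<close> have "X = apps w' (as' @ [X2])" "as @ [a] = map (\<lambda>a. subst a P 0) (as' @ [X2])"
    by simp_all
  with \<open>w = _\<close> show ?case by blast
qed

text \<open>If the hole is not in head position, the weak head step is one of the context; if it is, we first
  fill only the head occurrence.\<close>

lemma bb_context:
  assumes P: "closed P" and Q: "closed Q" and PQ: "P \<simeq> Q"
    and main: "\<And>k es. (\<And>e. e \<in> set es \<Longrightarrow> closed e) \<Longrightarrow> bb k (apps P es) \<Longrightarrow> bb k (apps Q es)"
  shows "bb k (subst X P 0) \<Longrightarrow> closed_at 1 X \<Longrightarrow> bb k (subst X Q 0)"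
proof -
  have head: "bb k (subst X Q 0)"
    if X: "closed_at 1 X" and s: "s = subst X P 0"
      and *: "\<And>X. closed_at 1 X \<Longrightarrow> \<not> vhead X \<Longrightarrow> s = subst X P 0 \<Longrightarrow> bb k (subst X Q 0)" for X s k
  proof (cases "vhead X")
    case True
    then obtain i Xs where Xs: "X = apps (Var i) Xs" by (auto simp: vhead_iff)
    with X have i: "i = 0" by simp
    define Y where "Y = apps P Xs"
    have "bb k (subst Y Q 0)"
    proof (rule *)
      show "closed_at 1 Y" using X P by (simp add: Y_def Xs closed_mono)
      show "\<not> vhead Y" using closed_not_vhead[OF P] by (simp add: Y_def)
      show "s = subst Y P 0" using P by (simp add: s Y_def Xs i)
    qed
    then have "bb k (apps P (map (\<lambda>a. subst a Q 0) Xs))" using P by (simp add: Y_def)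
    then have "bb k (apps Q (map (\<lambda>a. subst a Q 0) Xs))"
      by (rule main[rotated]) (use X Q in \<open>auto simp: Xs closed_at_subst0\<close>)
    then show ?thesis by (simp add: Xs i)
  qed (use X s * in blast)
  have "bb k s \<Longrightarrow> closed_at 1 X \<Longrightarrow> s = subst X P 0 \<Longrightarrow> bb k (subst X Q 0)" for s
  proof (induction arbitrary: X rule: bb.induct)
    case (base k s)
    from base.prems show ?case
    proof (rule head)
      fix X assume X: "closed_at 1 X" "\<not> vhead X" "s = subst X P 0"
      from base.hyps obtain m w q es where *: "s = apps w (q # es)" "closed s" "w \<simeq> W m" "q \<simeq> Z m"
        "c m \<le> k" "list_all2 (\<simeq>) es (seg (c m) k)" unfolding target_def by blast
      from spine_subst[of X P w "q # es"] X * obtain w' q' es' where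
        X': "X = apps w' (q' # es')" "w = subst w' P 0" "q = subst q' P 0"
        "es = map (\<lambda>a. subst a P 0) es'" by (auto simp: Cons_eq_map_conv)
      have cl: "closed_at 1 w'" "closed_at 1 q'" "\<And>e. e \<in> set es' \<Longrightarrow> closed_at 1 e"
        using X(1) by (auto simp: X'(1))
      have eq: "subst a Q 0 \<simeq> subst a P 0" if "closed_at 1 a" for a
        using eqv_subst[OF that eqv_sym[OF PQ]] .
      have "list_all2 (\<simeq>) (map (\<lambda>a. subst a Q 0) es') (seg (c m) k)"
      proof (rule list_all2_nthI)
        show len: "length (map (\<lambda>a. subst a Q 0) es') = length (seg (c m) k)"
          using list_all2_lengthD[OF *(6)] by (simp add: X'(4))
        show "map (\<lambda>a. subst a Q 0) es' ! i \<simeq> seg (c m) k ! i" if "i < length (seg (c m) k)" for i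
          using *(6) eq[OF cl(3)[of "es' ! i"]] that len
          by (auto simp: X'(4) list_all2_conv_all_nth intro: eqv_trans)
      qed
      moreover have "closed (subst X Q 0)" using X(1) Q by (simp add: closed_at_subst0)
      moreover have "subst X Q 0 = apps (subst w' Q 0) (subst q' Q 0 # map (\<lambda>a. subst a Q 0) es')"
        by (simp add: X'(1))
      ultimately have "target k (subst X Q 0)"
        unfolding target_def using *(3-5) X'(2,3) eq cl(1,2) eqv_trans by metis
      then show "bb k (subst X Q 0)" by (rule bb.base)
    qed
  next
    case (feed k s)
    have "bb (Suc k) (subst (X \<cdot> \<pi> k) Q 0)"
      by (rule feed.IH) (use feed.prems in \<open>simp_all add: closed_mono\<close>)
    then show ?case by (simp add: bb.feed)
  next
    case (step s s' k)
    from step.prems show ?case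
    proof (rule head)
      fix X assume X: "closed_at 1 X" "\<not> vhead X" "s = subst X P 0"
      show "bb k (subst X Q 0)"
      proof (cases X rule: whnf_cases)
        case (3 X')
        have "s' = subst X' P 0"
          using wh_det[OF step.hyps(1)] wh_psub[OF 3] X(3) unfolding subst0_psub by blast
        then have "bb k (subst X' Q 0)" using wh_closed_at[OF 3 X(1)] by (intro step.IH)
        then show ?thesis using wh_psub[OF 3] unfolding subst0_psub by (blast intro: bb.step)
      qed (use X step.hyps(1) in auto)
    qed
  qed
  then show "bb k (subst X P 0) \<Longrightarrow> closed_at 1 X \<Longrightarrow> bb k (subst X Q 0)" by blast
qed

text \<open>The quantifier over contexts is there for the Leibniz rule: contexts compose, so
  \<open>sim\<close> passes into them by \<open>sim_subst\<close>.\<close>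

definition sim :: "trm \<Rightarrow> trm \<Rightarrow> bool" where
  "sim M N \<longleftrightarrow> closed M \<and> closed N \<and> M \<simeq> N \<and>
     (\<forall>k X. closed_at 1 X \<longrightarrow> bb k (subst X M 0) = bb k (subst X N 0))"

lemma sim_refl: "closed M \<Longrightarrow> sim M M"
  by (simp add: sim_def)

lemma sim_sym: "sim M N \<Longrightarrow> sim N M"
  unfolding sim_def using eqv_sym by blast

lemma sim_trans: "sim M N \<Longrightarrow> sim N L \<Longrightarrow> sim M L"
  unfolding sim_def using eqv_trans by blast

lemma simI:
  assumes "closed P" "closed Q" "P \<simeq> Q"
    and "\<And>k es. (\<And>e. e \<in> set es \<Longrightarrow> closed e) \<Longrightarrow> bb k (apps P es) \<longleftrightarrow> bb k (apps Q es)"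
  shows "sim P Q"
  unfolding sim_def using assms eqv_sym bb_context[of P Q] bb_context[of Q P] by metis

lemma sim_subst:
  assumes "sim M N" "closed_at 1 X"
  shows "sim (subst X M 0) (subst X N 0)"
proof -
  have cl: "closed M" "closed N" "M \<simeq> N" using assms(1) by (auto simp: sim_def)
  have *: "subst Y (subst X L 0) 0 = subst (psub (\<lambda>_. X) Y) L 0" if "closed_at 1 Y" for Y L
    unfolding subst0_psub psub_psub by (rule psub_cong_closed[OF that]) simp
  have "bb k (subst Y (subst X M 0) 0) = bb k (subst Y (subst X N 0) 0)" if "closed_at 1 Y" for k Y
  proof -
    have "closed_at 1 (psub (\<lambda>_. X) Y)" by (rule closed_at_psub[OF that]) (rule assms(2))
    with assms(1) show ?thesis unfolding *[OF that] sim_def by blast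
  qed
  with cl assms(2) show ?thesis by (simp add: sim_def eqv_subst closed_at_subst0)
qed

text \<open>\<open>push\<close> is what the \<beta>-rules demand: contracting the head redex, even
  that of a target, keeps success. \<open>target_hn\<close> serves the rules for \<open>Om\<close>:
  nothing with an unsolvable head succeeds.\<close>

theorem omega_eq_sim:
  assumes push: "\<And>k s s'. target k s \<Longrightarrow> wh s s' \<Longrightarrow> bb k s'"
    and target_hn: "\<And>k s. target k s \<Longrightarrow> hn s"
  shows "M =\<^sub>\<omega> N \<Longrightarrow> sim M N"
proof -
  have bb_wh: "bb k s \<Longrightarrow> wh s s' \<Longrightarrow> bb k s'" for k s s'
  proof (induction arbitrary: s' rule: bb.induct)
    case (feed k s)
    then show ?case using bb.feed wh_appL by blast
  next
    case (step s s'' k)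
    then show ?case using wh_det by blast
  qed (rule push)
  have bb_hn: "bb k s \<Longrightarrow> hn s" for k s
    by (induction rule: bb.induct) (auto intro: target_hn hn_AppD simp: hn_wh)
  have beta: "sim (Abs U \<cdot> N) (subst U N 0)" if "closed (Abs U \<cdot> N)" for U N
  proof (rule simI)
    show "bb k (apps (Abs U \<cdot> N) es) = bb k (apps (subst U N 0) es)" for k es
      using wh_apps[OF wh_redex] bb_wh step by blast
  qed (use that wh_closed_at[OF wh_redex] eqv_wh[OF wh_redex] in auto)
  have Om: "sim M Om" if "closed M" "unsolvable M" for M
  proof (rule simI)
    show "bb k (apps M es) = bb k (apps Om es)" for k es
      using unsolvable_not_hn[OF that(2)] not_hn_Om bb_hn hn_appsD by blast
  qed (use that eqv_unsolvable in auto)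
  show "M =\<^sub>\<omega> N \<Longrightarrow> sim M N"
  proof (induction rule: omega_eq.induct)
    case (omega_Leibniz X Y M N)
    note MN = sim_subst[OF omega_Leibniz.IH(2)]
    from sim_trans[OF sim_trans[OF sim_sym[OF MN] omega_Leibniz.IH(1)] MN] omega_Leibniz.hyps(1,2)
    show ?case .
  next
    case (omega_rule P Q)
    show ?case
    proof (rule simI)
      show "P \<simeq> Q" by (rule eqv_ext) (use omega_rule in \<open>simp_all add: sim_def\<close>)
      fix k es assume es: "\<And>e. e \<in> set es \<Longrightarrow> closed e"
      have *: "bb k (apps (P \<cdot> e) es) = bb k (apps (Q \<cdot> e) es)"
        if "closed e" "\<And>e. e \<in> set es \<Longrightarrow> closed e" for k e es
      proof -
        have "closed_at 1 (apps (Var 0) es)" using that(2) by (auto simp: closed_mono)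
        then have "bb k (subst (apps (Var 0) es) (P \<cdot> e) 0) = bb k (subst (apps (Var 0) es) (Q \<cdot> e) 0)"
          using omega_rule.IH[OF that(1)] unfolding sim_def by blast
        moreover have "map (\<lambda>a. subst a u 0) es = es" for u using that(2) by (simp add: map_idI)
        ultimately show ?thesis by simp
      qed
      show "bb k (apps P es) = bb k (apps Q es)"
      proof (cases es)
        case Nil
        \<comment> \<open>With no argument present, the next stack entry provides the closed
          argument for the premise of the rule.\<close>
        have "bb k s \<longleftrightarrow> bb (Suc k) (s \<cdot> \<pi> k)" for s
          by (rule iffI[OF bb_extend feed])
        with Nil *[of "\<pi> k" "[]" "Suc k"] show ?thesis by simp
      next
        case (Cons e es')
        with es *[of e es' k] show ?thesis by simp
      qed
    qed (use omega_rule in auto)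
  qed (use sim_refl beta Om sim_sym in blast)+
qed

end

text \<open>The stack entry at position \<open>c m\<close> is substituted for the variable \<open>1\<close> below. The last argument
  \<open>F m\<close> of the variable \<open>0\<close> becomes the next \<open>W\<close>.\<close>

locale path = stack +
  fixes as :: "nat \<Rightarrow> trm list" and F :: "nat \<Rightarrow> trm"
  assumes c_less: "c m < c (Suc m)"
    and closed_W: "closed (W m)" and closed_Z [simp]: "closed (Z m)"
    and W_hnf: "W m \<cdot> Var 0 \<cdot> Var 1 \<simeq> apps (Var 0) (as m @ [F m])"
    and closed_as: "a \<in> set (as m) \<Longrightarrow> closed_at 2 a" and closed_F: "closed_at 2 (F m)"
    and F_next: "psub (case_nat (Z m) (\<lambda>_. \<pi> (c m))) (F m) \<simeq> W (Suc m)"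
    and calls: "apps (Z m) (map (psub (case_nat (Z m) (\<lambda>_. \<pi> (c m)))) (as m) @ Var 0
      # seg (Suc (c m)) (c (Suc m))) \<simeq> Var 0 \<cdot> Z (Suc m)"
    and WZ_hn: "hn (W m \<cdot> Z m)"
begin

lemma c_mono: "i \<le> j \<Longrightarrow> c i \<le> c j"
  using less_imp_le[OF c_less] by (rule lift_Suc_mono_le)

text \<open>Inverting the equivalence brings variable 0 of \<open>t\<close> to the head after
  \<open>j\<close> fresh variables. With \<open>w\<close> for variable 0 and the next
  \<open>j\<close> stack entries for the fresh ones, this is a run to a target.\<close>

lemma bb_reach:
  assumes t: "closed_at 1 t" and e: "t \<simeq> apps (Var 0) (Z m # seg (c m) k)" and k: "c m \<le> k"
    and w: "closed w" "w \<simeq> W m"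
  shows "bb k (subst t w 0)"
proof -
  obtain j us where us: "whs (apps t (map Var [1..<1 + j])) (apps (Var 0) us)"
    "length us = length (Z m # seg (c m) k) + j"
    "\<forall>l<length (Z m # seg (c m) k). us ! l \<simeq> (Z m # seg (c m) k) ! l"
    "\<forall>l<j. us ! (length (Z m # seg (c m) k) + l) \<simeq> Var (1 + l)"
    using e t by (rule eqv_inversion)
  define \<sigma> where "\<sigma> i = (case i of 0 \<Rightarrow> w | Suc i \<Rightarrow> \<pi> (k + i))" for i
  have cl_\<sigma>: "closed (\<sigma> i)" for i using w by (simp add: \<sigma>_def split: nat.split)
  have 1: "psub \<sigma> t = subst t w 0"
    unfolding subst0_psub by (rule psub_cong_closed[OF t]) (simp add: \<sigma>_def)
  have 2: "map (psub \<sigma>) (map Var [1..<1 + j]) = seg k (k + j)"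
    by (rule nth_equalityI) (auto simp: \<sigma>_def simp del: upt_Suc)
  have run: "whs (apps (subst t w 0) (seg k (k + j))) (apps w (map (psub \<sigma>) us))"
    using whs_psub[OF us(1), of \<sigma>] 2 by (simp add: 1 \<sigma>_def del: map_map)
  obtain q es where qes: "us = q # es" using us(2) by (cases us) auto
  have q: "psub \<sigma> q \<simeq> Z m"
    using eqv_psub[of q "Z m" \<sigma> \<sigma>] us(3)[rule_format, of 0] by (simp add: qes)
  have es: "list_all2 (\<simeq>) (map (psub \<sigma>) es) (seg (c m) (k + j))"
  proof (rule list_all2_nthI)
    show len: "length (map (psub \<sigma>) es) = length (seg (c m) (k + j))" using us(2) k by (simp add: qes)
    fix i assume i: "i < length (seg (c m) (k + j))"
    show "map (psub \<sigma>) es ! i \<simeq> seg (c m) (k + j) ! i"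
    proof (cases "i < k - c m")
      case True
      then have "es ! i \<simeq> \<pi> (c m + i)" using us(3)[rule_format, of "Suc i"] by (simp add: qes)
      then have "psub \<sigma> (es ! i) \<simeq> psub \<sigma> (\<pi> (c m + i))" by (rule eqv_psub) simp
      with i len show ?thesis by simp
    next
      case False
      define l where "l = i - (k - c m)"
      have l: "l < j" "Suc i = length (Z m # seg (c m) k) + l" "c m + i = k + l"
        using False i k by (auto simp: l_def)
      have "us ! Suc i \<simeq> Var (1 + l)" using us(4) l(1) unfolding l(2) by blast
      then have "psub \<sigma> (us ! Suc i) \<simeq> psub \<sigma> (Var (1 + l))" by (rule eqv_psub) simp
      with i len l(3) show ?thesis by (simp add: qes \<sigma>_def)
    qed
  qed
  have "closed (apps w (map (psub \<sigma>) us))"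
    using whs_closed_at[OF run, of 0] t w by (simp add: closed_at_subst0)
  moreover have "apps w (map (psub \<sigma>) us) = apps w (psub \<sigma> q # map (psub \<sigma>) es)" by (simp add: qes)
  ultimately have "target (k + j) (apps w (map (psub \<sigma>) us))"
    unfolding target_def using q es w(2) trans_le_add1[OF k] by metis
  with run have "bb (k + j) (apps (subst t w 0) (seg k (k + j)))" using base bb_whs by blast
  then show ?thesis by (rule bb_feeds)
qed

text \<open>With enough entries the head normal form of \<open>w\<close> surfaces and brings
  \<open>q\<close> to the head. By \<open>calls\<close>, \<open>q\<close> then calls the component
  equivalent to \<open>F m\<close>, which is the next \<open>W\<close>, with
  \<open>Z (Suc m)\<close>; \<open>bb_reach\<close> turns this equivalence into a run.\<close>

lemma push:
  assumes "target k s" and wh: "wh s s'"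
  shows "bb k s'"
proof -
  from assms(1) obtain m w q es where s: "s = apps w (q # es)" "closed s" "w \<simeq> W m" "q \<simeq> Z m"
    "c m \<le> k" "list_all2 (\<simeq>) es (seg (c m) k)" unfolding target_def by blast
  have clw: "closed w" and clq: "closed q" and cles: "\<And>e. e \<in> set es \<Longrightarrow> closed e"
    using s(2) by (auto simp: s(1))
  define n where "n = length (as m)"
  have "w \<cdot> Var 0 \<cdot> Var 1 \<simeq> apps (Var 0) (as m @ [F m])"
    using eqv_trans[OF eqv_app[OF eqv_app[OF s(3) eqv_refl] eqv_refl] W_hnf] .
  moreover have "closed_at 2 (w \<cdot> Var 0 \<cdot> Var 1)" using clw by (simp add: closed_mono)
  ultimately obtain j us where us:
    "whs (apps (w \<cdot> Var 0 \<cdot> Var 1) (map Var [2..<2 + j])) (apps (Var 0) us)"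
    "length us = length (as m @ [F m]) + j"
    "\<forall>l<length (as m @ [F m]). us ! l \<simeq> (as m @ [F m]) ! l"
    "\<forall>l<j. us ! (length (as m @ [F m]) + l) \<simeq> Var (2 + l)"
    by (rule eqv_inversion)
  \<comment> \<open>Enough entries to include those already received, to arrive at the next due
    position, and to serve variable 1 and the \<open>j\<close> fresh variables.\<close>
  define K where "K = max k (max (c (Suc m)) (c m + 1 + j))"
  have K: "k \<le> K" "c (Suc m) \<le> K" "c m + 1 + j \<le> K" by (auto simp: K_def)
  define es2 where "es2 = es @ seg k K"
  have es2: "list_all2 (\<simeq>) es2 (seg (c m) K)"
  proof -
    have "list_all2 (\<simeq>) es2 (seg (c m) k @ seg k K)"
      unfolding es2_def using s(6) by (intro list_all2_appendI) (simp_all add: list.rel_refl)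
    then show ?thesis using seg_append[OF s(5) K(1)] by simp
  qed
  have len2: "length es2 = K - c m" using list_all2_lengthD[OF es2] by simp
  have es2_nth: "es2 ! i \<simeq> \<pi> (c m + i)" if "i < K - c m" for i
    using es2 that by (auto simp: list_all2_conv_all_nth)
  have cl2: "closed (es2 ! i)" if "i < K - c m" for i
    using that len2 cles nth_mem[of i es2] by (auto simp: es2_def)
  \<comment> \<open>\<open>\<sigma>\<close> holds the actual arguments of the target and
    \<open>\<tau>\<close> the ideal ones; the default \<open>\<pi> (c m)\<close> merely closes all
    other variables.\<close>
  define \<sigma> where "\<sigma> i = (case i of 0 \<Rightarrow> q | Suc i \<Rightarrow> if i < Suc j then es2 ! i else \<pi> (c m))" for i
  define \<tau> where "\<tau> i = (case i of 0 \<Rightarrow> Z m | Suc i \<Rightarrow> if i < Suc j then \<pi> (c m + i) else \<pi> (c m))" for i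
  have \<sigma>\<tau>: "\<sigma> i \<simeq> \<tau> i" for i
    using s(4) es2_nth K(3) by (auto simp: \<sigma>_def \<tau>_def split: nat.split)
  have cl\<sigma>: "closed (\<sigma> i)" for i
    using clq cl2 K(3) by (auto simp: \<sigma>_def split: nat.split)
  have \<tau>: "psub \<tau> a = psub (case_nat (Z m) (\<lambda>_. \<pi> (c m))) a" if "closed_at 2 a" for a
    by (rule psub_cong_closed[OF that]) (auto simp: \<tau>_def less_Suc_eq numeral_2_eq_2)
  have args: "map (psub \<sigma>) (map Var [2..<2 + j]) = take j (drop 1 es2)"
    using K(3) len2 by (intro nth_equalityI) (auto simp: \<sigma>_def numeral_2_eq_2 simp del: upt_Suc)
  have es2_split: "es2 = es2 ! 0 # take j (drop 1 es2) @ drop (Suc j) es2"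
  proof -
    obtain x xs where x: "es2 = x # xs" using len2 K(3) by (cases es2) auto
    show ?thesis unfolding x by simp
  qed
  define rest where "rest = drop (Suc j) es2"
  let ?u = "apps (w \<cdot> Var 0 \<cdot> Var 1) (map Var [2..<2 + j])"
  have start: "apps (psub \<sigma> ?u) rest = apps s (seg k K)"
  proof -
    have "apps (psub \<sigma> ?u) rest = apps (w \<cdot> q \<cdot> (es2 ! 0)) (take j (drop 1 es2) @ rest)"
      using clw args by (simp add: \<sigma>_def del: map_map)
    also have "\<dots> = apps (w \<cdot> q) (es2 ! 0 # take j (drop 1 es2) @ rest)" by simp
    also have "\<dots> = apps (w \<cdot> q) es2" using es2_split unfolding rest_def by simp
    finally show ?thesis by (simp add: s(1) es2_def)
  qed
  \<comment> \<open>Component \<open>n\<close>, the one equivalent to \<open>F m\<close>, is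
    replaced by the hole \<open>Var 0\<close>, as in \<open>calls\<close>.\<close>
  define t where "t = apps q (map (psub \<sigma>) (take n us) @ Var 0 # map (psub \<sigma>) (drop (Suc n) us) @ rest)"
  define w' where "w' = psub \<sigma> (us ! n)"
  have lenus: "length us = Suc n + j" using us(2) by (simp add: n_def)
  have us_split: "us = take n us @ us ! n # drop (Suc n) us"
    using lenus by (simp add: id_take_nth_drop)
  have us_cl: "closed (psub \<sigma> a)" for a
    using closed_at_psub ex_closed_at cl\<sigma> by metis
  have rest_cl: "closed a" if "a \<in> set rest" for a
    using that cl2 len2 unfolding rest_def by (auto simp: in_set_conv_nth)
  have st: "subst t w' 0 = apps (psub \<sigma> (apps (Var 0) us)) rest"
  proof -
    have "map (\<lambda>a. subst a w' 0) rest = rest" using rest_cl by (simp add: map_idI)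
    then have "subst t w' 0 = apps q ((map (psub \<sigma>) (take n us) @ w' # map (psub \<sigma>) (drop (Suc n) us)) @ rest)"
      using clq us_cl by (simp add: t_def o_def)
    also have "map (psub \<sigma>) (take n us) @ w' # map (psub \<sigma>) (drop (Suc n) us) = map (psub \<sigma>) us"
      unfolding w'_def by (metis list.simps(9) map_append us_split)
    finally show ?thesis by (simp add: \<sigma>_def)
  qed
  have te: "t \<simeq> apps (Var 0) (Z (Suc m) # seg (c (Suc m)) K)"
  proof -
    let ?\<tau> = "case_nat (Z m) (\<lambda>_. \<pi> (c m))"
    have 1: "list_all2 (\<simeq>) (map (psub \<sigma>) (take n us)) (map (psub ?\<tau>) (as m))"
    proof (rule list_all2_nthI)
      show "length (map (psub \<sigma>) (take n us)) = length (map (psub ?\<tau>) (as m))"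
        using lenus by (simp add: n_def)
      fix i assume i: "i < length (map (psub ?\<tau>) (as m))"
      then have "us ! i \<simeq> as m ! i" using us(3)[rule_format, of i] by (simp add: nth_append)
      then have "psub \<sigma> (us ! i) \<simeq> psub \<tau> (as m ! i)" using \<sigma>\<tau> by (rule eqv_psub)
      with i \<tau>[OF closed_as[OF nth_mem]] lenus show "map (psub \<sigma>) (take n us) ! i \<simeq> map (psub ?\<tau>) (as m) ! i"
        by (simp add: n_def)
    qed
    have 2: "list_all2 (\<simeq>) (map (psub \<sigma>) (drop (Suc n) us) @ rest) (seg (Suc (c m)) K)"
    proof (rule list_all2_nthI)
      show len: "length (map (psub \<sigma>) (drop (Suc n) us) @ rest) = length (seg (Suc (c m)) K)"
        using lenus len2 K(3) by (simp add: rest_def)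
      fix i assume i: "i < length (seg (Suc (c m)) K)"
      show "(map (psub \<sigma>) (drop (Suc n) us) @ rest) ! i \<simeq> seg (Suc (c m)) K ! i"
      proof (cases "i < j")
        case True
        then have "us ! (Suc n + i) \<simeq> Var (2 + i)" using us(4)[rule_format, of i] by (simp add: n_def)
        then have "psub \<sigma> (us ! (Suc n + i)) \<simeq> psub \<tau> (Var (2 + i))" using \<sigma>\<tau> by (rule eqv_psub)
        with True i lenus show ?thesis by (simp add: nth_append \<tau>_def numeral_2_eq_2)
      next
        case False
        with es2_nth[of "Suc i"] i lenus len2 show ?thesis by (simp add: nth_append rest_def)
      qed
    qed
    have "t \<simeq> apps (Z m) (map (psub ?\<tau>) (as m) @ Var 0 # seg (Suc (c m)) K)"
      unfolding t_def by (intro eqv_apps s(4) list_all2_appendI 1 list_all2_Cons[THEN iffD2] conjI eqv_refl 2)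
    also have "seg (Suc (c m)) K = seg (Suc (c m)) (c (Suc m)) @ seg (c (Suc m)) K"
      using seg_append[of "Suc (c m)" "c (Suc m)" K] c_less[of m] K(2) by simp
    also have "apps (Z m) (map (psub ?\<tau>) (as m) @ Var 0 # \<dots>)
      = apps (apps (Z m) (map (psub ?\<tau>) (as m) @ Var 0 # seg (Suc (c m)) (c (Suc m)))) (seg (c (Suc m)) K)"
      by simp
    also have "\<dots> \<simeq> apps (Var 0 \<cdot> Z (Suc m)) (seg (c (Suc m)) K)"
      by (rule eqv_apps_same[OF calls])
    finally show ?thesis by simp
  qed
  have "bb K (subst t w' 0)"
  proof (rule bb_reach[OF _ te K(2)])
    show "closed_at 1 t" using us_cl rest_cl clq by (auto simp: t_def closed_mono)
    show "closed w'" by (simp add: w'_def us_cl)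
    have "us ! n \<simeq> F m" using us(3)[rule_format, of n] by (simp add: n_def)
    then have "w' \<simeq> psub \<tau> (F m)" unfolding w'_def using \<sigma>\<tau> by (rule eqv_psub)
    with F_next show "w' \<simeq> W (Suc m)" using \<tau>[OF closed_F] eqv_trans by metis
  qed
  \<comment> \<open>\<open>w\<close> is closed, so at least one step precedes the variable head. By
    determinism the instance of that step is the given one, and the rest of the run starts from
    \<open>s'\<close>.\<close>
  moreover obtain y where y: "wh ?u y" "whs y (apps (Var 0) us)"
  proof -
    have "\<not> vhead ?u" using closed_not_vhead[OF clw] by simp
    then have "?u \<noteq> apps (Var 0) us" by (metis vhead_apps vhead.simps(1))
    with us(1) that show thesis by (metis converse_rtranclpE)
  qed
  moreover have "apps (psub \<sigma> y) rest = apps s' (seg k K)"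
    using wh_det[OF wh_apps[OF wh_psub[OF y(1)]]] wh_apps[OF wh] start by metis
  ultimately have "bb K (apps s' (seg k K))"
    using bb_whs[OF whs_apps[OF whs_psub[OF y(2), of \<sigma>], of rest]] st by simp
  then show ?thesis using bb_feeds[of k "K - k" s'] K(1) by simp
qed

text \<open>Dropping arguments preserves solvability, so the target is first extended by entries up
  to a later due position; there it is equivalent to some \<open>W\<close> applied to its
  \<open>Z\<close>, solvable by \<open>WZ_hn\<close>.\<close>

lemma target_hn: "target k s \<Longrightarrow> hn s"
proof -
  assume "target k s"
  then obtain m w q es where s: "s = apps w (q # es)" "closed s" "w \<simeq> W m" "q \<simeq> Z m"
    "c m \<le> k" "list_all2 (\<simeq>) es (seg (c m) k)" unfolding target_def by blast
  have stage: "apps (W m) (Z m # seg (c m) (c (Suc m))) \<simeq> W (Suc m) \<cdot> Z (Suc m)" for m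
  proof -
    let ?\<tau> = "case_nat (Z m) (\<lambda>_. \<pi> (c m))"
    have "psub ?\<tau> (W m \<cdot> Var 0 \<cdot> Var 1) \<simeq> psub ?\<tau> (apps (Var 0) (as m @ [F m]))"
      using W_hnf by (rule eqv_psub) simp
    then have 1: "W m \<cdot> Z m \<cdot> \<pi> (c m) \<simeq> apps (Z m) (map (psub ?\<tau>) (as m) @ [psub ?\<tau> (F m)])"
      using closed_W by simp
    have "seg (c m) (c (Suc m)) = \<pi> (c m) # seg (Suc (c m)) (c (Suc m))"
      using c_less[of m] by (simp add: seg_def upt_conv_Cons)
    then have "apps (W m) (Z m # seg (c m) (c (Suc m))) = apps (W m \<cdot> Z m \<cdot> \<pi> (c m)) (seg (Suc (c m)) (c (Suc m)))"
      by simp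
    also have "\<dots> \<simeq> apps (apps (Z m) (map (psub ?\<tau>) (as m) @ [psub ?\<tau> (F m)])) (seg (Suc (c m)) (c (Suc m)))"
      by (rule eqv_apps_same[OF 1])
    also have "\<dots> \<simeq> apps (apps (Z m) (map (psub ?\<tau>) (as m) @ [W (Suc m)])) (seg (Suc (c m)) (c (Suc m)))"
      by (intro eqv_apps) (simp_all add: list.rel_refl list_all2_appendI F_next)
    also have "\<dots> = psub (\<lambda>_. W (Suc m)) (apps (Z m) (map (psub ?\<tau>) (as m) @ Var 0
        # seg (Suc (c m)) (c (Suc m))))"
    proof -
      have "closed (psub ?\<tau> a)" for a
        by (metis closed_at_psub ex_closed_at closed_Z closed_\<pi> old.nat.simps(4,5) not0_implies_Suc)
      then show ?thesis by (simp add: o_def del: psub_psub)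
    qed
    also have "\<dots> \<simeq> psub (\<lambda>_. W (Suc m)) (Var 0 \<cdot> Z (Suc m))"
      using calls by (rule eqv_psub) simp
    finally show ?thesis by simp
  qed
  have hn: "hn (apps (W m) (Z m # seg (c m) (c (m + j))))" for j m
  proof (induction j arbitrary: m)
    case 0
    then show ?case using WZ_hn by (simp add: seg_def)
  next
    case (Suc j)
    have mono: "c m \<le> c (Suc m)" "c (Suc m) \<le> c (Suc m + j)"
      using c_mono by simp_all
    have "apps (W m) (Z m # seg (c m) (c (m + Suc j)))
      = apps (apps (W m) (Z m # seg (c m) (c (Suc m)))) (seg (c (Suc m)) (c (Suc m + j)))"
      using seg_append[OF mono, symmetric] by simp
    also have "\<dots> \<simeq> apps (W (Suc m) \<cdot> Z (Suc m)) (seg (c (Suc m)) (c (Suc m + j)))"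
      by (rule eqv_apps_same[OF stage])
    finally show ?case using Suc[of "Suc m"] eqv_hn by simp
  qed
  have "j \<le> c j" for j
    by (induction j) (use c_less Suc_leI le_less_trans in \<open>simp, blast\<close>)
  from this[of "m + k"] have k: "k \<le> c (m + k)" by simp
  have "hn (apps (apps (W m) (Z m # seg (c m) k)) (seg k (c (m + k))))"
    using hn[of m k] seg_append[OF s(5) k] by (metis append_Cons foldl_append)
  then have "hn (apps (W m) (Z m # seg (c m) k))" by (rule hn_appsD)
  moreover have "s \<simeq> apps (W m) (Z m # seg (c m) k)"
    unfolding s(1) using s(3,4,6) by (intro eqv_apps) simp_all
  ultimately show "hn s" using eqv_hn by blast
qed

theorem omega_sim: "M =\<^sub>\<omega> N \<Longrightarrow> sim M N"
  using push target_hn by (rule omega_eq_sim)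

end

section \<open>Head variables reached by \<open>\<beta>\<close>-convertible terms\<close>

text \<open>The number of arguments is recorded because the run of \<open>B\<^sub>1\<close> is
  followed by actual weak head steps, with no room for additional arguments.\<close>

definition reach :: "nat \<Rightarrow> nat \<Rightarrow> trm \<Rightarrow> bool" where
  "reach n i t \<longleftrightarrow> (\<exists>bs. length bs = n \<and> whs t (apps (Var i) bs))"

text \<open>Unlike \<open>\<simeq>\<close>, this equivalence does not identify \<open>\<eta>\<close>-convertible terms.\<close>

definition beq :: "trm \<Rightarrow> trm \<Rightarrow> bool" where
  "beq t u \<longleftrightarrow> (\<forall>\<sigma> as n i. reach n i (apps (psub \<sigma> t) as) = reach n i (apps (psub \<sigma> u) as))"

lemma reach_wh: "wh t u \<Longrightarrow> reach n i t = reach n i u"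
proof -
  assume wh: "wh t u"
  have "whs t (apps (Var i) bs) = whs u (apps (Var i) bs)" for bs
  proof
    assume "whs t (apps (Var i) bs)"
    then show "whs u (apps (Var i) bs)" by (rule whs_vhead_step) (simp_all add: wh)
  qed (use wh in \<open>simp add: converse_rtranclp_into_rtranclp\<close>)
  then show ?thesis by (simp add: reach_def)
qed

lemma reach_whs: "whs t u \<Longrightarrow> reach n i t = reach n i u"
  by (induction rule: rtranclp_induct) (auto simp: reach_wh)

lemma reach_vhead: "reach n i (apps (Var h) bs) \<longleftrightarrow> h = i \<and> length bs = n"
proof -
  have inj: "apps (Var h) bs = apps (Var i) cs \<longleftrightarrow> h = i \<and> bs = cs" for cs
  proof (induction bs arbitrary: cs rule: rev_induct)
    case Nil
    then show ?case by (cases cs rule: rev_cases) auto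
  next
    case (snoc b bs)
    then show ?case by (cases cs rule: rev_cases) auto
  qed
  have *: "whs (apps (Var h) bs) u \<longleftrightarrow> apps (Var h) bs = u" for u
    using vhead_no_wh[of "apps (Var h) bs"] by (auto elim: converse_rtranclpE)
  show ?thesis unfolding reach_def * inj by auto
qed

lemma beq_context:
  assumes "\<And>l. beq (\<rho> l) (\<rho>' l)"
  shows "reach n i (psub \<rho> X) \<Longrightarrow> reach n i (psub \<rho>' X)"
proof -
  have "(wh ^^ m) (psub \<rho> X) (apps (Var i) bs) \<Longrightarrow> length bs = n \<Longrightarrow> (\<And>l. beq (\<rho> l) (\<rho>' l)) \<Longrightarrow>
    reach n i (psub \<rho>' X)" for m bs
  proof (induction m arbitrary: X \<rho> \<rho>' rule: less_induct)
    case (less m)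
    note beq = less.prems(3)
    have nv: "reach n i (psub \<rho>' Y)" if Y: "\<not> vhead Y" "(wh ^^ m) (psub \<rho> Y) (apps (Var i) bs)"
      "\<And>l. beq (\<rho> l) (\<rho>' l)" for Y \<rho> \<rho>'
    proof (cases Y rule: whnf_cases)
      case (2 u)
      with Y(2) wh_pow_Abs[of m _ "apps (Var i) bs"] have "apps (Var i) bs = Abs (psub (up \<rho>) u)" by simp
      then show ?thesis by (metis vhead_apps vhead.simps(1,3))
    next
      case (3 Y')
      have "m \<noteq> 0" using Y(2) wh_psub[OF 3, of \<rho>] vhead_no_wh[of "apps (Var i) bs"] by (cases m) auto
      then obtain k where k: "m = Suc k" by (cases m) auto
      then obtain y where y: "wh (psub \<rho> Y) y" "(wh ^^ k) y (apps (Var i) bs)"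
        using Y(2) by (metis relpowp_Suc_D2)
      with wh_det[OF y(1) wh_psub[OF 3]] have "reach n i (psub \<rho>' Y')"
        using less.IH[of k \<rho> Y' \<rho>'] k less.prems(2) Y(3) by simp
      then show ?thesis using reach_wh[OF wh_psub[OF 3]] by simp
    qed (use Y in auto)
    show ?case
    proof (cases "vhead X")
      case True
      then obtain l Xs where X: "X = apps (Var l) Xs" by (auto simp: vhead_iff)
      obtain d where d: "closed_at d X" using ex_closed_at by blast
      text \<open>Only the head occurrence is filled; the variables of the inserted term are moved out of the
        way of those of the context.\<close>
      define Y where "Y = apps (psub (\<lambda>i. Var (d + i)) (\<rho> l)) Xs"
      define \<tau> where "\<tau> \<rho> i = (if i < d then \<rho> i else Var (i - d))" for \<rho> :: "nat \<Rightarrow> trm" and i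
      have agree: "psub (\<tau> \<rho>) a = psub \<rho> a" if "a \<in> set Xs" for \<rho> a
        by (rule psub_cong_closed[of d]) (use that d in \<open>auto simp: X \<tau>_def\<close>)
      have tau: "psub (\<tau> \<rho>') Y = apps (\<rho> l) (map (psub \<rho>') Xs)" for \<rho>'
      proof -
        have 1: "\<tau> \<rho>' (d + i) = Var i" for i by (simp add: \<tau>_def)
        have 2: "map (psub (\<tau> \<rho>')) Xs = map (psub \<rho>') Xs" using agree by simp
        show ?thesis by (simp only: Y_def psub_apps psub_psub psub.simps 1 2 psub_Var)
      qed
      have "reach n i (psub (\<tau> \<rho>') Y)"
      \<comment> \<open>If the inserted term has a variable head, only the number of arguments
        counts; otherwise \<open>Y\<close> makes the next step itself and \<open>nv\<close>
        applies.\<close>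
      proof (cases "vhead (\<rho> l)")
        case True
        then obtain h hs where h: "\<rho> l = apps (Var h) hs" by (auto simp: vhead_iff)
        have "reach n i (psub (\<tau> \<rho>) Y)"
          unfolding reach_def using less.prems(1,2) by (auto simp: tau X intro: relpowp_imp_rtranclp)
        then have "reach n i (apps (Var h) (hs @ map (psub \<rho>) Xs))" unfolding tau h by simp
        then have "reach n i (apps (Var h) (hs @ map (psub \<rho>') Xs))" unfolding reach_vhead by simp
        then show ?thesis unfolding tau h by simp
      next
        case False
        have nvr: "\<not> vhead (psub (\<lambda>i. Var (r i)) t)" if "\<not> vhead t" for r :: "nat \<Rightarrow> nat" and t
          using that by (induction t) auto
        show ?thesis
        proof (rule nv)
          show "\<not> vhead Y" using nvr[OF False] by (simp add: Y_def)
          show "(wh ^^ m) (psub (\<tau> \<rho>) Y) (apps (Var i) bs)" using less.prems(1) by (simp add: tau X)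
          show "beq (\<tau> \<rho> l) (\<tau> \<rho>' l)" for l using beq by (auto simp: \<tau>_def beq_def)
        qed
      qed
      then have "reach n i (apps (\<rho> l) (map (psub \<rho>') Xs))" by (simp add: tau)
      then show ?thesis
        using beq[of l] unfolding beq_def X by (metis psub_apps psub.simps(1) psub_Var)
    qed (use nv less.prems in blast)
  qed
  then show "reach n i (psub \<rho> X) \<Longrightarrow> reach n i (psub \<rho>' X)"
    unfolding reach_def[of n i "psub \<rho> X"] using assms by (metis rtranclp_imp_relpowp)
qed

section \<open>Compatibility of \<open>beq\<close> with the term constructors and with
  \<beta>-conversion\<close>

lemma beq_refl: "beq t t" by (simp add: beq_def)

lemma beq_sym: "beq t u \<Longrightarrow> beq u t" by (simp add: beq_def)

lemma beq_trans: "beq t u \<Longrightarrow> beq u v \<Longrightarrow> beq t v" by (simp add: beq_def)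

lemma beq_psub: "beq t u \<Longrightarrow> beq (psub \<sigma> t) (psub \<sigma> u)"
  by (simp add: beq_def)

lemma beq_wh: "wh t u \<Longrightarrow> beq t u"
  unfolding beq_def using reach_wh wh_apps wh_psub by blast

lemma beq_appL: "beq t t' \<Longrightarrow> beq (t \<cdot> u) (t' \<cdot> u)"
  unfolding beq_def by (metis foldl_Cons psub.simps(2))

lemma beq_appR: "beq u u' \<Longrightarrow> beq (t \<cdot> u) (t \<cdot> u')"
proof -
  have *: "reach n i (apps (psub \<sigma> (t \<cdot> u')) as)"
    if b: "beq u u'" and r: "reach n i (apps (psub \<sigma> (t \<cdot> u)) as)" for \<sigma> as n i u u'
  proof -
    let ?l = "psub (\<lambda>i. Var (Suc i))"
    define X where "X = apps (?l (psub \<sigma> t) \<cdot> Var 0) (map ?l as)"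
    have X: "psub (case_nat v Var) X = apps (psub \<sigma> t \<cdot> v) as" for v
      by (simp add: X_def o_def)
    have "reach n i (psub (case_nat (psub \<sigma> u') Var) X)"
    proof (rule beq_context)
      show "reach n i (psub (case_nat (psub \<sigma> u) Var) X)" using r by (simp only: X psub.simps)
      show "beq (case_nat (psub \<sigma> u) Var l) (case_nat (psub \<sigma> u') Var l)" for l
        using beq_psub[OF b] beq_refl by (cases l) auto
    qed
    then show ?thesis by (simp only: X psub.simps)
  qed
  show "beq u u' \<Longrightarrow> beq (t \<cdot> u) (t \<cdot> u')"
    using * beq_sym unfolding beq_def[of "t \<cdot> u"] by blast
qed

lemma reach_Abs: "\<not> reach n i (Abs t)"
proof
  assume "reach n i (Abs t)"
  then obtain bs where "whs (Abs t) (apps (Var i) bs)" by (auto simp: reach_def)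
  then have "Abs t = apps (Var i) bs" by (auto elim: converse_rtranclpE)
  then show False by (metis vhead_apps vhead.simps(1,3))
qed

lemma beq_Abs: "beq t u \<Longrightarrow> beq (Abs t) (Abs u)"
proof -
  assume b: "beq t u"
  have "reach n i (apps (Abs (psub (up \<sigma>) t)) as) = reach n i (apps (Abs (psub (up \<sigma>) u)) as)" for \<sigma> as n i
  proof (cases as)
    case Nil
    then show ?thesis by (simp add: reach_Abs)
  next
    case (Cons a bs)
    have "reach n i (apps (Abs (psub (up \<sigma>) t)) (a # bs)) = reach n i (apps (psub (case_nat a \<sigma>) t) bs)" for t
      using reach_whs[OF whs_redex[of "psub (up \<sigma>) t" a bs]] unfolding subst0_psub psub_up_env .
    with b show ?thesis unfolding beq_def Cons by metis
  qed
  then show ?thesis by (simp add: beq_def)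
qed

lemma beq_beta: "beta t u \<Longrightarrow> beq t u"
  by (induction rule: beta.induct) (auto intro: beq_appL beq_appR beq_Abs beq_wh wh_redex)

lemma beq_beta_conv: "beta_conv t u \<Longrightarrow> beq t u"
proof (induction rule: equivclp_induct)
  case (step y z)
  then show ?case using beq_beta beq_sym beq_trans by metis
qed (rule beq_refl)

text \<open>A weak form of the standardization theorem.\<close>

lemma beta_conv_reach:
  assumes "beta_conv t (apps (Var i) bs)"
  obtains bs' where "whs t (apps (Var i) bs')" "length bs' = length bs"
proof -
  have "reach (length bs) i (apps (Var i) bs)" by (simp add: reach_vhead)
  then have "reach (length bs) i t"
    using beq_beta_conv[OF assms] unfolding beq_def by (metis foldl_Nil psub_Var)
  then show thesis using that by (auto simp: reach_def)
qed

lemma beta_conv_appL: "beta_conv t t' \<Longrightarrow> beta_conv (t \<cdot> u) (t' \<cdot> u)"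
proof (induction rule: equivclp_induct)
  case (step y z)
  then have "beta (y \<cdot> u) (z \<cdot> u) \<or> beta (z \<cdot> u) (y \<cdot> u)" by (auto intro: beta_appL)
  with step.IH show ?case by (metis equivclp_into_equivclp)
qed simp

lemma beta_conv_appR: "beta_conv u u' \<Longrightarrow> beta_conv (t \<cdot> u) (t \<cdot> u')"
proof (induction rule: equivclp_induct)
  case (step y z)
  then have "beta (t \<cdot> y) (t \<cdot> z) \<or> beta (t \<cdot> z) (t \<cdot> y)" by (auto intro: beta_appR)
  with step.IH show ?case by (metis equivclp_into_equivclp)
qed simp

lemma beta_conv_app: "beta_conv t t' \<Longrightarrow> beta_conv u u' \<Longrightarrow> beta_conv (t \<cdot> u) (t' \<cdot> u')"
  using beta_conv_appL beta_conv_appR equivclp_trans by metis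

section \<open>Normal forms containing a numeral\<close>

lemma hn_AbsD: "hn (Abs t) \<Longrightarrow> hn t"
proof -
  assume "hn (Abs t)"
  then have "hn (subst t (Var 0) 0)" using hn_AppVar hn_wh wh_redex by blast
  then show ?thesis unfolding subst0_psub by (rule hn_reflect)
qed

lemma not_hn_unsolvable: "\<not> hn t \<Longrightarrow> unsolvable t"
  unfolding unsolvable_def
proof
  assume "\<not> hn t"
  have pow: "hn ((Abs ^^ n) t) \<Longrightarrow> hn t" for n
    by (induction n) (auto dest: hn_AbsD)
  assume "\<exists>args. (\<forall>a\<in>set args. closed a) \<and> beta_conv (apps (closure t) args) Id_trm"
  then obtain as where "apps (closure t) as \<simeq> Id_trm" using eqv_beta_conv by blast
  moreover have "hn Id_trm" by (simp add: Id_trm_def hn_Abs)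
  ultimately have "hn (closure t)" using eqv_hn hn_appsD by blast
  with pow \<open>\<not> hn t\<close> show False unfolding closure_def by blast
qed

text \<open>The shape of \<beta>\<Omega>-normal terms, with \<open>Om\<close> as a constant. It is
  wider than normality: \<open>Abs Om\<close> is included.\<close>

inductive NF :: "trm \<Rightarrow> bool" where
  NF_var: "(\<And>u. u \<in> set us \<Longrightarrow> NF u) \<Longrightarrow> NF (apps (Var h) us)"
| NF_abs: "NF t \<Longrightarrow> NF (Abs t)"
| NF_Om: "NF Om"

lemma NF_App:
  assumes "NF t" "NF u" "\<And>p. t = Abs p \<Longrightarrow> t \<cdot> u = Om" "t \<noteq> Om"
  shows "NF (t \<cdot> u)"
  using assms(1)
proof cases
  case (NF_var us h)
  then have "t \<cdot> u = apps (Var h) (us @ [u])" by simp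
  moreover have "NF (apps (Var h) (us @ [u]))" using NF_var(2) assms(2) by (intro NF.NF_var) auto
  ultimately show ?thesis by simp
next
  case (NF_abs p)
  then show ?thesis using assms(3) NF.NF_Om by simp
qed (use assms in simp)

lemma betaOm_normal_NF: "\<not> (\<exists>t'. betaOm t t') \<Longrightarrow> NF t"
proof (induction t)
  case (Var i)
  show ?case using NF_var[of "[]" i] by simp
next
  case (Abs t)
  then show ?case using betaOm_abs NF_abs by blast
next
  case (App t u)
  show ?case
  proof (rule NF_App)
    show "NF t" "NF u" using App betaOm_appL betaOm_appR by blast+
    show "t \<cdot> u = Om" if "t = Abs p" for p using App.prems betaOm_beta that by blast
    show "t \<noteq> Om"
    proof
      assume t: "t = Om"
      have "\<not> hn (t \<cdot> u)" using t not_hn_Om hn_AppD by blast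
      moreover have "t \<cdot> u \<noteq> Om" using t by (simp add: Om_def)
      ultimately show False using App.prems betaOm_Om not_hn_unsolvable by blast
    qed
  qed
qed

lemma NF_rename: "NF t \<Longrightarrow> NF (psub (\<lambda>i. Var (r i)) t)"
proof (induction arbitrary: r rule: NF.induct)
  case (NF_var us h)
  have "NF (apps (Var (r h)) (map (psub (\<lambda>i. Var (r i))) us))"
    by (rule NF.NF_var) (use NF_var in auto)
  then show ?case by simp
next
  case (NF_abs t)
  from NF_abs.IH show ?case by (simp add: up_rename NF.NF_abs)
qed (simp add: NF_Om)

lemma size_rename: "size (psub (\<lambda>i. Var (r i)) t) = size t"
proof (induction t arbitrary: r)
  case (Abs t)
  from Abs show ?case by (simp add: up_rename)
qed auto

lemma subterms_apps: "s \<in> subterms (apps t us) \<Longrightarrow>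
    s \<in> subterms t \<or> (\<exists>u\<in>set us. s \<in> subterms u) \<or> (\<exists>us' \<noteq> []. s = apps t us')"
proof (induction us rule: rev_induct)
  case (snoc u us)
  then consider "s = apps t (us @ [u])" | "s \<in> subterms (apps t us)" | "s \<in> subterms u" by auto
  then show ?case
  proof cases
    case 1
    then show ?thesis by (metis snoc_eq_iff_butlast)
  next
    case 2
    with snoc.IH show ?thesis by auto
  qed auto
qed simp

lemma size_apps: "u \<in> set us \<Longrightarrow> size u < size (apps t us)"
proof (induction us rule: rev_induct)
  case (snoc v us)
  then show ?case by auto
qed simp

lemma size_Abs_pow: "size ((Abs ^^ n) t) = n + size t"
  by (induction n) auto

lemma subterms_psub_closed: "closed s \<Longrightarrow> s \<in> subterms t \<Longrightarrow> s \<in> subterms (psub \<sigma> t)"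
proof (induction t arbitrary: \<sigma>)
  case (App t u)
  then consider "s = t \<cdot> u" | "s \<in> subterms t" | "s \<in> subterms u" by auto
  then show ?case
  proof cases
    case 1
    then have "psub \<sigma> (t \<cdot> u) = s" using App.prems(1) psub_closed by metis
    then show ?thesis by auto
  qed (use App in auto)
next
  case (Abs t)
  then consider "s = Abs t" | "s \<in> subterms t" by auto
  then show ?case
  proof cases
    case 1
    then have "psub \<sigma> (Abs t) = s" using Abs.prems(1) psub_closed by metis
    then show ?thesis by auto
  qed (use Abs in auto)
qed auto

lemma NF_cases_hn:
  assumes "NF t" "hn t"
  obtains a h us where "t = (Abs ^^ a) (apps (Var h) us)" "\<forall>u\<in>set us. NF u"
proof -
  have "NF t \<Longrightarrow> hn t \<Longrightarrow> \<exists>a h us. t = (Abs ^^ a) (apps (Var h) us) \<and> (\<forall>u\<in>set us. NF u)" for t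
  proof (induction rule: NF.induct)
    case (NF_var us h)
    then show ?case by (intro exI[of _ 0] exI[of _ h] exI[of _ us]) auto
  next
    case (NF_abs t)
    then obtain a h us where "t = (Abs ^^ a) (apps (Var h) us)" "\<forall>u\<in>set us. NF u"
      using hn_AbsD by blast
    then show ?case by (intro exI[of _ "Suc a"] exI[of _ h] exI[of _ us]) auto
  qed (use not_hn_Om in auto)
  with assms that show thesis by blast
qed

lemma args_env_vars: "\<exists>r. args_env (map Var xs) = (\<lambda>i. Var (r i))"
proof -
  have "\<exists>j. args_env (map Var xs) i = Var j" for i
    by (simp add: args_env_def rev_nth)
  then show ?thesis by metis
qed

text \<open>The case \<open>size y = 0\<close> is that of an argument created by \<open>\<eta>\<close>-expanding \<open>v\<close>, which is a variable.\<close>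

lemma NF_components:
  assumes u: "u = (Abs ^^ a) (apps (Var h) us)" and v: "NF v" and uv: "u \<simeq> v"
  shows "\<exists>r. \<forall>l<length us. \<exists>y. NF y \<and> (size y < size v \<or> size y = 0) \<and> psub (\<lambda>i. Var (r i)) (us ! l) \<simeq> y"
proof -
  have "hn u" unfolding u by (simp add: hn_Abs_pow)
  then have "hn v" using eqv_hn[OF uv] by simp
  with v obtain b g vs where vs: "v = (Abs ^^ b) (apps (Var g) vs)" "\<forall>w\<in>set vs. NF w"
    by (rule NF_cases_hn)
  have run: "\<exists>r. whs (apps ((Abs ^^ a) t) (map Var [0..<a + b]))
      (apps (psub (\<lambda>i. Var (r i)) t) (map Var [a..<a + b]))" for a b t
  proof -
    obtain r where r: "args_env (map Var [0..<a]) = (\<lambda>i. Var (r i))" using args_env_vars by blast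
    have "map Var [0..<a + b] = map Var [0..<a] @ map Var [a..<a + b]"
      using upt_add_eq_append[of 0 a b] by simp
    then have "whs (apps ((Abs ^^ a) t) (map Var [0..<a + b]))
      (apps (psub (args_env (map Var [0..<a])) t) (map Var [a..<a + b]))"
      using whs_apps[OF whs_Abs_pow[of "map Var [0..<a]" t]] by simp
    then show ?thesis unfolding r by blast
  qed
  obtain r where r: "whs (apps u (map Var [0..<a + b]))
      (apps (psub (\<lambda>i. Var (r i)) (apps (Var h) us)) (map Var [a..<a + b]))"
    using run[where a = a and b = b] unfolding u by blast
  obtain r' where r': "whs (apps v (map Var [0..<b + a]))
      (apps (psub (\<lambda>i. Var (r' i)) (apps (Var g) vs)) (map Var [b..<b + a]))"
    using run[where a = b and b = a] unfolding vs by blast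
  define us' where "us' = map (psub (\<lambda>i. Var (r i))) us @ map Var [a..<a + b]"
  define vs' where "vs' = map (psub (\<lambda>i. Var (r' i))) vs @ map Var [b..<b + a]"
  have 1: "apps u (map Var [0..<a + b]) \<simeq> apps (Var (r h)) us'"
    using eqv_whs[OF r] by (simp add: us'_def)
  have 2: "apps v (map Var [0..<b + a]) \<simeq> apps (Var (r' g)) vs'"
    using eqv_whs[OF r'] by (simp add: vs'_def)
  have "apps u (map Var [0..<a + b]) \<simeq> apps v (map Var [0..<b + a])"
    unfolding add.commute[of b a] by (rule eqv_apps_same[OF uv])
  from eqv_trans[OF eqv_trans[OF eqv_sym[OF 1] this] 2]
  have e: "apps (Var (r h)) us' \<simeq> apps (Var (r' g)) vs'" .
  have NFv: "NF y \<and> (size y < size v \<or> size y = 0)" if y: "y \<in> set vs'" for y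
  proof -
    from y consider w where "w \<in> set vs" "y = psub (\<lambda>i. Var (r' i)) w" | k where "y = Var k"
      by (auto simp: vs'_def)
    then show ?thesis
    proof cases
      case 1
      then show ?thesis using vs size_apps[of w vs "Var g"] NF_rename size_rename
        by (auto simp: size_Abs_pow)
    next
      case 2
      then show ?thesis using NF_var[of "[]" k] by simp
    qed
  qed
  show ?thesis
  proof (intro exI[of _ r] allI impI)
    fix l assume l: "l < length us"
    then have "us' ! l \<simeq> vs' ! l" using eqv_comps[OF e] by (simp add: us'_def)
    moreover have "vs' ! l \<in> set vs'" using l eqv_head(2)[OF e] by (simp add: us'_def)
    ultimately show "\<exists>y. NF y \<and> (size y < size v \<or> size y = 0) \<and> psub (\<lambda>i. Var (r i)) (us ! l) \<simeq> y"
      using NFv l by (auto simp: us'_def nth_append)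
  qed
qed

lemma psub_iter: "psub \<sigma> ((App s ^^ j) t) = (App (psub \<sigma> s) ^^ j) (psub \<sigma> t)"
  by (induction j) auto

text \<open>Each application of \<open>f\<close> is matched by passing to a component of
  \<open>y\<close>, which is smaller or a variable.\<close>

lemma NF_iter_size: "NF y \<Longrightarrow> (App (Var f) ^^ j) (Var x) \<simeq> y \<Longrightarrow> j \<le> size y"
proof (induction j arbitrary: y f x)
  case (Suc j)
  have "(App (Var f) ^^ Suc j) (Var x) = (Abs ^^ 0) (apps (Var f) [(App (Var f) ^^ j) (Var x)])" by simp
  from NF_components[OF this Suc.prems] obtain r z where
    z: "NF z" "size z < size y \<or> size z = 0" "psub (\<lambda>i. Var (r i)) ((App (Var f) ^^ j) (Var x)) \<simeq> z" by auto
  have "j \<le> size z" using Suc.IH[OF z(1)] z(3) by (simp add: psub_iter)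
  moreover have "size y > 0"
  proof (rule ccontr)
    assume "\<not> 0 < size y"
    then obtain k where "y = Var k" by (cases y) auto
    with Suc.prems(2) eqv_head(2)[of f "[(App (Var f) ^^ j) (Var x)]" k "[]"] show False by simp
  qed
  ultimately show ?case using z(2) by linarith
qed simp

lemma church_closed [simp]: "closed_at d (church k)"
proof -
  have "closed_at e ((App (Var 1) ^^ k) (Var 0))" if "2 \<le> e" for e using that by (induction k) auto
  then show ?thesis by (simp add: church_def)
qed

lemma church_suffix:
  assumes "church m \<in> subterms ((Abs ^^ a) t)"
  shows "(\<exists>i. (Abs ^^ a) t = (Abs ^^ i) (church m)) \<or> church m \<in> subterms t"
  using assms
proof (induction a)
  case (Suc a)
  then consider "church m = (Abs ^^ Suc a) t" | "church m \<in> subterms ((Abs ^^ a) t)" by auto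
  then show ?case
  proof cases
    case 1
    then show ?thesis by (metis funpow_0)
  next
    case 2
    with Suc.IH show ?thesis by (metis comp_apply funpow.simps(2))
  qed
qed simp

text \<open>On the way from \<open>u\<close> to the numeral, \<open>v\<close> is replaced by
  components that are smaller or variables. The \<open>m\<close> nested applications in the numeral
  must then be matched inside what is left of \<open>v\<close>.\<close>

lemma NF_church_bound:
  "NF u \<Longrightarrow> NF v \<Longrightarrow> u \<simeq> v \<Longrightarrow> church m \<in> subterms u \<Longrightarrow> m \<le> Suc (size v)"
proof (induction "size u" arbitrary: u v rule: less_induct)
  case less
  have "hn u"
  proof (rule ccontr)
    assume "\<not> hn u"
    with less.prems(1) have "u = Om"
    proof (cases rule: NF.cases)
      case (NF_abs t)
      \<comment> \<open>An unsolvable \<open>NF\<close> term consists of abstractions over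
        \<open>Om\<close> and so has no room for a numeral.\<close>
      have "NF t \<Longrightarrow> \<not> hn t \<Longrightarrow> church m \<in> subterms t \<Longrightarrow> False" for t
      proof (induction rule: NF.induct)
        case NF_Om
        then show ?case by (auto simp: Om_def church_def)
      next
        case (NF_abs t)
        have "Abs t \<noteq> church m"
        proof
          assume "Abs t = church m"
          moreover have "hn (church m)"
          proof -
            have "vhead ((App (Var 1) ^^ m) (Var 0))" by (cases m) auto
            then show ?thesis by (simp add: church_def hn_Abs)
          qed
          ultimately show False using NF_abs.prems by simp
        qed
        with NF_abs show ?case using hn_Abs by auto
      qed simp
      from this[OF less.prems(1)] less.prems(4) \<open>\<not> hn u\<close> show ?thesis by blast
    qed auto
    with less.prems(4) show False by (auto simp: Om_def church_def)
  qed
  with less.prems(1) obtain a h us where us: "u = (Abs ^^ a) (apps (Var h) us)" "\<forall>w\<in>set us. NF w"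
    by (rule NF_cases_hn)
  from church_suffix less.prems(4) us(1)
  consider i where "u = (Abs ^^ i) (church m)" | "church m \<in> subterms (apps (Var h) us)" by blast
  then show ?case
  proof cases
    case 1
    show ?thesis
    proof (cases m)
      case (Suc k)
      have "u = (Abs ^^ (i + 2)) (apps (Var 1) [(App (Var 1) ^^ k) (Var 0)])"
        unfolding 1 Suc church_def by (simp add: funpow_swap1)
      from NF_components[OF this less.prems(2,3)] obtain r y where
        y: "NF y" "size y < size v \<or> size y = 0" "psub (\<lambda>i. Var (r i)) ((App (Var 1) ^^ k) (Var 0)) \<simeq> y" by auto
      have "k \<le> size y" using NF_iter_size[OF y(1)] y(3) by (simp add: psub_iter)
      \<comment> \<open>If \<open>y\<close> is a variable, \<open>k\<close> is 0 whatever the size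
        of \<open>v\<close>; this case accounts for the \<open>Suc\<close> in the bound.\<close>
      with y(2) Suc show ?thesis by linarith
    qed simp
  next
    case 2
    have "church m \<notin> subterms (Var h)" "\<And>us'. church m \<noteq> apps (Var h) us'"
      by (auto simp: church_def) (metis vhead_apps vhead.simps(1,3))
    with subterms_apps[OF 2] obtain l where l: "l < length us" "church m \<in> subterms (us ! l)"
      by (metis in_set_conv_nth)
    from NF_components[OF us(1) less.prems(2,3)] l(1) obtain r y where
      y: "NF y" "size y < size v \<or> size y = 0" "psub (\<lambda>i. Var (r i)) (us ! l) \<simeq> y" by blast
    have "m \<le> Suc (size y)"
    proof (rule less.hyps[OF _ _ y(1) y(3)])
      show "size (psub (\<lambda>i. Var (r i)) (us ! l)) < size u"
        using l(1) size_apps[of "us ! l" us "Var h"] by (simp add: size_rename us(1) size_Abs_pow)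
      show "NF (psub (\<lambda>i. Var (r i)) (us ! l))" using us(2) l(1) NF_rename by simp
      show "church m \<in> subterms (psub (\<lambda>i. Var (r i)) (us ! l))"
        using l(2) by (intro subterms_psub_closed) simp_all
    qed
    with y(2) show ?thesis by linarith
  qed
qed

section \<open>The head normal form of \<open>D x\<close>\<close>

primrec occurs :: "nat \<Rightarrow> trm \<Rightarrow> bool" where
  "occurs i (Var j) \<longleftrightarrow> i = j"
| "occurs i (t \<cdot> u) \<longleftrightarrow> occurs i t \<or> occurs i u"
| "occurs i (Abs t) \<longleftrightarrow> occurs (Suc i) t"

lemma psub_cong_occurs: "(\<And>i. occurs i t \<Longrightarrow> \<sigma> i = \<tau> i) \<Longrightarrow> psub \<sigma> t = psub \<tau> t"
proof (induction t arbitrary: \<sigma> \<tau>)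
  case (App t u)
  then show ?case by (metis occurs.simps(2) psub.simps(2))
next
  case (Abs t)
  have "psub (up \<sigma>) t = psub (up \<tau>) t"
    by (rule Abs.IH) (use Abs.prems in \<open>auto simp: up_def split: nat.split\<close>)
  then show ?case by simp
qed simp

lemma closed_at_liftD: "closed_at (Suc d) (lift t k) \<Longrightarrow> k \<le> d \<Longrightarrow> closed_at d t"
  by (induction t arbitrary: d k) (auto split: if_splits)

lemma occurs_closed_at: "occurs i t \<Longrightarrow> closed_at d (psub \<rho> t) \<Longrightarrow> closed_at d (\<rho> i)"
proof (induction t arbitrary: i d \<rho>)
  case (Var j)
  then show ?case by simp
next
  case (App t u)
  from App.prems(2) have c: "closed_at d (psub \<rho> t)" "closed_at d (psub \<rho> u)" by simp_all
  from App.prems(1) consider "occurs i t" | "occurs i u" by auto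
  then show ?case
  proof cases
    case 1
    show ?thesis by (rule App.IH(1)[OF 1 c(1)])
  next
    case 2
    show ?thesis by (rule App.IH(2)[OF 2 c(2)])
  qed
next
  case (Abs t)
  have "closed_at (Suc d) (up \<rho> (Suc i))"
    by (rule Abs.IH) (use Abs.prems in simp_all)
  then show ?case using closed_at_liftD[of d "\<rho> i" 0] by simp
qed

text \<open>A closed redex is replaced by a closed contractum, so no free variable is lost and
  closedness can be read backwards.\<close>

lemma closed_head_step_closed_at: "closed_head_step t u \<Longrightarrow> closed_at d u \<Longrightarrow> closed_at d t"
  by (induction rule: closed_head_step.induct)
    (auto simp: closed_mono elim: closed_at_mono[of "Suc 0"])

lemma closed_head_step_cases:
  "closed_head_step t u \<Longrightarrow> wh t u \<or> (\<exists>b b'. t = Abs b \<and> u = Abs b' \<and> closed_head_step b b')"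
proof (induction rule: closed_head_step.induct)
  case (1 p q k rs)
  show ?case
  proof (cases k)
    case 0
    then show ?thesis using wh_apps[OF wh_redex] by simp
  next
    case (Suc k')
    then show ?thesis using closed_head_step.intros[OF 1] by auto
  qed
qed

text \<open>Outside an abstraction these steps are weak head steps, so by determinism they pass
  through \<open>Abs a\<close>; the rest happens below the abstraction.\<close>

lemma closed_head_steps_Abs:
  "closed_head_step\<^sup>*\<^sup>* t u \<Longrightarrow> u = Abs v \<Longrightarrow> whs t (Abs a) \<Longrightarrow> closed_head_step\<^sup>*\<^sup>* a v"
proof (induction arbitrary: a rule: converse_rtranclp_induct)
  case base
  then have "Abs v = Abs a" by (auto elim: converse_rtranclpE)
  then show ?case by simp
next
  case (step t t')
  from closed_head_step_cases[OF step.hyps(1)] show ?case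
  proof
    assume wh: "wh t t'"
    from step.prems(2) have "whs t' (Abs a)"
      by (cases rule: converse_rtranclpE) (use wh wh_det in auto)
    with step show ?thesis by blast
  next
    assume "\<exists>b b'. t = Abs b \<and> t' = Abs b' \<and> closed_head_step b b'"
    then obtain b b' where b: "t = Abs b" "t' = Abs b'" "closed_head_step b b'" by blast
    with step.prems(2) have "a = b" by (auto elim: converse_rtranclpE)
    with b step.IH[of b'] step.prems(1) show ?thesis by (simp add: converse_rtranclp_into_rtranclp)
  qed
qed

lemma closed_head_step_beta: "closed_head_step t u \<Longrightarrow> beta t u"
proof (induction rule: closed_head_step.induct)
  case (1 p q k rs)
  have "beta (apps (Abs p \<cdot> q) rs) (apps (subst p q 0) rs)"
    using wh_beta[OF wh_apps[OF wh_redex]] .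
  then show ?case by (induction k) (auto intro: beta_abs)
qed

lemma closed_head_steps_beta_conv: "closed_head_step\<^sup>*\<^sup>* t u \<Longrightarrow> beta_conv t u"
  by (induction rule: rtranclp_induct)
    (auto intro: equivclp_into_equivclp closed_head_step_beta)

lemma hn_whnf: "hn t \<Longrightarrow> \<exists>u. whs t u \<and> (vhead u \<or> (\<exists>a. u = Abs a))"
proof -
  have "(wh ^^ n) (apps t as) u \<Longrightarrow> vhead u \<Longrightarrow> \<exists>u. whs t u \<and> (vhead u \<or> (\<exists>a. u = Abs a))" for n as u
  proof (induction n arbitrary: t)
    case 0
    then have "vhead t" by (metis vhead_apps relpowp.simps(1))
    then show ?case by blast
  next
    case (Suc n)
    from Suc.prems(1) obtain s where s: "wh (apps t as) s" "(wh ^^ n) s u" by (metis relpowp_Suc_D2)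
    show ?case
    proof (cases t rule: whnf_cases)
      case (3 t')
      then have "s = apps t' as" using wh_det[OF s(1) wh_apps] by blast
      with Suc s 3 show ?thesis by (meson converse_rtranclp_into_rtranclp)
    qed blast+
  qed
  then show "hn t \<Longrightarrow> ?thesis" unfolding hn_def by (metis rtranclp_imp_relpowp)
qed

text \<open>If \<open>D x\<close> reduced to an abstraction \<open>\<lambda>y. a\<close>, then \<open>a\<close> would not contain \<open>y\<close>, as the head reduction
  of \<open>D s\<close> to \<open>Kstar\<close> contracts closed redexes only; all the terms \<open>D x m\<close> would then share one normal
  form, which contains only finitely many numerals.\<close>

lemma D_head_variable:
  assumes D: "closed D"
    and D_nf: "\<And>m. \<exists>v. has_betaOm_nf (D \<cdot> Var 0 \<cdot> church m) v \<and> begins_with 0 v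
      \<and> church m \<in> subterms v"
    and D_head: "closed_head_step\<^sup>*\<^sup>* (D \<cdot> church s) Kstar"
  obtains rs where "whs (D \<cdot> Var 0) (apps (Var 0) rs)" "\<And>r. r \<in> set rs \<Longrightarrow> closed_at 1 r"
proof -
  obtain v where v: "\<And>m. has_betaOm_nf (D \<cdot> Var 0 \<cdot> church m) (v m)" "\<And>m. begins_with 0 (v m)"
    "\<And>m. church m \<in> subterms (v m)" using D_nf by metis
  have ve: "D \<cdot> Var 0 \<cdot> church m \<simeq> v m" for m
    using v(1) eqv_betaOms unfolding has_betaOm_nf_def by blast
  have vNF: "NF (v m)" for m
    using v(1) betaOm_normal_NF unfolding has_betaOm_nf_def by blast
  have "hn (D \<cdot> Var 0 \<cdot> church 0)" using eqv_hn[OF ve] v(2)[of 0] by (auto simp: begins_with_def)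
  then have "hn (D \<cdot> Var 0)" by (rule hn_AppD)
  then obtain u where u: "whs (D \<cdot> Var 0) u" "vhead u \<or> (\<exists>a. u = Abs a)" using hn_whnf by blast
  have cu: "closed_at 1 u" using whs_closed_at[OF u(1)] D by (simp add: closed_mono)
  from u(2) show thesis
  proof
    assume "vhead u"
    then obtain i rs where "u = apps (Var i) rs" by (auto simp: vhead_iff)
    with cu u(1) that show thesis by simp
  next
    assume "\<exists>a. u = Abs a"
    then obtain a where a: "u = Abs a" by blast
    let ?\<rho> = "up (\<lambda>_. church s)"
    have "whs (D \<cdot> church s) (Abs (psub ?\<rho> a))"
      using whs_psub[OF u(1), of "\<lambda>_. church s"] D by (simp add: a)
    then have "closed_head_step\<^sup>*\<^sup>* (psub ?\<rho> a) (Abs (Var 0))"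
      using closed_head_steps_Abs[OF D_head] by (simp add: Kstar_def)
    then have "closed (psub ?\<rho> a)"
      by (induction rule: converse_rtranclp_induct) (auto intro: closed_head_step_closed_at)
    then have no: "\<not> occurs 0 a" using occurs_closed_at[of 0 a 0 ?\<rho>] by auto
    have same: "subst a x 0 = subst a y 0" for x y
      unfolding subst0_psub using no by (intro psub_cong_occurs) (auto split: nat.split)
    have Dm: "D \<cdot> Var 0 \<cdot> church m \<simeq> subst a Om 0" for m
    proof -
      have "whs (D \<cdot> Var 0 \<cdot> church m) (Abs a \<cdot> church m)" using whs_App u(1) a by blast
      also have "wh (Abs a \<cdot> church m) (subst a (church m) 0)" by (rule wh_redex)
      finally have "D \<cdot> Var 0 \<cdot> church m \<simeq> subst a (church m) 0" by (rule eqv_whs)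
      then show ?thesis using same[of "church m" Om] by simp
    qed
    have "v m \<simeq> v 0" for m
      using eqv_trans[OF eqv_trans[OF eqv_sym[OF ve] Dm] eqv_trans[OF eqv_sym[OF Dm] ve]] .
    then have "m \<le> Suc (size (v 0))" for m using NF_church_bound vNF v(3) by blast
    from this[of "Suc (Suc (size (v 0)))"] show thesis by simp
  qed
qed

lemma betaOm_closed_at: "betaOm t u \<Longrightarrow> closed_at d t \<Longrightarrow> closed_at d u"
  by (induction arbitrary: d rule: betaOm.induct) (auto simp: closed_at_subst0 closed_mono)

lemma has_nf_begins:
  assumes "has_betaOm_nf t v" "begins_with 0 v" "closed_at d t"
  obtains cs where "t \<simeq> apps (Var 0) cs" "\<And>r. r \<in> set cs \<Longrightarrow> closed_at d r"
proof -
  from assms obtain cs where cs: "v = apps (Var 0) cs" "betaOm\<^sup>*\<^sup>* t v"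
    by (auto simp: begins_with_def has_betaOm_nf_def)
  from cs(2) assms(3) have "closed_at d v"
    by (induction rule: rtranclp_induct) (auto intro: betaOm_closed_at)
  with cs eqv_betaOms that show thesis by auto
qed

section \<open>Runs of \<open>B\<^sub>i\<close>\<close>

lemma psub_pair [simp]: "psub \<sigma> (pair a b) = pair (psub \<sigma> a) (psub \<sigma> b)"
  by (simp add: pair_def lift0_psub)

lemma whs_pair: "whs (pair a b \<cdot> q) (q \<cdot> a \<cdot> b)"
  using whs_redex[of "Var 0 \<cdot> lift a 0 \<cdot> lift b 0" q "[]"] by (simp add: pair_def)

lemma closed_Theta [simp]: "closed_at d Theta"
  by (simp add: Theta_def Atrm_def)

lemma closed_Atrm [simp]: "closed_at d Atrm"
  by (simp add: Atrm_def)

lemma whs_Theta: "whs (Theta \<cdot> g) (g \<cdot> (Theta \<cdot> g))"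
proof -
  have "whs (apps Theta [g]) (apps (Abs (Var 0 \<cdot> (Atrm \<cdot> Atrm \<cdot> Var 0))) [g])"
    using whs_redex[of "Abs (Var 0 \<cdot> (Var 1 \<cdot> Var 1 \<cdot> Var 0))" Atrm "[g]"]
    by (simp add: Theta_def Atrm_def numeral_2_eq_2)
  also have "whs \<dots> (apps (subst (Var 0 \<cdot> (Atrm \<cdot> Atrm \<cdot> Var 0)) g 0) [])"
    by (rule whs_redex)
  finally show ?thesis by (simp add: Theta_def)
qed

definition GM :: "trm \<Rightarrow> trm \<Rightarrow> trm" where
  "GM S y = psub (\<lambda>_. y) (Gtrm S)"

abbreviation gO :: trm where
  "gO \<equiv> Abs (Var 0 \<cdot> Om)"

lemma psub_GM [simp]: "psub \<sigma> (GM S y) = GM S (psub \<sigma> y)"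
  by (simp add: GM_def)

lemma closed_at_pair [simp]: "closed_at d a \<Longrightarrow> closed_at d b \<Longrightarrow> closed_at d (pair a b)"
  by (simp add: pair_def closed_at_lift)

lemma closed_at_Gtrm: "closed S \<Longrightarrow> closed_at 1 (Gtrm S)"
  by (simp add: Gtrm_def closed_mono)

lemma closed_at_GM: "closed S \<Longrightarrow> closed_at d y \<Longrightarrow> closed_at d (GM S y)"
  unfolding GM_def using closed_at_Gtrm closed_at_psub by metis

text \<open>Stopping at the abstraction over \<open>f\<close> leaves \<open>f\<close> as the last
  argument of all steps so far, the form in which \<open>moves_beta\<close> follows the run.\<close>

lemma whs_level:
  assumes S: "closed S"
  obtains a where "whs (Theta \<cdot> GM S y \<cdot> k) (Abs a)"
    "\<And>f. subst a f 0 = pair (f \<cdot> k) (k \<cdot> gO \<cdot> y \<cdot> (Theta \<cdot> GM S y \<cdot> (S \<cdot> k) \<cdot> f))"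
proof -
  define x where "x = Theta \<cdot> GM S y"
  define b where "b = pair (Var 0 \<cdot> Var 1) (Var 1 \<cdot> gO \<cdot> lift (lift (lift y 0) 0) 0 \<cdot> (Var 2 \<cdot> (S \<cdot> Var 1) \<cdot> Var 0))"
  have G: "GM S y = Abs (Abs (Abs b))"
    using S by (simp add: GM_def Gtrm_def b_def numeral_3_eq_3 numeral_2_eq_2)
  have "whs (apps (Theta \<cdot> GM S y) [k]) (apps (Abs (Abs (Abs b)) \<cdot> x) [k])"
    using whs_apps[OF whs_Theta] unfolding G x_def .
  also have "whs \<dots> (psub (args_env [x, k]) (Abs b))"
    using whs_Abs_pow[of "[x, k]" "Abs b"] by (simp add: numeral_2_eq_2)
  finally have 1: "whs (Theta \<cdot> GM S y \<cdot> k) (Abs (psub (up (args_env [x, k])) b))" by simp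
  have "args_env [x, k] = case_nat k (case_nat x Var)"
    using args_env_snoc[of "[x]" k] args_env_snoc[of "[]" x] by simp
  then have "subst (psub (up (args_env [x, k])) b) f 0 = psub (case_nat f (case_nat k (case_nat x Var))) b" for f
    by (simp only: subst0_psub psub_up_env)
  also have "psub (case_nat f (case_nat k (case_nat x Var))) b = pair (f \<cdot> k) (k \<cdot> gO \<cdot> y \<cdot> (x \<cdot> (S \<cdot> k) \<cdot> f))" for f
    using S by (simp add: b_def lift0_psub numeral_2_eq_2)
  finally show thesis using that 1 unfolding x_def by blast
qed

lemma whs_level_pair:
  assumes "closed S"
  shows "whs (Theta \<cdot> GM S y \<cdot> k \<cdot> f) (pair (f \<cdot> k) (k \<cdot> gO \<cdot> y \<cdot> (Theta \<cdot> GM S y \<cdot> (S \<cdot> k) \<cdot> f)))"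
proof -
  obtain a where a: "whs (Theta \<cdot> GM S y \<cdot> k) (Abs a)"
    "\<And>f. subst a f 0 = pair (f \<cdot> k) (k \<cdot> gO \<cdot> y \<cdot> (Theta \<cdot> GM S y \<cdot> (S \<cdot> k) \<cdot> f))"
    using assms by (rule whs_level) (rule that, auto)
  have "whs (Theta \<cdot> GM S y \<cdot> k \<cdot> f) (Abs a \<cdot> f)" using a(1) by (rule whs_App)
  also have "wh \<dots> (subst a f 0)" by (rule wh_redex)
  finally show ?thesis by (simp add: a(2))
qed

lemma closed_at_Btrm: "closed D \<Longrightarrow> closed C \<Longrightarrow> closed S \<Longrightarrow> closed_at d (Btrm D C S i)"
  by (simp add: Btrm_def Ftrm_def closed_mono closed_at_mono[OF closed_at_Gtrm])

lemma whs_B: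
  assumes "closed D" "closed C" "closed S"
  obtains a b where "whs (Btrm D C S i) (Abs a)" "subst a x 0 = Abs b"
    "\<And>y. subst b y 0 = apps (D \<cdot> x) [church i, Atrm, Atrm, GM S y, church 0,
      Abs (Btrm D C S i \<cdot> (C \<cdot> lift x 0 \<cdot> Var 0))]"
proof -
  define w where "w = Btrm D C S i"
  define e where "e = apps (D \<cdot> Var 1) [church i, Atrm, Atrm, Gtrm S, church 0,
      Abs (Var 3 \<cdot> (C \<cdot> Var 2 \<cdot> Var 0))]"
  have F: "Ftrm D C S i = Abs (Abs (Abs e))" by (simp add: Ftrm_def e_def)
  have w: "closed w" using assms closed_at_Btrm by (simp add: w_def)
  have "whs w (Ftrm D C S i \<cdot> w)" unfolding w_def Btrm_def by (rule whs_Theta)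
  also have "wh \<dots> (subst (Abs (Abs e)) w 0)" unfolding F by (rule wh_redex)
  finally have 1: "whs w (Abs (psub (up (case_nat w Var)) (Abs e)))" by (simp add: subst0_psub)
  have 2: "subst (psub (up (case_nat w Var)) (Abs e)) x 0 = Abs (psub (up (case_nat x (case_nat w Var))) e)"
    unfolding subst0_psub psub_up_env by simp
  have "subst (psub (up (case_nat x (case_nat w Var))) e) y 0
    = psub (case_nat y (case_nat x (case_nat w Var))) e" for y
    by (simp only: subst0_psub psub_up_env)
  also have "psub (case_nat y (case_nat x (case_nat w Var))) e = apps (D \<cdot> x) [church i, Atrm, Atrm, GM S y, church 0,
      Abs (w \<cdot> (C \<cdot> lift x 0 \<cdot> Var 0))]" for y
  proof -
    have "psub (case_nat y (case_nat x (case_nat w Var))) (Gtrm S) = GM S y"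
      unfolding GM_def by (rule psub_cong_closed[OF closed_at_Gtrm[OF assms(3)]]) simp
    then show ?thesis using assms w by (simp add: e_def numeral_2_eq_2 numeral_3_eq_3)
  qed
  finally have 3: "subst (psub (up (case_nat x (case_nat w Var))) e) y 0 = apps (D \<cdot> x) [church i, Atrm, Atrm,
      GM S y, church 0, Abs (w \<cdot> (C \<cdot> lift x 0 \<cdot> Var 0))]" for y .
  from 1 2 3 show thesis unfolding w_def by (rule that)
qed

lemma whs_B_app:
  assumes "closed D" "closed C" "closed S"
  shows "whs (Btrm D C S i \<cdot> x \<cdot> y) (apps (D \<cdot> x) [church i, Atrm, Atrm, GM S y, church 0,
      Abs (Btrm D C S i \<cdot> (C \<cdot> lift x 0 \<cdot> Var 0))])"
proof -
  obtain a b where ab: "whs (Btrm D C S i) (Abs a)" "subst a x 0 = Abs b"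
    "\<And>y. subst b y 0 = apps (D \<cdot> x) [church i, Atrm, Atrm, GM S y, church 0,
      Abs (Btrm D C S i \<cdot> (C \<cdot> lift x 0 \<cdot> Var 0))]"
    using assms by (rule whs_B) (rule that)
  have "whs (apps (Btrm D C S i) [x, y]) (apps (Abs a) [x, y])" using ab(1) by (rule whs_apps)
  also have "whs \<dots> (apps (subst a x 0) [y])" by (rule whs_redex)
  also have "whs \<dots> (apps (subst b y 0) [])" unfolding ab(2) by (rule whs_redex)
  finally show ?thesis by (simp add: ab(3))
qed

lemma whs_church: "whs (church k \<cdot> f \<cdot> x) ((App f ^^ k) x)"
  using whs_Abs_pow[of "[f, x]" "(App (Var 1) ^^ k) (Var 0)"]
  by (simp add: church_def psub_iter args_env_def)

lemma whs_church_gO: "whs (church k \<cdot> gO \<cdot> y) (apps y (replicate k Om))"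
proof -
  have "whs ((App gO ^^ k) y) (apps y (replicate k Om))"
  proof (induction k)
    case (Suc k)
    have "wh (gO \<cdot> (App gO ^^ k) y) ((App gO ^^ k) y \<cdot> Om)"
      using wh_redex[of "Var 0 \<cdot> Om" "(App gO ^^ k) y"] by simp
    also have "whs \<dots> (apps y (replicate k Om) \<cdot> Om)" using Suc by (rule whs_App)
    also have "apps y (replicate k Om) \<cdot> Om = apps y (replicate (Suc k) Om)"
      by (simp only: apps_snoc[symmetric] replicate_append_same replicate_Suc)
    finally show ?case by simp
  qed simp
  with whs_church show ?thesis by (meson rtranclp_trans)
qed

section \<open>The stack that follows an infinite branch\<close>

definition Kfst :: trm where
  "Kfst = Abs (Abs (Var 1))"

lemma closed_Kfst [simp]: "closed_at d Kfst"
  by (simp add: Kfst_def)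

lemma closed_Kstar [simp]: "closed_at d Kstar"
  by (simp add: Kstar_def)

lemma whs_Kfst: "whs (Kfst \<cdot> a \<cdot> b) a"
  using whs_Abs_pow[of "[a, b]" "Var 1"] by (simp add: Kfst_def args_env_def)

lemma whs_Kstar: "whs (Kstar \<cdot> a \<cdot> b) b"
  using whs_Abs_pow[of "[a, b]" "Var 0"] by (simp add: Kstar_def args_env_def)

text \<open>In \<open>Theta \<cdot> GM S y \<cdot> church l \<cdot> f\<close>, the entry \<open>Kstar\<close> selects the second component of the pair, where
  \<open>y\<close> is applied \<open>l\<close> times to \<open>Om\<close> and then to the recursive call. If \<open>y\<close> is a tuple, it is filled up with
  further \<open>Om\<close>, and the selector picks the recursive call. The final \<open>Kfst\<close> leaves the recursion.\<close>

definition descent :: "nat \<Rightarrow> nat \<Rightarrow> trm list" where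
  "descent n j = concat (map (\<lambda>l. Kstar # replicate (n - l) Om @ [sel (Suc n) l]) [j..<n]) @ [Kfst]"

lemma descent_end [simp]: "descent n n = [Kfst]"
  by (simp add: descent_def)

lemma descent_step: "j < n \<Longrightarrow>
    descent n j = Kstar # replicate (n - j) Om @ sel (Suc n) j # descent n (Suc j)"
  by (simp add: descent_def upt_conv_Cons)

lemma closed_descent: "a \<in> set (descent n j) \<Longrightarrow> closed a"
  by (auto simp: descent_def closed_sel split: if_splits)

lemma eqv_descent:
  assumes S: "closed S" "\<And>k. beta_conv (S \<cdot> church k) (church (Suc k))"
  shows "j \<le> n \<Longrightarrow> k \<simeq> church j \<Longrightarrow>
    apps (Theta \<cdot> GM S (tup (Suc n)) \<cdot> k \<cdot> v) (descent n j) \<simeq> v \<cdot> church n"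
proof (induction "n - j" arbitrary: j k)
  case 0
  then have "j = n" by simp
  let ?X = "Theta \<cdot> GM S (tup (Suc n))"
  have "?X \<cdot> k \<cdot> v \<cdot> Kfst \<simeq> Kfst \<cdot> (v \<cdot> k) \<cdot> (k \<cdot> gO \<cdot> tup (Suc n) \<cdot> (?X \<cdot> (S \<cdot> k) \<cdot> v))"
    using eqv_whs[OF whs_App[OF whs_level_pair[OF S(1)]]] eqv_whs[OF whs_pair] by (rule eqv_trans)
  also have "\<dots> \<simeq> v \<cdot> k" by (rule eqv_whs[OF whs_Kfst])
  also have "\<dots> \<simeq> v \<cdot> church n" using 0(3) unfolding \<open>j = n\<close> by (rule eqv_app[OF eqv_refl])
  finally show ?case by (simp add: \<open>j = n\<close>)
next
  case (Suc d)
  then have j: "j < n" "d = n - Suc j" by simp_all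
  let ?M = "tup (Suc n)"
  let ?X = "Theta \<cdot> GM S ?M"
  let ?T = "?X \<cdot> (S \<cdot> k) \<cdot> v"
  \<comment> \<open>The numeral contributes \<open>j\<close> copies of \<open>Om\<close>, the stack
    the remaining \<open>n - j\<close>. The tuple is then full, with the recursive call at position
    \<open>j\<close>.\<close>
  let ?as = "replicate j Om @ ?T # replicate (n - j) Om"
  have len: "length ?as = Suc n" using j by simp
  have "?X \<cdot> k \<cdot> v \<cdot> Kstar \<simeq> Kstar \<cdot> (v \<cdot> k) \<cdot> (k \<cdot> gO \<cdot> ?M \<cdot> ?T)"
    using eqv_whs[OF whs_App[OF whs_level_pair[OF S(1)]]] eqv_whs[OF whs_pair] by (rule eqv_trans)
  also have "\<dots> \<simeq> k \<cdot> gO \<cdot> ?M \<cdot> ?T" by (rule eqv_whs[OF whs_Kstar])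
  also have "\<dots> \<simeq> church j \<cdot> gO \<cdot> ?M \<cdot> ?T" by (intro eqv_app eqv_refl Suc.prems)
  also have "\<dots> \<simeq> apps ?M (replicate j Om) \<cdot> ?T" by (rule eqv_whs[OF whs_App[OF whs_church_gO]])
  finally have "apps (?X \<cdot> k \<cdot> v \<cdot> Kstar) (replicate (n - j) Om @ [sel (Suc n) j]) \<simeq>
    apps (apps ?M (replicate j Om) \<cdot> ?T) (replicate (n - j) Om @ [sel (Suc n) j])"
    by (rule eqv_apps_same)
  also have "\<dots> = apps ?M ?as \<cdot> sel (Suc n) j" by simp
  also have "\<dots> \<simeq> ?as ! j"
    using eqv_whs[OF whs_tup_sel[of j ?as]] j unfolding len by simp
  also have "?as ! j = ?T" by (simp add: nth_append)
  finally have "apps (apps (?X \<cdot> k \<cdot> v \<cdot> Kstar) (replicate (n - j) Om @ [sel (Suc n) j])) (descent n (Suc j))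
    \<simeq> apps ?T (descent n (Suc j))" by (rule eqv_apps_same)
  moreover have "apps ?T (descent n (Suc j)) \<simeq> v \<cdot> church n"
  proof (rule Suc.hyps(1)[OF j(2)])
    show "Suc j \<le> n" using j by simp
    show "S \<cdot> k \<simeq> church (Suc j)"
      using eqv_app[OF eqv_refl Suc.prems(2)] eqv_beta_conv[OF S(2)] by (rule eqv_trans)
  qed
  ultimately show ?case unfolding descent_step[OF j(1)] using eqv_trans by simp
qed

text \<open>What is used of the hypotheses once a branch is fixed: \<open>sq m\<close> are its
  nodes, \<open>z m\<close> the numeral that \<open>C\<close> appends, and \<open>rs\<close> and
  \<open>cs m\<close> the arguments of the head variable in \<open>D x\<close> and in node
  \<open>m\<close> concatenated with that variable.\<close>

locale branch =
  fixes C S D :: trm and rs :: "trm list" and cs :: "nat \<Rightarrow> trm list" and sq z :: "nat \<Rightarrow> nat"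
  assumes closed_C [simp]: "closed C" and closed_S [simp]: "closed S" and closed_D [simp]: "closed D"
    and S_succ: "beta_conv (S \<cdot> church k) (church (Suc k))"
    and D_var: "whs (D \<cdot> Var 0) (apps (Var 0) rs)" and closed_rs: "r \<in> set rs \<Longrightarrow> closed_at 1 r"
    and C_var: "C \<cdot> church (sq m) \<cdot> Var 0 \<simeq> apps (Var 0) (cs m)"
    and closed_cs: "r \<in> set (cs m) \<Longrightarrow> closed_at 1 r"
    and C_step: "beta_conv (C \<cdot> church (sq m) \<cdot> church (z m)) (church (sq (Suc m)))"
    and D_sq: "beta_conv (D \<cdot> church (sq m)) Kstar"
begin

abbreviation B :: "nat \<Rightarrow> trm" where
  "B \<equiv> Btrm D C S"

lemma closed_B [simp]: "closed_at d (B i)"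
  by (simp add: closed_at_Btrm)

definition chunk :: "nat \<Rightarrow> trm list" where
  "chunk m = tup (Suc (z m)) # descent (z m) 0"

definition start :: "nat \<Rightarrow> nat" where
  "start m = length (concat (map chunk [0..<m]))"

text \<open>Chunks are nonempty, so the first \<open>Suc p\<close> of them extend beyond position
  \<open>p\<close>.\<close>

definition stk :: "nat \<Rightarrow> trm" where
  "stk p = concat (map chunk [0..<Suc p]) ! p"

lemma start_Suc: "start (Suc m) = start m + length (chunk m)"
  by (simp add: start_def)

lemma start_less: "start m < start (Suc m)"
  by (simp add: start_Suc chunk_def)

lemma stk_chunk:
  assumes "i < length (chunk m)"
  shows "stk (start m + i) = chunk m ! i"
proof -
  have "l \<le> start l" for l
  proof (induction l)
    case (Suc l)
    then show ?case using start_less[of l] by linarith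
  qed simp
  from this[of m] have "[0..<Suc (start m + i)] = [0..<m] @ m # [Suc m..<Suc (start m + i)]"
    using upt_add_eq_append[of 0 m "Suc (start m + i) - m"] by (simp add: upt_conv_Cons del: upt_Suc)
  then show ?thesis unfolding stk_def using assms by (simp add: start_def nth_append del: upt_Suc)
qed

lemma closed_stk: "closed (stk p)"
proof -
  have "p < length (concat (map chunk [0..<Suc p]))"
  proof (induction p)
    case 0
    show ?case by (simp add: chunk_def)
  next
    case (Suc p)
    then show ?case by (simp add: chunk_def)
  qed
  then have "stk p \<in> set (concat (map chunk [0..<Suc p]))" unfolding stk_def by (rule nth_mem)
  then show ?thesis by (auto simp: chunk_def closed_descent)
qed

definition W :: "nat \<Rightarrow> trm" where
  "W m = Abs (B 0 \<cdot> (C \<cdot> church (sq m) \<cdot> Var 0))"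

text \<open>The call of \<open>W m\<close> with its numeral is due once block \<open>m\<close> is
  spent, hence at the start of block \<open>Suc m\<close>.\<close>

sublocale stack stk W "\<lambda>m. church (z m)" "\<lambda>m. start (Suc m)"
  by unfold_locales (rule closed_stk)

lemma seg_chunk: "seg (start m) (start (Suc m)) = chunk m"
  by (rule nth_equalityI) (simp_all add: start_Suc stk_chunk)

lemma seg_first: "stk (start m) = tup (Suc (z m))"
  and seg_rest: "seg (Suc (start m)) (start (Suc m)) = descent (z m) 0"
proof -
  have "seg (start m) (start (Suc m)) = stk (start m) # seg (Suc (start m)) (start (Suc m))"
    using start_less[of m] by (simp add: seg_def upt_conv_Cons)
  then show "stk (start m) = tup (Suc (z m))" "seg (Suc (start m)) (start (Suc m)) = descent (z m) 0"
    unfolding seg_chunk by (simp_all add: chunk_def)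
qed

text \<open>\<open>Kstar\<close> drops \<open>church i\<close>: on a node the two runs become alike
  here, except for \<open>v\<close>.\<close>

lemma eqv_D_run:
  assumes "D \<cdot> x \<simeq> Kstar"
  shows "apps (D \<cdot> x) [church i, Atrm, Atrm, GM S y, church 0, v] \<simeq> Theta \<cdot> GM S y \<cdot> church 0 \<cdot> v"
proof -
  have "D \<cdot> x \<cdot> church i \<cdot> Atrm \<simeq> Kstar \<cdot> church i \<cdot> Atrm" by (intro eqv_app assms eqv_refl)
  from eqv_trans[OF this eqv_whs[OF whs_Kstar]]
  have "apps (D \<cdot> x \<cdot> church i \<cdot> Atrm) [Atrm, GM S y, church 0, v] \<simeq> apps Atrm [Atrm, GM S y, church 0, v]"
    by (rule eqv_apps_same)
  then show ?thesis by (simp add: Theta_def)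
qed

lemma eqv_calls:
  assumes "D \<cdot> x \<simeq> Kstar"
  shows "apps (apps (D \<cdot> x) [church i, Atrm, Atrm, GM S (stk (start m)), church 0, v])
    (seg (Suc (start m)) (start (Suc m))) \<simeq> v \<cdot> church (z m)"
proof -
  have "apps (Theta \<cdot> GM S (tup (Suc (z m))) \<cdot> church 0 \<cdot> v) (descent (z m) 0) \<simeq> v \<cdot> church (z m)"
    by (rule eqv_descent) (simp_all add: S_succ)
  from eqv_trans[OF eqv_apps_same[OF eqv_D_run[OF assms]] this]
  show ?thesis unfolding seg_rest seg_first .
qed

text \<open>All arguments of the head \<open>x\<close> in \<open>B i \<cdot> x \<cdot> y\<close> but
  the last one. The distinguishing numeral sits at position \<open>length rs\<close>.\<close>

definition tl_args :: "nat \<Rightarrow> trm \<Rightarrow> trm \<Rightarrow> trm list" where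
  "tl_args i x y = map (psub (\<lambda>_. x)) rs @ [church i, Atrm, Atrm, GM S y, church 0]"

lemma whs_B_hnf:
  "whs (B i \<cdot> x \<cdot> y) (apps x (tl_args i x y @ [Abs (B i \<cdot> (C \<cdot> lift x 0 \<cdot> Var 0))]))"
proof -
  have "whs (psub (\<lambda>_. x) (D \<cdot> Var 0)) (psub (\<lambda>_. x) (apps (Var 0) rs))"
    using D_var by (rule whs_psub)
  then have "whs (D \<cdot> x) (apps x (map (psub (\<lambda>_. x)) rs))" by simp
  from whs_apps[OF this, of "[church i, Atrm, Atrm, GM S y, church 0, Abs (B i \<cdot> (C \<cdot> lift x 0 \<cdot> Var 0))]"]
  show ?thesis using whs_B_app[of D C S i x y] unfolding tl_args_def by simp
qed

lemma W_hnf: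
  assumes \<sigma>: "closed \<sigma>" "\<sigma> \<simeq> church (sq m)"
  shows "Abs (B i \<cdot> (C \<cdot> \<sigma> \<cdot> Var 0)) \<cdot> Var 0 \<cdot> Var 1 \<simeq>
    apps (Var 0) ((cs m @ tl_args i (C \<cdot> \<sigma> \<cdot> Var 0) (Var 1)) @ [Abs (B i \<cdot> (C \<cdot> (C \<cdot> \<sigma> \<cdot> Var 1) \<cdot> Var 0))])"
proof -
  let ?x = "C \<cdot> \<sigma> \<cdot> Var 0"
  let ?as = "tl_args i ?x (Var 1) @ [Abs (B i \<cdot> (C \<cdot> (C \<cdot> \<sigma> \<cdot> Var 1) \<cdot> Var 0))]"
  have "whs (apps (Abs (B i \<cdot> ?x)) [Var 0, Var 1]) (apps (subst (B i \<cdot> ?x) (Var 0) 0) [Var 1])"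
    by (rule whs_redex)
  then have "whs (Abs (B i \<cdot> ?x) \<cdot> Var 0 \<cdot> Var 1) (B i \<cdot> ?x \<cdot> Var 1)" using \<sigma> by simp
  from eqv_trans[OF eqv_whs[OF this] eqv_whs[OF whs_B_hnf]]
  have 1: "Abs (B i \<cdot> ?x) \<cdot> Var 0 \<cdot> Var 1 \<simeq> apps ?x ?as" using \<sigma> by simp
  have "?x \<simeq> apps (Var 0) (cs m)"
    using eqv_app[OF eqv_app[OF eqv_refl \<sigma>(2)] eqv_refl] C_var by (rule eqv_trans)
  from eqv_trans[OF 1 eqv_apps_same[OF this]] show ?thesis by simp
qed

lemma D_sq_eqv: "D \<cdot> church (sq m) \<simeq> Kstar"
  using D_sq by (rule eqv_beta_conv)

lemma C_step_eqv: "C \<cdot> church (sq m) \<cdot> church (z m) \<simeq> church (sq (Suc m))"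
  using C_step by (rule eqv_beta_conv)

lemma closed_tl_args: "closed_at d x \<Longrightarrow> closed_at d y \<Longrightarrow> a \<in> set (tl_args i x y) \<Longrightarrow> closed_at d a"
  using closed_rs closed_at_psub[of 1 _ d "\<lambda>_. x"] closed_at_GM[of S d y] by (auto simp: tl_args_def)

sublocale path stk W "\<lambda>m. church (z m)" "\<lambda>m. start (Suc m)"
  "\<lambda>m. cs m @ tl_args 0 (C \<cdot> church (sq m) \<cdot> Var 0) (Var 1)"
  "\<lambda>m. Abs (B 0 \<cdot> (C \<cdot> (C \<cdot> church (sq m) \<cdot> Var 1) \<cdot> Var 0))"
proof
  fix m
  show "start (Suc m) < start (Suc (Suc m))" by (rule start_less)
  show "closed (W m)" by (simp add: W_def closed_mono)
  show "closed (church (z m))" by simp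
  show "W m \<cdot> Var 0 \<cdot> Var 1 \<simeq> apps (Var 0) ((cs m @ tl_args 0 (C \<cdot> church (sq m) \<cdot> Var 0) (Var 1)) @
    [Abs (B 0 \<cdot> (C \<cdot> (C \<cdot> church (sq m) \<cdot> Var 1) \<cdot> Var 0))])"
    unfolding W_def by (rule W_hnf) simp_all
  show "closed_at 2 a" if "a \<in> set (cs m @ tl_args 0 (C \<cdot> church (sq m) \<cdot> Var 0) (Var 1))" for a
    using that closed_tl_args[of 2 "C \<cdot> church (sq m) \<cdot> Var 0" "Var 1" a 0] closed_at_mono[OF closed_cs]
    by (auto simp: closed_mono)
  show "closed_at 2 (Abs (B 0 \<cdot> (C \<cdot> (C \<cdot> church (sq m) \<cdot> Var 1) \<cdot> Var 0)))"
    by (simp add: closed_mono)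
  let ?\<tau> = "case_nat (church (z m)) (\<lambda>_. stk (start (Suc m)))"
  show "psub ?\<tau> (Abs (B 0 \<cdot> (C \<cdot> (C \<cdot> church (sq m) \<cdot> Var 1) \<cdot> Var 0))) \<simeq> W (Suc m)"
  proof -
    have "Abs (B 0 \<cdot> (C \<cdot> (C \<cdot> church (sq m) \<cdot> church (z m)) \<cdot> Var 0)) \<simeq> W (Suc m)"
      unfolding W_def by (intro eqv_abs eqv_app eqv_refl C_step_eqv)
    then show ?thesis by simp
  qed
  let ?x = "C \<cdot> church (sq m) \<cdot> church (z m)"
  show "apps (church (z m)) (map (psub ?\<tau>) (cs m @ tl_args 0 (C \<cdot> church (sq m) \<cdot> Var 0) (Var 1)) @
      Var 0 # seg (Suc (start (Suc m))) (start (Suc (Suc m)))) \<simeq> Var 0 \<cdot> church (z (Suc m))"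
  proof -
    let ?as = "[church 0, Atrm, Atrm, GM S (stk (start (Suc m))), church 0, Var 0]"
    let ?y = "psub ?\<tau> (apps (Var 0) (cs m))"
    have tl: "map (psub ?\<tau>) (tl_args 0 (C \<cdot> church (sq m) \<cdot> Var 0) (Var 1)) @ [Var 0]
      = map (psub (\<lambda>_. ?x)) rs @ ?as"
      by (simp add: tl_args_def)
    have "psub ?\<tau> (C \<cdot> church (sq m) \<cdot> Var 0) \<simeq> ?y"
      using C_var by (rule eqv_psub) simp
    then have y: "?x \<simeq> ?y" by simp
    have x: "?x \<simeq> church (sq (Suc m))" by (rule C_step_eqv)
    \<comment> \<open>The head normal form of \<open>D\<close> is read backwards: once the numeral
      has been supplied, the arguments of the head variable fold up to \<open>D\<close> applied to
      the next node.\<close>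
    have "apps ?x (map (psub (\<lambda>_. ?x)) rs) \<simeq> D \<cdot> ?x"
    proof -
      have "whs (psub (\<lambda>_. ?x) (D \<cdot> Var 0)) (psub (\<lambda>_. ?x) (apps (Var 0) rs))"
        using D_var by (rule whs_psub)
      from eqv_sym[OF eqv_whs[OF this]] show ?thesis by simp
    qed
    from eqv_trans[OF eqv_apps_same[OF eqv_sym[OF y]] this]
    have "apps ?y (map (psub (\<lambda>_. ?x)) rs) \<simeq> D \<cdot> ?x" .
    then have "apps (apps (apps ?y (map (psub (\<lambda>_. ?x)) rs)) ?as) (seg (Suc (start (Suc m))) (start (Suc (Suc m))))
      \<simeq> apps (apps (D \<cdot> ?x) ?as) (seg (Suc (start (Suc m))) (start (Suc (Suc m))))"
      by (intro eqv_apps_same)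
    also have "\<dots> \<simeq> Var 0 \<cdot> church (z (Suc m))"
      using eqv_trans[OF eqv_app[OF eqv_refl x] D_sq_eqv] by (rule eqv_calls)
    finally have "apps (apps (apps ?y (map (psub (\<lambda>_. ?x)) rs)) ?as) (seg (Suc (start (Suc m))) (start (Suc (Suc m))))
      \<simeq> Var 0 \<cdot> church (z (Suc m))" .
    moreover have "apps (church (z m)) (map (psub ?\<tau>) (cs m @ tl_args 0 (C \<cdot> church (sq m) \<cdot> Var 0) (Var 1)) @
      Var 0 # seg (Suc (start (Suc m))) (start (Suc (Suc m))))
      = apps (apps ?y (map (psub ?\<tau>) (tl_args 0 (C \<cdot> church (sq m) \<cdot> Var 0) (Var 1)) @ [Var 0]))
        (seg (Suc (start (Suc m))) (start (Suc (Suc m))))" by simp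
    ultimately show ?thesis unfolding tl by simp
  qed
  show "hn (W m \<cdot> church (z m))"
  proof -
    have "wh (W m \<cdot> church (z m)) (B 0 \<cdot> ?x)"
      using wh_redex[of "B 0 \<cdot> (C \<cdot> church (sq m) \<cdot> Var 0)" "church (z m)"] by (simp add: W_def)
    moreover have "hn (B 0 \<cdot> ?x \<cdot> Var 0)"
    proof -
      let ?f = "Abs (B 0 \<cdot> (C \<cdot> lift ?x 0 \<cdot> Var 0))"
      have "D \<cdot> ?x \<simeq> Kstar" using eqv_app[OF eqv_refl C_step_eqv] D_sq_eqv by (rule eqv_trans)
      from eqv_trans[OF eqv_trans[OF eqv_whs[OF whs_B_app] eqv_D_run[OF this]] eqv_whs[OF whs_level_pair]]
      have "B 0 \<cdot> ?x \<cdot> Var 0 \<simeq> pair (?f \<cdot> church 0)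
        (church 0 \<cdot> gO \<cdot> Var 0 \<cdot> (Theta \<cdot> GM S (Var 0) \<cdot> (S \<cdot> church 0) \<cdot> ?f))" by simp
      moreover have "hn (pair a b)" for a b by (simp add: pair_def hn_Abs)
      ultimately show ?thesis using eqv_hn by blast
    qed
    ultimately show ?thesis using hn_wh hn_AppD by blast
  qed
qed

end

section \<open>Telling terms apart by their head variables\<close>

text \<open>Both \<open>h\<close> and the difference of \<open>n\<close> and \<open>d\<close> are
  invariants of the \<open>\<simeq>\<close>-class by \<open>shape_unique\<close>; \<eta>-expansion
  leaves them alone.\<close>

definition shape :: "nat \<Rightarrow> nat \<Rightarrow> nat \<Rightarrow> trm \<Rightarrow> bool" where
  "shape d h n t \<longleftrightarrow> (\<exists>us. length us = n \<and> apps t (map Var [0..<d]) \<simeq> apps (Var h) us)"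

lemma shapeI: "apps t (map Var [0..<d]) \<simeq> apps (Var h) us \<Longrightarrow> length us = n \<Longrightarrow> shape d h n t"
  unfolding shape_def by blast

lemma shape_more: "shape d h n t \<Longrightarrow> shape (d + e) h (n + e) t"
proof -
  assume "shape d h n t"
  then obtain us where us: "length us = n" "apps t (map Var [0..<d]) \<simeq> apps (Var h) us"
    unfolding shape_def by blast
  have "apps (apps t (map Var [0..<d])) (map Var [d..<d + e]) \<simeq> apps (apps (Var h) us) (map Var [d..<d + e])"
    using us(2) by (rule eqv_apps_same)
  then have "apps t (map Var [0..<d + e]) \<simeq> apps (Var h) (us @ map Var [d..<d + e])"
    using upt_add_eq_append[of 0 d e] by simp
  then show ?thesis by (rule shapeI) (simp add: us(1))
qed

lemma shape_eqv: "shape d h n t \<Longrightarrow> u \<simeq> t \<Longrightarrow> shape d h n u"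
  unfolding shape_def using eqv_trans[OF eqv_apps_same] by blast

lemma shape_unique:
  assumes "shape d h n t" "shape d' h' n' u" "t \<simeq> u"
  shows "h = h' \<and> n + d' = n' + d"
proof -
  have "shape (d + d') h (n + d') t" using assms(1) by (rule shape_more)
  moreover have "shape (d + d') h' (n' + d) t"
    using shape_more[OF shape_eqv[OF assms(2,3)], of d] by (simp add: add.commute)
  ultimately obtain us vs where *: "length us = n + d'" "length vs = n' + d"
    "apps t (map Var [0..<d + d']) \<simeq> apps (Var h) us" "apps t (map Var [0..<d + d']) \<simeq> apps (Var h') vs"
    unfolding shape_def by blast
  show ?thesis using eqv_head[OF eqv_trans[OF eqv_sym[OF *(3)] *(4)]] *(1,2) by simp
qed

lemma shape_Kfst: "shape 2 0 0 Kfst"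
  using eqv_whs[OF whs_Kfst[of "Var 0" "Var 1"]] by (intro shapeI[where us = "[]"]) (simp_all add: numeral_2_eq_2)

lemma shape_Kstar: "shape 2 1 0 Kstar"
  using eqv_whs[OF whs_Kstar[of "Var 0" "Var 1"]] by (intro shapeI[where us = "[]"]) (simp_all add: numeral_2_eq_2)

lemma shape_church_0: "shape 2 1 0 (church 0)"
  using eqv_whs[OF whs_church[of 0 "Var 0" "Var 1"]]
  by (intro shapeI[where us = "[]"]) (simp_all add: numeral_2_eq_2)

lemma shape_church_Suc: "shape 2 0 1 (church (Suc k))"
  using eqv_whs[OF whs_church[of "Suc k" "Var 0" "Var 1"]]
  by (intro shapeI[where us = "[(App (Var 0) ^^ k) (Var 1)]"]) (simp_all add: numeral_2_eq_2)

lemma shape_pair: "shape 1 0 2 (pair a b)"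
  using eqv_whs[OF whs_pair[of a b "Var 0"]] by (intro shapeI[where us = "[a, b]"]) simp_all

lemma shape_tup: "length as \<le> N \<Longrightarrow> shape (Suc (N - length as)) (N - length as) N (apps (tup N) as)"
proof -
  assume le: "length as \<le> N"
  let ?bs = "as @ map Var [0..<N - length as]"
  have "whs (apps (tup N) ?bs \<cdot> Var (N - length as)) (apps (Var (N - length as)) ?bs)"
    using whs_tup[of ?bs] le by simp
  then show ?thesis using le by (intro shapeI[where us = ?bs]) (simp_all add: eqv_whs)
qed

lemma shape_sel: "l < N \<Longrightarrow> shape N l 0 (sel N l)"
  using eqv_whs[OF whs_sel[of l "map Var [0..<N]"]] by (intro shapeI[where us = "[]"]) simp_all

text \<open>This is why a block may end with \<open>Kfst\<close>. It could not end with
  \<open>Kstar\<close>, which is \<open>church 0\<close>.\<close>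

lemma church_not_Kfst: "t \<simeq> church k \<Longrightarrow> \<not> t \<simeq> Kfst"
proof
  assume "t \<simeq> church k" "t \<simeq> Kfst"
  then have e: "church k \<simeq> Kfst" using eqv_trans[OF eqv_sym] by blast
  show False
  proof (cases k)
    case 0
    then show ?thesis using shape_unique[OF shape_church_0 shape_Kfst] e by simp
  next
    case (Suc l)
    then show ?thesis using shape_unique[OF shape_church_Suc shape_Kfst] e by simp
  qed
qed

section \<open>Partially applied abstractions\<close>

text \<open>The state of a multiple abstraction with \<open>n\<close> binders still open, as needed
  when a tuple or selector receives its arguments one at a time.\<close>

definition papp :: "trm \<Rightarrow> nat \<Rightarrow> (nat \<Rightarrow> trm) \<Rightarrow> trm" where
  "papp b n \<sigma> = (Abs ^^ n) (psub ((up ^^ n) \<sigma>) b)"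

lemma psub_Abs_pow: "psub \<sigma> ((Abs ^^ n) t) = (Abs ^^ n) (psub ((up ^^ n) \<sigma>) t)"
proof (induction n arbitrary: \<sigma>)
  case (Suc n)
  have "(up ^^ n) (up \<sigma>) = up ((up ^^ n) \<sigma>)" by (rule funpow_swap1[symmetric])
  then show ?case using Suc by simp
qed simp

lemma up_pow_comp: "psub ((up ^^ n) \<sigma>) ((up ^^ n) \<tau> i) = (up ^^ n) (\<lambda>i. psub \<sigma> (\<tau> i)) i"
  by (induction n arbitrary: i) (simp_all add: up_comp)

lemma papp_Suc:
  obtains a where "papp b (Suc n) \<sigma> = Abs a" "\<And>x. subst a x 0 = papp b n (case_nat x \<sigma>)"
proof
  show "papp b (Suc n) \<sigma> = Abs ((Abs ^^ n) (psub ((up ^^ Suc n) \<sigma>) b))" by (simp add: papp_def)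
  fix x
  have *: "(\<lambda>i. psub (case_nat x Var) (up \<sigma> i)) = case_nat x \<sigma>"
    by (auto simp: fun_eq_iff up_def lift0_psub split: nat.split)
  show "subst ((Abs ^^ n) (psub ((up ^^ Suc n) \<sigma>) b)) x 0 = papp b n (case_nat x \<sigma>)"
    unfolding subst0_psub psub_Abs_pow psub_psub funpow_Suc_right o_def up_pow_comp * papp_def ..
qed

lemma whs_papp: "whs (apps (papp b (n + length as) (args_env bs)) as) (papp b n (args_env (bs @ as)))"
proof (induction as arbitrary: n rule: rev_induct)
  case (snoc x as)
  obtain a where a: "papp b (Suc n) (args_env (bs @ as)) = Abs a"
    "\<And>x. subst a x 0 = papp b n (case_nat x (args_env (bs @ as)))"
    by (rule papp_Suc[of b n "args_env (bs @ as)"]) (rule that)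
  have "whs (apps (papp b (Suc n + length as) (args_env bs)) as \<cdot> x) (papp b (Suc n) (args_env (bs @ as)) \<cdot> x)"
    by (rule whs_App[OF snoc.IH])
  also have "wh (papp b (Suc n) (args_env (bs @ as)) \<cdot> x) (subst a x 0)"
    unfolding a(1) by (rule wh_redex)
  finally show ?case using args_env_snoc[of "bs @ as" x] by (simp add: a(2))
qed simp

definition tup_inner :: "nat \<Rightarrow> trm" where
  "tup_inner N = apps (Var 0) (map (\<lambda>l. Var (N - l)) [0..<N])"

lemma up_pow_Var: "(up ^^ n) Var = Var"
  by (induction n) simp_all

lemma tup_papp: "tup N = papp (tup_inner N) (Suc N) (args_env [])"
  unfolding tup_def papp_def args_env_Nil up_pow_Var psub_Var tup_inner_def funpow_Suc_Abs ..

lemma papp_tup_full: "length as = N \<Longrightarrow> papp (tup_inner N) 0 (args_env (as @ [q])) = apps q as"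
proof -
  assume "length as = N"
  with tup_body[of as] have "psub (up (args_env as)) (tup_inner N) = apps (Var 0) (map (\<lambda>a. lift a 0) as)"
    by (simp add: tup_inner_def)
  then have "psub (case_nat q Var) (psub (up (args_env as)) (tup_inner N)) = apps q as"
    by (simp add: o_def subst0_psub[symmetric] del: psub_psub)
  then show ?thesis unfolding psub_up_env by (simp add: papp_def args_env_snoc)
qed

lemma sel_papp: "sel N l = papp (Var (N - 1 - l)) N (args_env [])"
  by (simp add: papp_def up_pow_Var sel_def)

lemma papp_sel_full: "l < length as \<Longrightarrow> papp (Var (length as - 1 - l)) 0 (args_env as) = as ! l"
proof -
  assume l: "l < length as"
  then have "length as - Suc l < length as" by linarith
  with l show ?thesis by (simp add: papp_def args_env_def rev_nth)
qed

lemma whs_sel_part: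
  assumes "l < N" "Suc (length as) = N"
  obtains a where "whs (apps (sel N l) as) (Abs a)" "\<And>x. subst a x 0 = (as @ [x]) ! l"
proof -
  let ?b = "Var (N - 1 - l)"
  obtain a where a: "papp ?b (Suc 0) (args_env as) = Abs a" "\<And>x. subst a x 0 = papp ?b 0 (case_nat x (args_env as))"
    by (rule papp_Suc[of ?b 0 "args_env as"]) (rule that)
  have "whs (apps (sel N l) as) (Abs a)"
    using whs_papp[of ?b 1 as "[]"] assms(2) a(1) by (simp add: sel_papp)
  moreover have "subst a x 0 = (as @ [x]) ! l" for x
    using papp_sel_full[of l "as @ [x]"] assms a(2)[of x] by (simp add: args_env_snoc)
  ultimately show thesis by (rule that)
qed

text \<open>\<open>beta_conv_reach\<close> fixes the number of arguments by an actual reduction;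
  what the arguments are is left open.\<close>

lemma whs_num_gO:
  assumes "closed k" "beta_conv k (church j)"
  obtains bs where "length bs = j" "whs (k \<cdot> gO \<cdot> y) (apps y bs)"
proof -
  have "beta_conv (k \<cdot> gO \<cdot> Var 0) (church j \<cdot> gO \<cdot> Var 0)" using assms(2) by (intro beta_conv_appL)
  also have "beta_conv (church j \<cdot> gO \<cdot> Var 0) (apps (Var 0) (replicate j Om))"
    by (rule whs_beta_conv[OF whs_church_gO])
  finally obtain bs where bs: "whs (k \<cdot> gO \<cdot> Var 0) (apps (Var 0) bs)" "length bs = length (replicate j Om)"
    by (rule beta_conv_reach)
  have "whs (psub (\<lambda>_. y) (k \<cdot> gO \<cdot> Var 0)) (psub (\<lambda>_. y) (apps (Var 0) bs))" using bs(1) by (rule whs_psub)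
  then show thesis using that[of "map (psub (\<lambda>_. y)) bs"] assms(1) bs(2) by simp
qed

section \<open>The run of \<open>B\<^sub>1\<close> avoids the targets\<close>

context branch
begin

text \<open>If \<open>T \<cdot> x\<close>, followed by entries from position \<open>p\<close> on, is a target, then \<open>x\<close> is equivalent to the
  entry at position \<open>p - 1\<close>, or \<open>T \<simeq> W m\<close> and \<open>p = start (Suc m)\<close>, or the entry before some
  \<open>start (Suc m)\<close>, which is \<open>Kfst\<close>, is equivalent to a numeral.\<close>

definition admissible :: "nat \<Rightarrow> trm \<Rightarrow> trm \<Rightarrow> bool" where
  "admissible p T x \<longleftrightarrow> (0 < p \<longrightarrow> \<not> x \<simeq> stk (p - 1)) \<and> (\<forall>m. p = start (Suc m) \<longrightarrow> \<not> T \<simeq> W m)"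

text \<open>In a pair \<open>(p, s)\<close>, the first \<open>p\<close> entries have been consumed.
  Admissibility at each reduction step is the evidence that no target is met there.\<close>

inductive move :: "nat \<times> trm \<Rightarrow> nat \<times> trm \<Rightarrow> bool" where
  red: "wh (T \<cdot> x) s \<Longrightarrow> admissible p T x \<Longrightarrow> move (p, T \<cdot> x) (p, s)"
| pop: "move (p, Abs a) (Suc p, subst a (stk p) 0)"

lemma start_mono: "m < n \<Longrightarrow> start m < start n"
  using start_less by (rule lift_Suc_mono_less)

lemma stk_last: "stk (start (Suc m) - 1) = Kfst"
proof -
  have "last (seg (start m) (start (Suc m))) = Kfst"
    unfolding seg_chunk by (simp add: chunk_def descent_def)
  moreover have "seg (start m) (start (Suc m)) = seg (start m) (start (Suc m) - 1) @ [stk (start (Suc m) - 1)]"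
    using start_less[of m] seg_Suc[of "start m" "start (Suc m) - 1"] by simp
  ultimately show ?thesis by simp
qed

lemma apps_split:
  assumes "apps s as = apps t bs" "length as \<le> length bs"
  obtains bs1 bs2 where "bs = bs1 @ bs2" "length bs2 = length as" "as = bs2" "s = apps t bs1"
proof -
  have "apps s as = apps t bs \<Longrightarrow> length as \<le> length bs \<Longrightarrow> \<exists>bs1. bs = bs1 @ as \<and> s = apps t bs1"
    for as bs
  proof (induction as arbitrary: bs rule: rev_induct)
    case (snoc a as)
    then obtain bs' b where b: "bs = bs' @ [b]" by (cases bs rule: rev_cases) auto
    with snoc.IH[of bs'] snoc.prems show ?case by auto
  qed simp
  from this[OF assms] that show thesis by blast
qed

text \<open>Success has a finite derivation, but the invariant keeps the admissible run going. As
  \<open>feed\<close> may run ahead of the abstractions, the derivation speaks of \<open>s\<close>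
  with the entries from \<open>p\<close> to \<open>k\<close> already attached.\<close>

lemma runs_forever_not_bb:
  assumes run: "\<And>Q. I Q \<Longrightarrow> \<exists>Q'. move Q Q' \<and> I Q'"
  shows "bb k t \<Longrightarrow> I (p, s) \<Longrightarrow> t = apps s (seg p k) \<Longrightarrow> p \<le> k \<Longrightarrow> False"
proof (induction arbitrary: p s rule: bb.induct)
  case (base k t)
  then obtain m w q es where t: "t = apps w (q # es)" "w \<simeq> W m" "q \<simeq> church (z m)"
    "start (Suc m) \<le> k" "list_all2 (\<simeq>) es (seg (start (Suc m)) k)" unfolding target_def by blast
  have len: "length es = k - start (Suc m)" using list_all2_lengthD[OF t(5)] by simp
  from run[OF base.prems(1)] obtain Q where Q: "move (p, s) Q" by blast
  consider "p < start (Suc m)" | "start (Suc m) \<le> p" by linarith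
  then show ?case
  proof cases
    case 1
    \<comment> \<open>The argument \<open>q\<close> of the target would be the last entry of a
      block, \<open>Kfst\<close>, which is no numeral.\<close>
    have "apps (w \<cdot> q) es = apps s (seg p k)" using base.prems(2) by (simp add: t(1))
    moreover have "length es \<le> length (seg p k)" using len 1 by simp
    ultimately obtain bs1 bs2 where bs: "seg p k = bs1 @ bs2" "length bs2 = length es" "w \<cdot> q = apps s bs1"
      by (rule apps_split)
    have "seg p k = seg p (start (Suc m)) @ seg (start (Suc m)) k"
      using 1 t(4) by (simp add: seg_append)
    with bs len have "bs1 = seg p (start (Suc m))" by simp
    then have "bs1 = seg p (start (Suc m) - 1) @ [Kfst]"
      using 1 seg_Suc[of p "start (Suc m) - 1"] stk_last[of m] by simp
    with bs(3) have "q = Kfst" by simp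
    with t(3) church_not_Kfst[of q] show ?thesis by simp
  next
    case 2
    \<comment> \<open>Here \<open>w\<close> and \<open>q\<close> lie inside \<open>s\<close>. The
      last argument of \<open>s\<close> is \<open>q\<close> itself, with \<open>w\<close> excluded
      by admissibility, or a later one, equivalent to the preceding stack entry.\<close>
    have e: "apps s (seg p k) = apps w (q # es)" using base.prems(2) by (simp add: t(1))
    have "length (seg p k) \<le> length (q # es)" using 2 len by simp
    with e obtain bs1 bs2 where bs: "q # es = bs1 @ bs2" "length bs2 = length (seg p k)" "s = apps w bs1"
      by (rule apps_split)
    have len1: "length bs1 = Suc (p - start (Suc m))"
    proof -
      have "Suc (length es) = length bs1 + length bs2" using arg_cong[OF bs(1), of length] by simp
      then show ?thesis using bs(2) len 2 base.prems(3) by simp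
    qed
    then obtain cs c where c: "bs1 = cs @ [c]" by (cases bs1 rule: rev_cases) auto
    with bs(3) have s: "s = apps w cs \<cdot> c" by simp
    with Q have adm: "admissible p (apps w cs) c" by (cases rule: move.cases) auto
    show ?thesis
    proof (cases "p = start (Suc m)")
      case True
      with len1 c have "cs = []" by simp
      with adm True t(2) show ?thesis by (auto simp: admissible_def)
    next
      case False
      with 2 have p: "start (Suc m) < p" by simp
      define i where "i = p - start (Suc m) - 1"
      have i: "i < length es" "length cs = Suc i" using p len base.prems(3) len1 c by (auto simp: i_def)
      have "c = (q # es) ! length cs" unfolding bs(1) c by (simp add: nth_append)
      then have "c = es ! i" by (simp add: i(2))
      moreover have "es ! i \<simeq> seg (start (Suc m)) k ! i"
        using t(5) i(1) by (auto simp: list_all2_conv_all_nth)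
      moreover have "seg (start (Suc m)) k ! i = stk (p - 1)" using i(1) len p by (simp add: i_def)
      ultimately show ?thesis using adm p by (simp add: admissible_def)
    qed
  qed
next
  case (feed k t)
  show ?case
    by (rule feed.IH[OF feed.prems(1)]) (use feed.prems(2,3) seg_Suc[OF feed.prems(3)] in simp_all)
next
  case (step t t' k)
  from run[OF step.prems(1)] obtain Q where Q: "move (p, s) Q" "I Q" by blast
  from Q(1) show ?case
  proof cases
    case (red T x s')
    have "t' = apps s' (seg p k)"
      using wh_det[OF step.hyps(1)] wh_apps[OF red(3), of "seg p k"] step.prems(2) red(1) by simp
    with step.IH[of p s'] Q(2) step.prems(3) red(2) show ?thesis by simp
  next
    case (pop a)
    show ?thesis
    proof (cases "p = k")
      case True
      with step.prems(2) pop(1) step.hyps(1) show ?thesis by (simp add: seg_def)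
    next
      case False
      with step.prems(3) have "seg p k = stk p # seg (Suc p) k" by (simp add: seg_def upt_conv_Cons)
      then have "wh t (apps (subst a (stk p) 0) (seg (Suc p) k))"
        using step.prems(2) pop(1) wh_apps[OF wh_redex[of a "stk p"], of "seg (Suc p) k"] by simp
      from wh_det[OF step.hyps(1) this] step.IH[of "Suc p" "subst a (stk p) 0"] Q(2) pop(2) step.prems(3) False
      show ?thesis by simp
    qed
  qed
qed

end

section \<open>Sequences of moves, and the inequivalences that make them admissible\<close>

context branch
begin

lemma admissible_eqv: "T \<simeq> T' \<Longrightarrow> admissible p T x \<Longrightarrow> admissible p T' x"
  unfolding admissible_def using eqv_trans by blast

text \<open>Admissibility depends on the function part only up to \<open>\<simeq>\<close>, so one
  check covers all its reductions while the last argument stays in place.\<close>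

lemma moves_red: "whs T T' \<Longrightarrow> admissible p T x \<Longrightarrow> move\<^sup>*\<^sup>* (p, T \<cdot> x) (p, T' \<cdot> x)"
proof (induction rule: converse_rtranclp_induct)
  case (step T T1)
  have "move (p, T \<cdot> x) (p, T1 \<cdot> x)" using step by (intro red wh_appL)
  moreover have "admissible p T1 x" using eqv_wh[OF step.hyps(1)] step.prems by (rule admissible_eqv)
  ultimately show ?case using step.IH by (blast intro: converse_rtranclp_into_rtranclp)
qed simp

lemma moves_beta: "whs T (Abs a) \<Longrightarrow> admissible p T x \<Longrightarrow> move\<^sup>+\<^sup>+ (p, T \<cdot> x) (p, subst a x 0)"
proof -
  assume T: "whs T (Abs a)" "admissible p T x"
  have "admissible p (Abs a) x" using eqv_whs[OF T(1)] T(2) by (rule admissible_eqv)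
  then have "move (p, Abs a \<cdot> x) (p, subst a x 0)" by (intro red wh_redex)
  with moves_red[OF T] show ?thesis by (rule rtranclp_into_tranclp1)
qed

lemma moves_papp:
  "move\<^sup>*\<^sup>* (p, papp b (n + i) (args_env bs)) (p + i, papp b n (args_env (bs @ seg p (p + i))))"
proof (induction i arbitrary: p bs)
  case 0
  show ?case by (simp add: seg_def)
next
  case (Suc i)
  obtain a where a: "papp b (Suc (n + i)) (args_env bs) = Abs a"
    "\<And>x. subst a x 0 = papp b (n + i) (case_nat x (args_env bs))"
    by (rule papp_Suc[of b "n + i" "args_env bs"]) (rule that)
  have "move (p, papp b (n + Suc i) (args_env bs)) (Suc p, subst a (stk p) 0)"
    using pop[of p a] a(1) by simp
  also have "subst a (stk p) 0 = papp b (n + i) (args_env (bs @ [stk p]))"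
    by (simp add: a(2) args_env_snoc)
  also have "move\<^sup>*\<^sup>* (Suc p, papp b (n + i) (args_env (bs @ [stk p])))
    (Suc p + i, papp b n (args_env ((bs @ [stk p]) @ seg (Suc p) (Suc p + i))))" by (rule Suc.IH)
  also have "(bs @ [stk p]) @ seg (Suc p) (Suc p + i) = bs @ seg p (p + Suc i)"
    by (simp add: seg_def upt_conv_Cons del: upt_Suc)
  finally show ?case by simp
qed

lemma move_pair: "move (p, pair a b) (Suc p, stk p \<cdot> a \<cdot> b)"
  using pop[of p "Var 0 \<cdot> lift a 0 \<cdot> lift b 0"] by (simp add: pair_def)

lemma inner_not_boundary: "start m < p \<Longrightarrow> p < start (Suc m) \<Longrightarrow> p \<noteq> start (Suc n)"
proof
  assume "start m < p" "p < start (Suc m)" "p = start (Suc n)"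
  moreover have "start i \<le> start j" if "i \<le> j" for i j
    using that start_mono[of i j] by (cases "i = j") auto
  ultimately have "\<not> Suc n \<le> m" "\<not> Suc m \<le> Suc n" by (metis not_le)+
  then show False by simp
qed

lemma admissible_inner:
  "start m < p \<Longrightarrow> p < start (Suc m) \<Longrightarrow> \<not> x \<simeq> stk (p - 1) \<Longrightarrow> admissible p T x"
  unfolding admissible_def using inner_not_boundary by blast

lemma two_vars: "map Var [0..<2] = [Var 0, Var 1]"
  by (simp add: numeral_2_eq_2)

lemma length_tl_args: "length (tl_args i x y) = length rs + 5"
  by (simp add: tl_args_def)

lemma church_1_not_0: "\<not> church 1 \<simeq> church 0"
  using shape_unique[OF shape_church_Suc[of 0] shape_church_0] by auto

lemma shape_W:
  assumes "closed \<sigma>" "\<sigma> \<simeq> church (sq m)"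
  shows "shape 2 0 (length (cs m) + length rs + 6) (Abs (B i \<cdot> (C \<cdot> \<sigma> \<cdot> Var 0)))"
proof (rule shapeI)
  show "apps (Abs (B i \<cdot> (C \<cdot> \<sigma> \<cdot> Var 0))) (map Var [0..<2]) \<simeq>
    apps (Var 0) ((cs m @ tl_args i (C \<cdot> \<sigma> \<cdot> Var 0) (Var 1)) @ [Abs (B i \<cdot> (C \<cdot> (C \<cdot> \<sigma> \<cdot> Var 1) \<cdot> Var 0))])"
    using W_hnf[OF assms, of i] by (simp add: two_vars)
qed (simp add: length_tl_args)

text \<open>Counting the arguments of the head forces \<open>us\<close> to be as long as
  \<open>cs m\<close>; then position \<open>length us + length rs\<close> holds
  \<open>church 1\<close> on one side and \<open>church 0\<close> on the other.\<close>

lemma not_W: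
  assumes t: "t \<cdot> Var 0 \<cdot> Var 1 \<simeq> apps (Var 0) ((us @ tl_args 1 x y) @ [a])"
  shows "\<not> t \<simeq> W m"
proof
  assume "t \<simeq> W m"
  then have 1: "t \<cdot> Var 0 \<cdot> Var 1 \<simeq> W m \<cdot> Var 0 \<cdot> Var 1" by (intro eqv_app eqv_refl)
  let ?bs = "cs m @ tl_args 0 (C \<cdot> church (sq m) \<cdot> Var 0) (Var 1)"
  let ?b = "Abs (B 0 \<cdot> (C \<cdot> (C \<cdot> church (sq m) \<cdot> Var 1) \<cdot> Var 0))"
  have 2: "W m \<cdot> Var 0 \<cdot> Var 1 \<simeq> apps (Var 0) (?bs @ [?b])" unfolding W_def by (rule W_hnf) simp_all
  note e = eqv_trans[OF eqv_trans[OF eqv_sym[OF t] 1] 2]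
  have us: "length us = length (cs m)" using eqv_head(2)[OF e] by (simp add: length_tl_args)
  have "((us @ tl_args 1 x y) @ [a]) ! (length us + length rs) \<simeq> (?bs @ [?b]) ! (length us + length rs)"
    by (rule eqv_comps[OF e]) (simp add: length_tl_args)
  then show False using church_1_not_0 by (simp add: us tl_args_def nth_append)
qed

lemma B_1_not_W: "\<not> B 1 \<simeq> W m"
  by (rule not_W[where us = "[]"]) (use eqv_whs[OF whs_B_hnf] in simp)

lemma W_1_not_W:
  assumes "closed \<sigma>" "\<sigma> \<simeq> church (sq m')"
  shows "\<not> Abs (B 1 \<cdot> (C \<cdot> \<sigma> \<cdot> Var 0)) \<simeq> W m"
  by (rule not_W[OF W_hnf[OF assms]])

text \<open>Otherwise \<open>P \<cdot> Var 1\<close> would be equivalent to a term with head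
  \<open>Var 0\<close>, a variable that it does not contain. Substituting \<open>Om\<close> for that
  variable kills one side only.\<close>

lemma Kfst_not_W:
  assumes P: "closed P"
  shows "\<not> Kfst \<cdot> P \<simeq> W m"
proof
  assume e: "Kfst \<cdot> P \<simeq> W m"
  let ?bs = "(cs m @ tl_args 0 (C \<cdot> church (sq m) \<cdot> Var 0) (Var 1)) @
    [Abs (B 0 \<cdot> (C \<cdot> (C \<cdot> church (sq m) \<cdot> Var 1) \<cdot> Var 0))]"
  have 1: "P \<cdot> Var 1 \<simeq> Kfst \<cdot> P \<cdot> Var 0 \<cdot> Var 1"
    by (rule eqv_sym[OF eqv_whs[OF whs_App[OF whs_Kfst]]])
  have 2: "Kfst \<cdot> P \<cdot> Var 0 \<cdot> Var 1 \<simeq> W m \<cdot> Var 0 \<cdot> Var 1" by (intro eqv_app e eqv_refl)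
  have 3: "W m \<cdot> Var 0 \<cdot> Var 1 \<simeq> apps (Var 0) ?bs" unfolding W_def by (rule W_hnf) simp_all
  note e = eqv_trans[OF eqv_trans[OF 1 2] 3]
  let ?\<sigma> = "case_nat Om (\<lambda>_. Var 1)"
  have "psub ?\<sigma> (P \<cdot> Var 1) \<simeq> psub ?\<sigma> (apps (Var 0) ?bs)" using e by (rule eqv_psub) simp
  then have "P \<cdot> Var 1 \<simeq> apps Om (map (psub ?\<sigma>) ?bs)" using P by simp
  moreover have "hn (P \<cdot> Var 1)" using eqv_hn[OF e] by simp
  ultimately have "hn (apps Om (map (psub ?\<sigma>) ?bs))" using eqv_hn by blast
  then show False using not_hn_Om hn_appsD by blast
qed

lemma seg_ConsD:
  assumes "seg p q = x # xs"
  shows "p < q" "stk p = x" "seg (Suc p) q = xs"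
proof -
  show "p < q" using assms by (metis length_seg list.distinct(1) list.size(3) zero_less_diff length_greater_0_conv)
  then have "seg p q = stk p # seg (Suc p) q" by (simp add: seg_def upt_conv_Cons)
  with assms show "stk p = x" "seg (Suc p) q = xs" by simp_all
qed

lemma seg_appendD:
  assumes "seg p q = xs @ ys"
  shows "seg p (p + length xs) = xs" "seg (p + length xs) q = ys"
proof -
  have "seg p (p + length xs) = xs \<and> seg (p + length xs) q = ys" using assms
  proof (induction xs arbitrary: p)
    case Nil
    then show ?case by (simp add: seg_def)
  next
    case (Cons x xs)
    note * = seg_ConsD[OF Cons.prems[unfolded append_Cons]]
    have "seg p (p + length (x # xs)) = stk p # seg (Suc p) (Suc p + length xs)"
      by (simp add: seg_def upt_conv_Cons del: upt_Suc)
    with Cons.IH[OF *(3)] *(2) show ?case by simp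
  qed
  then show "seg p (p + length xs) = xs" "seg (p + length xs) q = ys" by simp_all
qed

text \<open>The stepwise counterpart of \<open>eqv_descent\<close>: each last argument must also
  differ from the stack entry just consumed. At the head of a level that entry is the tuple or a
  selector, both told from \<open>f\<close> by their shapes.\<close>

lemma descent_run:
  assumes f: "closed f" "shape 2 0 L f" "0 < L"
  shows "j \<le> z m \<Longrightarrow> closed k \<Longrightarrow> beta_conv k (church j) \<Longrightarrow> start m < p \<Longrightarrow>
    seg p (start (Suc m)) = descent (z m) j \<Longrightarrow>
    stk (p - 1) = tup (Suc (z m)) \<or> (\<exists>l<z m. stk (p - 1) = sel (Suc (z m)) l) \<Longrightarrow>
    \<exists>k'. closed k' \<and> beta_conv k' (church (z m)) \<and>
      move\<^sup>*\<^sup>* (p, Theta \<cdot> GM S (tup (Suc (z m))) \<cdot> k \<cdot> f) (start (Suc m), f \<cdot> k')"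
proof (induction "z m - j" arbitrary: j k p)
  fix d j k p
  define n where "n = z m"
  define q where "q = start (Suc m)"
  define X where "X = Theta \<cdot> GM S (tup (Suc n))"
  define T where "T = X \<cdot> (S \<cdot> k) \<cdot> f"
  define Q where "Q = k \<cdot> gO \<cdot> tup (Suc n) \<cdot> T"
  assume prems: "j \<le> z m" "closed k" "beta_conv k (church j)" "start m < p"
    "seg p (start (Suc m)) = descent (z m) j"
    "stk (p - 1) = tup (Suc (z m)) \<or> (\<exists>l<z m. stk (p - 1) = sel (Suc (z m)) l)"
  note prems' = prems[folded n_def q_def]
  have pq: "p < q"
  proof (rule ccontr)
    assume "\<not> p < q"
    then have "seg p q = []" by (simp add: seg_def)
    with prems'(5) show False by (simp add: descent_def)
  qed
  note inner = admissible_inner[of m, folded q_def]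
  have fneq: "\<not> f \<simeq> stk (p - 1)"
  proof
    assume e: "f \<simeq> stk (p - 1)"
    from prems'(6) show False
    proof (elim disjE exE conjE)
      assume "stk (p - 1) = tup (Suc n)"
      then show False using shape_unique[OF f(2) shape_tup[of "[]" "Suc n"]] e by simp
    next
      fix l assume l: "l < n" "stk (p - 1) = sel (Suc n) l"
      then have "shape (Suc n) l 0 (stk (p - 1))" using shape_sel[of l "Suc n"] by simp
      from shape_unique[OF f(2) this e] f(3) l(1) show False by simp
    qed
  qed
  obtain a where a: "whs (X \<cdot> k) (Abs a)" "subst a f 0 = pair (f \<cdot> k) Q"
  proof -
    obtain a where "whs (Theta \<cdot> GM S (tup (Suc n)) \<cdot> k) (Abs a)"
      "\<And>f. subst a f 0 = pair (f \<cdot> k) (k \<cdot> gO \<cdot> tup (Suc n) \<cdot> (Theta \<cdot> GM S (tup (Suc n)) \<cdot> (S \<cdot> k) \<cdot> f))"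
      by (rule whs_level[OF closed_S, of "tup (Suc n)" k]) (rule that)
    then show thesis using that by (simp add: Q_def T_def X_def)
  qed
  have "move\<^sup>+\<^sup>+ (p, X \<cdot> k \<cdot> f) (p, pair (f \<cdot> k) Q)"
    using moves_beta[OF a(1) inner[OF prems'(4) pq fneq]] a(2) by simp
  then have to_pair: "move\<^sup>*\<^sup>* (p, X \<cdot> k \<cdot> f) (Suc p, stk p \<cdot> (f \<cdot> k) \<cdot> Q)"
    using move_pair[of p "f \<cdot> k" Q] by (metis tranclp_into_rtranclp rtranclp.rtrancl_into_rtrancl)
  obtain bs where bs: "length bs = j" "whs (k \<cdot> gO \<cdot> tup (Suc n)) (apps (tup (Suc n)) bs)"
    using prems'(2,3) by (rule whs_num_gO)
  have "Q \<simeq> apps (tup (Suc n)) (bs @ [T])"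
    unfolding Q_def using eqv_whs[OF whs_App[OF bs(2)]] by simp
  \<comment> \<open>A partially filled tuple, hence neither \<open>Kfst\<close> nor
    \<open>Kstar\<close>, the entries it is compared with below.\<close>
  then have shape_Q: "shape (Suc (n - j)) (n - j) (Suc n) Q"
    using shape_tup[of "bs @ [T]" "Suc n"] bs(1) prems'(1) by (intro shape_eqv[of _ _ _ _ Q]) simp_all
  show "\<exists>k'. closed k' \<and> beta_conv k' (church n) \<and> move\<^sup>*\<^sup>* (p, X \<cdot> k \<cdot> f) (q, f \<cdot> k')"
    if "0 = n - j"
  proof -
    have "j = n" using that prems'(1) by simp
    note seg = seg_ConsD[OF prems'(5)[unfolded this descent_end]]
    have q: "q = Suc p"
    proof -
      have "length (seg (Suc p) q) = 0" by (simp only: seg(3) list.size)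
      then show ?thesis using pq by simp
    qed
    have "\<not> Q \<simeq> Kfst" using shape_unique[OF shape_Q shape_Kfst] by auto
    moreover have "\<not> Kfst \<cdot> (f \<cdot> k) \<simeq> W m" for m using Kfst_not_W prems'(2) f(1) by simp
    ultimately have "admissible (Suc p) (Kfst \<cdot> (f \<cdot> k)) Q"
      using seg(2) by (simp add: admissible_def)
    moreover have "whs (Kfst \<cdot> (f \<cdot> k)) (Abs (lift (f \<cdot> k) 0))"
      using wh_redex[of "Abs (Var 1)" "f \<cdot> k"] by (simp add: Kfst_def r_into_rtranclp)
    ultimately have "move\<^sup>+\<^sup>+ (Suc p, Kfst \<cdot> (f \<cdot> k) \<cdot> Q) (Suc p, subst (lift (f \<cdot> k) 0) Q 0)"
      by (intro moves_beta)
    then have "move\<^sup>*\<^sup>* (p, X \<cdot> k \<cdot> f) (q, f \<cdot> k)"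
      using to_pair unfolding seg(2) q subst_lift0 by (metis rtranclp_trans tranclp_into_rtranclp)
    with prems'(2,3) \<open>j = n\<close> show ?thesis by blast
  qed
  show "\<exists>k'. closed k' \<and> beta_conv k' (church n) \<and> move\<^sup>*\<^sup>* (p, X \<cdot> k \<cdot> f) (q, f \<cdot> k')"
    if dn: "Suc d = n - j" and IH: "\<And>j k p. d = z m - j \<Longrightarrow> j \<le> z m \<Longrightarrow> closed k \<Longrightarrow> beta_conv k (church j) \<Longrightarrow> start m < p \<Longrightarrow>
    seg p (start (Suc m)) = descent (z m) j \<Longrightarrow>
    stk (p - 1) = tup (Suc (z m)) \<or> (\<exists>l<z m. stk (p - 1) = sel (Suc (z m)) l) \<Longrightarrow>
    \<exists>k'. closed k' \<and> beta_conv k' (church (z m)) \<and>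
      move\<^sup>*\<^sup>* (p, Theta \<cdot> GM S (tup (Suc (z m))) \<cdot> k \<cdot> f) (start (Suc m), f \<cdot> k')"
  proof -
    have jn: "j < n" using that by simp
    let ?Oms = "replicate (n - j) Om"
    note seg1 = seg_ConsD[OF prems'(5)[unfolded descent_step[OF jn]]]
    note seg2 = seg_appendD[OF seg1(3)]
    define p1 where "p1 = Suc p + (n - j)"
    have p1: "Suc p + length ?Oms = p1" by (simp add: p1_def)
    note seg2 = seg2[unfolded p1]
    note seg3 = seg_ConsD[OF seg2(2)]
    have p1q: "Suc p1 < q"
    proof (rule ccontr)
      assume "\<not> Suc p1 < q"
      then have "seg (Suc p1) q = []" by (simp add: seg_def)
      with seg3(3) show False by (simp add: descent_def)
    qed
    have inner': "start m < Suc p" "Suc p < q" using prems'(4) p1q by (simp_all add: p1_def)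
    have "\<not> Q \<simeq> Kstar" using shape_unique[OF shape_Q shape_Kstar] by auto
    then have "admissible (Suc p) (Kstar \<cdot> (f \<cdot> k)) Q"
      using inner' seg1(2) by (intro inner) simp_all
    moreover have "whs (Kstar \<cdot> (f \<cdot> k)) (Abs (Var 0))"
      using wh_redex[of "Abs (Var 0)" "f \<cdot> k"] by (simp add: Kstar_def r_into_rtranclp)
    ultimately have "move\<^sup>+\<^sup>+ (Suc p, Kstar \<cdot> (f \<cdot> k) \<cdot> Q) (Suc p, subst (Var 0) Q 0)"
      by (intro moves_beta)
    then have to_Q: "move\<^sup>*\<^sup>* (p, X \<cdot> k \<cdot> f) (Suc p, Q)"
      using to_pair unfolding seg1(2) by (simp add: rtranclp_trans tranclp_into_rtranclp)
    have "T \<simeq> pair (f \<cdot> (S \<cdot> k)) (S \<cdot> k \<cdot> gO \<cdot> tup (Suc n) \<cdot> (X \<cdot> (S \<cdot> (S \<cdot> k)) \<cdot> f))"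
      unfolding T_def X_def by (rule eqv_whs[OF whs_level_pair[OF closed_S]])
    then have "\<not> T \<simeq> Kstar"
      using shape_unique[OF shape_eqv[OF shape_pair] shape_Kstar] by fastforce
    then have adm_T: "admissible (Suc p) (k \<cdot> gO \<cdot> tup (Suc n)) T"
      using inner' seg1(2) by (intro inner) simp_all
    obtain b where b: "papp (tup_inner (Suc n)) (Suc (Suc (n - j))) (args_env bs) = Abs b"
      "\<And>x. subst b x 0 = papp (tup_inner (Suc n)) (Suc (n - j)) (case_nat x (args_env bs))"
      by (rule papp_Suc[of "tup_inner (Suc n)" "Suc (n - j)" "args_env bs"]) (rule that)
    have "whs (apps (tup (Suc n)) bs) (Abs b)"
      using whs_papp[of "tup_inner (Suc n)" "Suc (Suc (n - j))" bs "[]"] b(1) bs(1) jn by (simp add: tup_papp)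
    with bs(2) have "whs (k \<cdot> gO \<cdot> tup (Suc n)) (Abs b)" by (rule rtranclp_trans)
    from moves_beta[OF this adm_T]
    have "move\<^sup>+\<^sup>+ (Suc p, Q) (Suc p, papp (tup_inner (Suc n)) (Suc (n - j)) (args_env (bs @ [T])))"
      by (simp add: b(2) Q_def args_env_snoc)
    with to_Q have 1: "move\<^sup>*\<^sup>* (p, X \<cdot> k \<cdot> f) (Suc p, papp (tup_inner (Suc n)) (Suc (n - j)) (args_env (bs @ [T])))"
      by simp
    have "(bs @ [T]) @ seg (Suc p) (Suc p + Suc (n - j)) = (bs @ T # ?Oms) @ [sel (Suc n) j]"
      using seg_Suc[of "Suc p" p1] seg2(1) seg3(2) by (simp add: p1_def)
    then have "papp (tup_inner (Suc n)) 0 (args_env ((bs @ [T]) @ seg (Suc p) (Suc p + Suc (n - j))))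
      = apps (sel (Suc n) j) (bs @ T # ?Oms)"
      using papp_tup_full[of "bs @ T # ?Oms" "Suc n" "sel (Suc n) j"] bs(1) jn by simp
    \<comment> \<open>As \<open>j < n\<close>, the last argument of the selector is an
      \<open>Om\<close>; it is split off to be compared with the preceding entry, the selector
      itself.\<close>
    also have "bs @ T # ?Oms = (bs @ T # replicate d Om) @ [Om]"
      using that(1)[symmetric] by (simp add: replicate_append_same)
    finally have "papp (tup_inner (Suc n)) 0 (args_env ((bs @ [T]) @ seg (Suc p) (Suc p + Suc (n - j))))
      = apps (sel (Suc n) j) (bs @ T # replicate d Om) \<cdot> Om" by simp
    moreover have "Suc p + Suc (n - j) = Suc p1" by (simp add: p1_def)
    ultimately have to_sel: "move\<^sup>*\<^sup>* (p, X \<cdot> k \<cdot> f) (Suc p1, apps (sel (Suc n) j) (bs @ T # replicate d Om) \<cdot> Om)"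
      using rtranclp_trans[OF 1 moves_papp[of "Suc p" "tup_inner (Suc n)" 0 "Suc (n - j)" "bs @ [T]", unfolded add_0]]
      by (simp only:)
    obtain e where e: "whs (apps (sel (Suc n) j) (bs @ T # replicate d Om)) (Abs e)"
      "\<And>x. subst e x 0 = ((bs @ T # replicate d Om) @ [x]) ! j"
    proof (rule whs_sel_part[of j "Suc n" "bs @ T # replicate d Om"])
      show "Suc (length (bs @ T # replicate d Om)) = Suc n" using jn bs(1) dn by simp
      show "j < Suc n" using jn by simp
    qed (rule that)
    have "\<not> Om \<simeq> sel (Suc n) j"
    proof
      assume "Om \<simeq> sel (Suc n) j"
      moreover have "hn (sel (Suc n) j)" by (simp add: sel_def hn_Abs_pow del: funpow.simps)
      ultimately show False using eqv_hn not_hn_Om by blast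
    qed
    then have "admissible (Suc p1) (apps (sel (Suc n) j) (bs @ T # replicate d Om)) Om"
      using inner' p1q seg3(2) by (intro inner) (simp_all add: p1_def)
    from moves_beta[OF e(1) this] have "move\<^sup>+\<^sup>+ (Suc p1, apps (sel (Suc n) j) (bs @ T # replicate d Om) \<cdot> Om) (Suc p1, T)"
      using bs(1) by (simp add: e(2) nth_append)
    with to_sel have to_T: "move\<^sup>*\<^sup>* (p, X \<cdot> k \<cdot> f) (Suc p1, T)" by simp
    have "\<exists>k'. closed k' \<and> beta_conv k' (church (z m)) \<and>
      move\<^sup>*\<^sup>* (Suc p1, Theta \<cdot> GM S (tup (Suc (z m))) \<cdot> (S \<cdot> k) \<cdot> f) (start (Suc m), f \<cdot> k')"
    proof (rule IH)
      show "d = z m - Suc j" "Suc j \<le> z m" using that(1) jn by (simp_all add: n_def)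
      show "closed (S \<cdot> k)" using prems'(2) by simp
      show "beta_conv (S \<cdot> k) (church (Suc j))"
        using beta_conv_appR[OF prems'(3)] S_succ by (rule equivclp_trans)
      show "start m < Suc p1" using inner' by (simp add: p1_def)
      show "seg (Suc p1) (start (Suc m)) = descent (z m) (Suc j)" using seg3(3) by (simp add: n_def q_def)
      show "stk (Suc p1 - 1) = tup (Suc (z m)) \<or> (\<exists>l<z m. stk (Suc p1 - 1) = sel (Suc (z m)) l)"
        using seg3(2) jn by (auto simp: n_def)
    qed
    with to_T show ?thesis unfolding T_def X_def n_def q_def by (meson rtranclp_trans)
  qed
qed

text \<open>\<open>\<sigma>\<close> is only convertible to the numeral of the node, as weak head
  reduction leaves the argument formed by \<open>C\<close> unevaluated.\<close>

definition stage :: "nat \<times> trm \<Rightarrow> bool" where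
  "stage Q \<longleftrightarrow> (\<exists>m \<sigma>. Q = (start m, B 1 \<cdot> \<sigma>) \<and> closed \<sigma> \<and> beta_conv \<sigma> (church (sq m)))"

lemma whs_D_num:
  assumes "closed \<sigma>" "beta_conv \<sigma> (church (sq m))"
  shows "whs (D \<cdot> \<sigma> \<cdot> x \<cdot> y) y"
proof -
  have "beta_conv (D \<cdot> \<sigma>) Kstar" using beta_conv_appR[OF assms(2)] D_sq by (rule equivclp_trans)
  then have "beta_conv (D \<cdot> \<sigma> \<cdot> Var 1 \<cdot> Var 0) (Kstar \<cdot> Var 1 \<cdot> Var 0)" by (intro beta_conv_appL)
  also have "beta_conv \<dots> (apps (Var 0) [])" using whs_beta_conv[OF whs_Kstar] by simp
  finally obtain bs where bs: "whs (D \<cdot> \<sigma> \<cdot> Var 1 \<cdot> Var 0) (apps (Var 0) bs)" "length bs = length ([] :: trm list)"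
    by (rule beta_conv_reach)
  have "whs (psub (case_nat y (\<lambda>_. x)) (D \<cdot> \<sigma> \<cdot> Var 1 \<cdot> Var 0)) (psub (case_nat y (\<lambda>_. x)) (apps (Var 0) bs))"
    using bs(1) by (rule whs_psub)
  then show ?thesis using assms(1) bs(2) by simp
qed

lemma stage_step:
  assumes "stage Q"
  shows "\<exists>Q'. stage Q' \<and> move\<^sup>+\<^sup>+ Q Q'"
proof -
  from assms obtain m \<sigma> where Q: "Q = (start m, B 1 \<cdot> \<sigma>)" and \<sigma>: "closed \<sigma>" "beta_conv \<sigma> (church (sq m))"
    unfolding stage_def by blast
  note \<sigma>_eqv = eqv_beta_conv[OF \<sigma>(2)]
  let ?y = "tup (Suc (z m))"
  define f where "f = Abs (B 1 \<cdot> (C \<cdot> \<sigma> \<cdot> Var 0))"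
  have f: "closed f" "shape 2 0 (length (cs m) + length rs + 6) f"
    using \<sigma>(1) shape_W[OF \<sigma>(1) \<sigma>_eqv, of 1] by (simp_all add: f_def closed_mono)
  obtain a b where ab: "whs (B 1) (Abs a)" "subst a \<sigma> 0 = Abs b"
    "\<And>y. subst b y 0 = apps (D \<cdot> \<sigma>) [church 1, Atrm, Atrm, GM S y, church 0,
      Abs (B 1 \<cdot> (C \<cdot> lift \<sigma> 0 \<cdot> Var 0))]"
    by (rule whs_B[OF closed_D closed_C closed_S, of 1 \<sigma>]) (rule that)
  \<comment> \<open>Before the first block there is no preceding entry; before any other it is
    \<open>Kfst\<close>, which differs from every numeral.\<close>
  have "admissible (start m) (B 1) \<sigma>"
  proof (cases m)
    case 0
    have "start 0 = 0" by (simp add: start_def)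
    then show ?thesis using B_1_not_W by (simp add: admissible_def 0)
  next
    case (Suc l)
    then show ?thesis using stk_last[of l] B_1_not_W church_not_Kfst[OF \<sigma>_eqv] by (simp add: admissible_def)
  qed
  from moves_beta[OF ab(1) this] have 1: "move\<^sup>+\<^sup>+ Q (start m, Abs b)" by (simp add: ab(2) Q)
  define h where "h = apps (D \<cdot> \<sigma>) [church 1, Atrm, Atrm, GM S ?y, church 0]"
  have 2: "move (start m, Abs b) (Suc (start m), h \<cdot> f)"
    using pop[of "start m" b] \<sigma>(1) by (simp add: ab(3) seg_first h_def f_def)
  have len: "Suc (start m) < start (Suc m)"
    by (simp add: start_Suc chunk_def descent_def)
  have "\<not> f \<simeq> ?y" using shape_unique[OF f(2) shape_tup[of "[]" "Suc (z m)"]] by auto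
  then have adm: "admissible (Suc (start m)) h f" using len by (intro admissible_inner) (simp_all add: seg_first)
  have "whs (apps (D \<cdot> \<sigma> \<cdot> church 1 \<cdot> Atrm) [Atrm, GM S ?y, church 0]) (apps Atrm [Atrm, GM S ?y, church 0])"
    by (rule whs_apps[OF whs_D_num[OF \<sigma>]])
  then have "whs h (Theta \<cdot> GM S ?y \<cdot> church 0)" by (simp add: h_def Theta_def)
  from moves_red[OF this adm]
  have 3: "move\<^sup>*\<^sup>* (Suc (start m), h \<cdot> f) (Suc (start m), Theta \<cdot> GM S ?y \<cdot> church 0 \<cdot> f)" .
  have "\<exists>k'. closed k' \<and> beta_conv k' (church (z m)) \<and>
      move\<^sup>*\<^sup>* (Suc (start m), Theta \<cdot> GM S ?y \<cdot> church 0 \<cdot> f) (start (Suc m), f \<cdot> k')"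
    by (rule descent_run[OF f]) (simp_all add: seg_rest seg_first)
  then obtain k' where k': "closed k'" "beta_conv k' (church (z m))"
    "move\<^sup>*\<^sup>* (Suc (start m), Theta \<cdot> GM S ?y \<cdot> church 0 \<cdot> f) (start (Suc m), f \<cdot> k')" by blast
  have "admissible (start (Suc m)) f k'"
    unfolding admissible_def f_def
    using church_not_Kfst[OF eqv_beta_conv[OF k'(2)]] stk_last[of m] W_1_not_W[OF \<sigma>(1) \<sigma>_eqv] by simp
  then have 4: "move (start (Suc m), f \<cdot> k') (start (Suc m), B 1 \<cdot> (C \<cdot> \<sigma> \<cdot> k'))"
    using red[OF wh_redex[of "B 1 \<cdot> (C \<cdot> \<sigma> \<cdot> Var 0)" k']] \<sigma>(1) by (simp add: f_def)
  have "beta_conv (C \<cdot> \<sigma> \<cdot> k') (C \<cdot> church (sq m) \<cdot> church (z m))"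
    by (intro beta_conv_app \<sigma>(2) k'(2)) simp
  then have "beta_conv (C \<cdot> \<sigma> \<cdot> k') (church (sq (Suc m)))" using C_step by (rule equivclp_trans)
  then have "stage (start (Suc m), B 1 \<cdot> (C \<cdot> \<sigma> \<cdot> k'))"
    unfolding stage_def using \<sigma>(1) k'(1) by (intro exI[of _ "Suc m"] exI[of _ "C \<cdot> \<sigma> \<cdot> k'"]) simp
  moreover have "move\<^sup>+\<^sup>+ Q (start (Suc m), B 1 \<cdot> (C \<cdot> \<sigma> \<cdot> k'))"
    using 1 2 3 k'(3) 4 by (meson tranclp.trancl_into_trancl tranclp_rtranclp_tranclp)
  ultimately show ?thesis by blast
qed

lemma not_bb_B_1: "\<not> bb 0 (B 1 \<cdot> church (sq 0))"
proof
  assume bb: "bb 0 (B 1 \<cdot> church (sq 0))"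
  \<comment> \<open>\<open>I\<close> holds on the way to a stage. Every stage leads to another by at
    least one move, so there is always a next move that preserves \<open>I\<close>.\<close>
  define I where "I Q \<longleftrightarrow> (\<exists>Q'. stage Q' \<and> move\<^sup>*\<^sup>* Q Q')" for Q
  have I: "\<exists>Q'. move Q Q' \<and> I Q'" if "I Q" for Q
  proof -
    from that obtain Q' where Q': "stage Q'" "move\<^sup>*\<^sup>* Q Q'" unfolding I_def by blast
    with stage_step obtain Q'' where "stage Q''" "move\<^sup>+\<^sup>+ Q' Q''" by blast
    with Q'(2) have "stage Q''" "move\<^sup>+\<^sup>+ Q Q''" by simp_all
    then show ?thesis unfolding I_def by (meson tranclpD)
  qed
  have "stage (start 0, B 1 \<cdot> church (sq 0))"
    unfolding stage_def by (intro exI[of _ 0] exI[of _ "church (sq 0)"]) simp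
  then have "I (0, B 1 \<cdot> church (sq 0))" unfolding I_def by (auto simp: start_def)
  from runs_forever_not_bb[of I, OF I bb this] show False by (simp add: seg_def)
qed

text \<open>With a hole in place of \<open>W 0\<close>, the term fed with the whole first block is
  equivalent to the hole applied to its numeral; \<open>bb_reach\<close> makes this a run.\<close>

lemma bb_B_0: "bb 0 (B 0 \<cdot> church (sq 0))"
proof -
  let ?k = "start (Suc 0)"
  let ?t = "apps (apps (D \<cdot> church (sq 0)) [church 0, Atrm, Atrm, GM S (stk (start 0)), church 0, Var 0])
    (seg (Suc (start 0)) ?k)"
  have s0: "start 0 = 0" by (simp add: start_def)
  have "bb ?k (subst ?t (W 0) 0)"
  proof (rule bb_reach)
    show "closed_at 1 ?t"
      using closed_at_GM[OF closed_S closed_mono[OF closed_stk]] by (auto simp: closed_mono)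
    show "?t \<simeq> apps (Var 0) (church (z 0) # seg ?k ?k)"
      using eqv_calls[OF D_sq_eqv] by (simp add: seg_def)
    show "closed (W 0)" by (rule closed_W)
  qed simp_all
  also have "subst ?t (W 0) 0 = apps (apps (D \<cdot> church (sq 0)) [church 0, Atrm, Atrm, GM S (stk 0), church 0, W 0])
    (seg (Suc 0) ?k)"
    using closed_at_GM[OF closed_S closed_stk] by (simp add: s0)
  finally have 1: "bb ?k \<dots>" .
  have "whs (B 0 \<cdot> church (sq 0) \<cdot> stk 0)
    (apps (D \<cdot> church (sq 0)) [church 0, Atrm, Atrm, GM S (stk 0), church 0, W 0])"
    using whs_B_app[of D C S 0 "church (sq 0)" "stk 0"] by (simp add: W_def)
  from bb_whs[OF whs_apps[OF this] 1]
  have "bb ?k (apps (B 0 \<cdot> church (sq 0) \<cdot> stk 0) (seg (Suc 0) ?k))" .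
  moreover have "seg 0 ?k = stk 0 # seg (Suc 0) ?k"
    using start_less[of 0] by (simp add: seg_def upt_conv_Cons s0)
  ultimately have "bb (0 + ?k) (apps (B 0 \<cdot> church (sq 0)) (seg 0 (0 + ?k)))" by simp
  then show ?thesis by (rule bb_feeds)
qed

theorem not_omega_eq: "\<not> B 0 \<cdot> church (sq 0) =\<^sub>\<omega> B 1 \<cdot> church (sq 0)"
proof
  assume "B 0 \<cdot> church (sq 0) =\<^sub>\<omega> B 1 \<cdot> church (sq 0)"
  from omega_sim[OF this] have
    "bb 0 (subst (Var 0) (B 0 \<cdot> church (sq 0)) 0) = bb 0 (subst (Var 0) (B 1 \<cdot> church (sq 0)) 0)"
    unfolding sim_def by (metis closed_at.simps(1) zero_less_one)
  with bb_B_0 not_bb_B_1 show False by simp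
qed

end

section \<open>Infinite branches of the tree of unsecured sequence numbers\<close>

lemma unsecured_prefix:
  assumes "inj code" "code ys \<in> unsecured_tree code R n" "prefix xs ys"
  shows "code xs \<in> unsecured_tree code R n"
proof -
  have "seq_less code s' (code ys)" if "seq_less code s' (code xs)" for s'
  proof -
    from that obtain us vs where "s' = code us" "code xs = code vs" "strict_prefix us vs"
      unfolding seq_less_def by blast
    moreover from this have "vs = xs" using injD[OF assms(1)] by metis
    ultimately have "strict_prefix us ys" using assms(3) prefix_order.less_le_trans by blast
    with \<open>s' = code us\<close> show ?thesis unfolding seq_less_def by blast
  qed
  with assms(2) show ?thesis unfolding unsecured_tree_def unsecured_def by blast
qed

text \<open>A chain may skip lengths. Its node number i has length at least i and the tree is closed
  under initial segments, so cutting node \<open>l + m\<close> to length \<open>l + m\<close> gives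
  a branch that grows by one entry at a time.\<close>

lemma infinite_branch:
  assumes inj: "inj code" and T: "T = unsecured_tree code R n"
    and s: "s \<in> range code" and nwf: "\<not> well_founded_tree code (subtree code T s)"
  obtains L x where "code (L 0) = s" "\<And>m. L (Suc m) = L m @ [x m]" "\<And>m. code (L m) \<in> T"
proof -
  from nwf obtain g where g: "\<And>i. g i \<in> subtree code T s" "\<And>i. seq_less code (g i) (g (Suc i))"
    unfolding well_founded_tree_def by blast
  have gT: "g i \<in> T" "g i = s \<or> seq_less code s (g i)" for i
    using g(1)[of i] unfolding subtree_def by (auto split: if_splits)
  from s obtain ls where ls: "s = code ls" by blast
  have "\<exists>G. \<forall>i. g i = code (G i)"
  proof (intro choice allI)
    show "\<exists>y. g i = code y" for i using g(2)[of i] unfolding seq_less_def by blast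
  qed
  then obtain G where G: "\<And>i. g i = code (G i)" by blast
  have less: "strict_prefix xs ys" if "seq_less code (code xs) (code ys)" for xs ys
    using that injD[OF inj] unfolding seq_less_def by metis
  have lsG: "prefix ls (G i)" for i
  proof (cases "g i = s")
    case True
    then show ?thesis using injD[OF inj, of "G i" ls] by (simp add: G ls)
  next
    case False
    then have "seq_less code (code ls) (code (G i))" using gT(2)[of i] by (simp add: G ls)
    then show ?thesis by (rule prefix_order.less_imp_le[OF less])
  qed
  have step: "strict_prefix (G i) (G (Suc i))" for i using g(2)[of i] unfolding G by (rule less)
  have len: "i \<le> length (G i)" for i
  proof (induction i)
    case (Suc i)
    then show ?case using prefix_length_less[OF step[of i]] by linarith
  qed simp
  define l where "l = length ls"
  define L where "L m = take (l + m) (G (l + m))" for m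
  show thesis
  proof (rule that)
    show "code (L 0) = s" using lsG[of l] by (auto simp: L_def l_def ls prefix_def)
    show "code (L m) \<in> T" for m
      unfolding T by (rule unsecured_prefix[OF inj, of "G (l + m)"])
        (use gT(1)[of "l + m"] in \<open>simp_all add: G T L_def take_is_prefix\<close>)
    show "L (Suc m) = L m @ [G (Suc (l + m)) ! (l + m)]" for m
    proof -
      obtain ys where "G (Suc (l + m)) = G (l + m) @ ys" using step[of "l + m"] by (auto simp: strict_prefix_def prefix_def)
      then have "take (l + m) (G (Suc (l + m))) = L m" using len[of "l + m"] by (simp add: L_def)
      moreover have "l + m < length (G (Suc (l + m)))" using len[of "Suc (l + m)"] by simp
      ultimately show ?thesis by (simp add: L_def take_Suc_conv_app_nth)
    qed
  qed
qed

theorem theorem8p6: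
  fixes code :: "nat list \<Rightarrow> nat"
    and P :: "nat \<Rightarrow> bool" and R :: "nat \<Rightarrow> nat \<Rightarrow> bool" and n :: nat
    and T :: "nat set" and C S D :: trm
  assumes coding: "effective_coding code"
    and R_recursive: "recursive_rel R"
    and P_def: "\<And>k. P k \<longleftrightarrow> (\<forall>f. \<exists>m. R (bar code f m) k)"
    and T_def: "T = unsecured_tree code R n"
    and C_closed: "closed C"
    and C_concat: "represents_concatenation code C"
    and C_nf: "\<And>s. s \<in> range code \<Longrightarrow>
      \<exists>v. has_betaOm_nf (C \<cdot> church s \<cdot> Var 0) v \<and> begins_with 0 v"
    and S_closed: "closed S"
    and S_succ: "\<And>k. beta_conv (S \<cdot> church k) (church (Suc k))"
    and D_closed: "closed D"
    and D_nf: "\<And>m. \<exists>v. has_betaOm_nf (D \<cdot> Var 0 \<cdot> church m) v \<and> begins_with 0 v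
      \<and> church m \<in> subterms v"
    and D_in: "\<And>s. s \<in> T \<Longrightarrow> D \<cdot> church s =\<^sub>\<omega> Kstar"
    and D_out: "\<And>s. s \<in> range code \<Longrightarrow> s \<notin> T \<Longrightarrow> D \<cdot> church s =\<^sub>\<omega> Om"
    and D_head: "\<And>s. s \<in> T \<Longrightarrow> closed_head_step\<^sup>*\<^sup>* (D \<cdot> church s) Kstar"
  shows "\<forall>s\<in>range code. Btrm D C S 0 \<cdot> church s =\<^sub>\<omega> Btrm D C S 1 \<cdot> church s
           \<longrightarrow> well_founded_tree code (subtree code T s)"
proof (intro ballI impI)
  fix s assume s: "s \<in> range code" and eq: "Btrm D C S 0 \<cdot> church s =\<^sub>\<omega> Btrm D C S 1 \<cdot> church s"
  show "well_founded_tree code (subtree code T s)"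
  proof (rule ccontr)
    assume nwf: "\<not> well_founded_tree code (subtree code T s)"
    have "inj code" using coding by (simp add: effective_coding_def)
    then obtain L x where L: "code (L 0) = s" "\<And>m. L (Suc m) = L m @ [x m]" "\<And>m. code (L m) \<in> T"
      using T_def s nwf by (rule infinite_branch) (rule that)
    \<comment> \<open>Depending on the reading of concatenation, the appended numeral is the code of
      a one-element sequence or its entry.\<close>
    have "\<exists>z. \<forall>m. beta_conv (C \<cdot> church (code (L m)) \<cdot> church (z m)) (church (code (L (Suc m))))"
      using C_concat unfolding represents_concatenation_def
    proof
      assume "\<forall>xs ys. beta_conv (C \<cdot> church (code xs) \<cdot> church (code ys)) (church (code (xs @ ys)))"
      then show ?thesis unfolding L(2) by (intro exI[of _ "\<lambda>m. code [x m]"]) simp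
    next
      assume "\<forall>xs z. beta_conv (C \<cdot> church (code xs) \<cdot> church z) (church (code (xs @ [z])))"
      then show ?thesis unfolding L(2) by (intro exI[of _ x]) simp
    qed
    then obtain z where z: "\<And>m. beta_conv (C \<cdot> church (code (L m)) \<cdot> church (z m)) (church (code (L (Suc m))))"
      by blast
    have "\<exists>c. C \<cdot> church (code (L m)) \<cdot> Var 0 \<simeq> apps (Var 0) c \<and> (\<forall>r\<in>set c. closed_at 1 r)" for m
    proof -
      obtain v where v: "has_betaOm_nf (C \<cdot> church (code (L m)) \<cdot> Var 0) v" "begins_with 0 v"
        using C_nf[of "code (L m)"] by blast
      have "closed_at 1 (C \<cdot> church (code (L m)) \<cdot> Var 0)" using C_closed by (simp add: closed_mono)
      with v show ?thesis by (rule has_nf_begins) blast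
    qed
    then obtain cs where cs: "\<And>m. C \<cdot> church (code (L m)) \<cdot> Var 0 \<simeq> apps (Var 0) (cs m)"
      "\<And>m r. r \<in> set (cs m) \<Longrightarrow> closed_at 1 r" by metis
    obtain rs where rs: "whs (D \<cdot> Var 0) (apps (Var 0) rs)" "\<And>r. r \<in> set rs \<Longrightarrow> closed_at 1 r"
      using D_closed D_nf D_head[OF L(3)[of 0]] by (rule D_head_variable) (rule that)
    interpret branch C S D rs cs "\<lambda>m. code (L m)" z
    proof
      show "beta_conv (D \<cdot> church (code (L m))) Kstar" for m
        by (rule closed_head_steps_beta_conv[OF D_head[OF L(3)]])
    qed (fact C_closed S_closed D_closed S_succ rs cs z)+
    show False using not_omega_eq eq by (simp add: L(1))
  qed
qed

end
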